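(* Let $\mathcal{P}\subset\mathbb{R}[X_0,\ldots,X_n]$ be a finite set of homogeneous polynomials such that $\max_{P\in\mathcal{P}}\deg(P)\le d$, and let $0\le m\le n-1$ be an integer. (1) Let $y\in\mathbb{R}\mathrm{P}^n$ and denote by $H\simeq\mathbb{R}\mathrm{P}^{n-1}$ the hyperplane $H:=y^\perp$. Let $V\subset\mathbb{R}\mathrm{P}^n\setminus H\simeq\mathbb{R}^n$ be the common zero set of $\mathcal{P}$ in $\mathbb{R}\mathrm{P}^n\setminus H$ and assume that $\dim_{\mathbb{R}}V\le m$. Then there exist a one-parameter family of real algebraic sets $\{V_t\}_{t>0}$ in $\mathbb{R}^n$ and $t_0>0$ such that for every $0<t<t_0$ the set $V_t$ is a nonsingular complete intersection in $\mathbb{R}^n$ defined by $n-m$ (affine) polynomials of degree bounded by $2d$, and such that for every ball $B(0,R)$ in $\mathbb{R}^n$ with $R>0$: $$\lim_{t\to0}\left(V_t\cap B(0,R)\right)=V\cap B(0,R).$$ (2) Let $Z\subset S^n$ be the common zero set of $\mathcal{P}$ in $S^n$ and assume that $\dim_{\mathbb{R}}(Z)\le m$. Then there exist a one-parameter family of real algebraic sets $\{Z_t\}_{t>0}$ in $S^n$ and $t_0>0$ such that for every $0<t<t_0$ the set $Z_t$ is a nonsingular complete intersection in $S^n$ defined by $n-m$ homogeneous polynomials of degree bounded by $2d$ and such that $$\lim_{t\to0}Z_t\supseteq Z.$$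
   Context: $\mathbb{R}^n$ carries the Euclidean metric and $S^n\subset\mathbb{R}^{n+1}$ the geodesic metric $\mathrm{dist}(a,b)=\arccos\langle a,b\rangle$; balls are closed. For $y\in\mathbb{R}\mathrm{P}^n$, $\mathbb{R}\mathrm{P}^n\setminus y^\perp$ is identified with $\mathbb{R}^n$ through the standard affine chart: after an orthogonal change of coordinates with $y=[1,0,\ldots,0]$ and $H=\{X_0=0\}$, $[x_0,\ldots,x_n]\mapsto(x_1/x_0,\ldots,x_n/x_0)$. Hausdorff limits: for a closed set $C$ in a metric space $X$ and $\varepsilon\ge0$, $\mathcal{U}_X(C,\varepsilon)=\bigcup_{x\in C}B(x,\varepsilon)$. For a family $\{C_t\}_{t>0}$ of closed sets, $\lim_{t\to0}C_t=C_0$ means that $C_0$ is closed and for every $\varepsilon>0$ there exists $t_\varepsilon>0$ such that for all $0<t<t_\varepsilon$ one has $C_t\subseteq\mathcal{U}_X(C_0,\varepsilon)$ and $C_0\subseteq\mathcal{U}_X(C_t,\varepsilon)$. The notation $\lim_{t\to0}C_t\supseteq C$ means that $\{C_t\}$ converges in this sense to some closed set $C_0$ and $C_0\supseteq C$. A nonsingular complete intersection in $\mathbb{R}^n$ (resp. $S^n$) defined by $n-m$ polynomials is the common zero set, in $\mathbb{R}^n$ (resp. $S^n$), of $n-m$ polynomials whose differentials (resp. whose differentials restricted to the tangent space of $S^n$) are linearly independent at every point of this common zero set; in particular it is empty or a smooth submanifold of dimension $m$. *)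

theory Defs
  imports
    "HOL-Analysis.Analysis"
    "HOL-Library.Poly_Mapping"
    "HOL-Algebra.Algebraic_Closure_Type"
begin

section \<open>Real polynomials in finitely many variables\<close>

text \<open>
  A polynomial is a finitely supported map from exponent vectors to coefficients; its ring
  structure is the one of \<^typ>\<open>('v \<Rightarrow>\<^sub>0 nat) \<Rightarrow>\<^sub>0 real\<close>. The variables are indexed by a finite type:
  \<^typ>\<open>'n\<close> for affine $n$-space, where $n$ is the cardinality of \<^typ>\<open>'n\<close>, and \<^typ>\<open>'n option\<close> for
  $n+1$ homogeneous coordinates, where \<^term>\<open>None\<close> is the index of $X_0$ and the indices
  \<^term>\<open>Some i\<close> are those of $X_1,\dots,X_n$.
\<close>

type_synonym 'v rpoly = "('v \<Rightarrow>\<^sub>0 nat) \<Rightarrow>\<^sub>0 real"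

definition monom_degree :: "('v::finite \<Rightarrow>\<^sub>0 nat) \<Rightarrow> nat" where
  "monom_degree a = (\<Sum>i\<in>UNIV. Poly_Mapping.lookup a i)"

text \<open>The zero polynomial gets degree 0; only upper bounds on degrees are used.\<close>

definition total_degree :: "'v::finite rpoly \<Rightarrow> nat" where
  "total_degree p = Max (insert 0 (monom_degree ` Poly_Mapping.keys p))"

definition homogeneous :: "'v::finite rpoly \<Rightarrow> bool" where
  "homogeneous p \<longleftrightarrow> (\<exists>k. \<forall>a\<in>Poly_Mapping.keys p. monom_degree a = k)"

definition eval_poly :: "'v::finite rpoly \<Rightarrow> real ^ 'v \<Rightarrow> real" where
  "eval_poly p x =
     (\<Sum>a\<in>Poly_Mapping.keys p. Poly_Mapping.lookup p a * (\<Prod>i\<in>UNIV. (x $ i) ^ Poly_Mapping.lookup a i))"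

definition algebraic_set :: "(real ^ 'v::finite) set \<Rightarrow> bool" where
  "algebraic_set A \<longleftrightarrow> (\<exists>\<P>. finite \<P> \<and> A = {x. \<forall>P\<in>\<P>. eval_poly P x = 0})"


section \<open>Dimension\<close>

text \<open>
  The dimension of a real algebraic set $A$ is the Krull dimension of its ring of polynomial
  functions, the quotient of the polynomial ring by the ideal of all polynomials vanishing on $A$
  (Bochnak, Coste, Roy, Real Algebraic Geometry). The zero ring, hence the empty set, has
  dimension \<^term>\<open>-\<infinity>\<close>.
\<close>

definition krull_dim :: "('a, 'b) ring_scheme \<Rightarrow> ereal" where
  "krull_dim R = Sup {ereal (real k) | k. \<exists>\<pp>.
     (\<forall>i\<le>k. primeideal (\<pp> i) R) \<and> (\<forall>i<k. \<pp> i \<subset> \<pp> (Suc i))}"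

definition vanishing_ideal :: "(real ^ 'v::finite) set \<Rightarrow> 'v rpoly set" where
  "vanishing_ideal A = {p. \<forall>x\<in>A. eval_poly p x = 0}"

definition real_dim :: "(real ^ 'v::finite) set \<Rightarrow> ereal" where
  "real_dim A = krull_dim ((ring_of_type_algebra :: 'v rpoly ring) Quot vanishing_ideal A)"


section \<open>Nonsingular complete intersections\<close>

text \<open>
  \<^term>\<open>T x\<close> is the subspace to which the differentials at \<^term>\<open>x\<close> are restricted before they are
  required to be linearly independent.
\<close>

definition nonsingular_zero_set ::
  "(real ^ 'v::finite) set \<Rightarrow> (real ^ 'v \<Rightarrow> (real ^ 'v) set) \<Rightarrow> nat \<Rightarrow> (nat \<Rightarrow> 'v rpoly) \<Rightarrow> (real ^ 'v) set \<Rightarrow> bool"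
where
  "nonsingular_zero_set M T k Q V \<longleftrightarrow>
     V = {x\<in>M. \<forall>i<k. eval_poly (Q i) x = 0} \<and>
     (\<forall>x\<in>V. \<forall>c :: nat \<Rightarrow> real.
        (\<forall>v\<in>T x. (\<Sum>i<k. c i * frechet_derivative (eval_poly (Q i)) (at x) v) = 0) \<longrightarrow> (\<forall>i<k. c i = 0))"

definition nonsingular_ci_affine ::
  "nat \<Rightarrow> (nat \<Rightarrow> 'v rpoly) \<Rightarrow> (real ^ 'v::finite) set \<Rightarrow> bool" where
  "nonsingular_ci_affine = nonsingular_zero_set UNIV (\<lambda>x. UNIV)"

definition nonsingular_ci_sphere ::
  "nat \<Rightarrow> (nat \<Rightarrow> 'v rpoly) \<Rightarrow> (real ^ 'v::finite) set \<Rightarrow> bool" where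
  "nonsingular_ci_sphere = nonsingular_zero_set (sphere 0 1) (\<lambda>x. {v. x \<bullet> v = 0})"


section \<open>Hausdorff limits\<close>

definition closed_nbhd :: "'a set \<Rightarrow> ('a \<Rightarrow> 'a \<Rightarrow> real) \<Rightarrow> 'a set \<Rightarrow> real \<Rightarrow> 'a set" where
  "closed_nbhd M \<delta> C e = (\<Union>x\<in>C. Metric_space.mcball M \<delta> x e)"

text \<open>
  The limit as $t\to 0$ of a family of closed sets indexed by $t>0$ in the metric space \<^term>\<open>M\<close>
  with distance \<open>\<delta>\<close>; the values of \<^term>\<open>C\<close> at $t\le 0$ are irrelevant.
\<close>

definition hausdorff_limit ::
  "'a set \<Rightarrow> ('a \<Rightarrow> 'a \<Rightarrow> real) \<Rightarrow> (real \<Rightarrow> 'a set) \<Rightarrow> 'a set \<Rightarrow> bool" where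
  "hausdorff_limit M \<delta> C C0 \<longleftrightarrow>
     (\<forall>t>0. closedin (Metric_space.mtopology M \<delta>) (C t)) \<and>
     closedin (Metric_space.mtopology M \<delta>) C0 \<and>
     (\<forall>e>0. \<exists>te>0. \<forall>t. 0 < t \<and> t < te \<longrightarrow>
        C t \<subseteq> closed_nbhd M \<delta> C0 e \<and> C0 \<subseteq> closed_nbhd M \<delta> (C t) e)"

text \<open>
  The value 0 off the unit sphere is irrelevant; \<^locale>\<open>Metric_space\<close> asks for a distance that is
  nonnegative everywhere.
\<close>

definition geodesic_dist :: "'a::real_inner \<Rightarrow> 'a \<Rightarrow> real" where
  "geodesic_dist a b = (if norm a = 1 \<and> norm b = 1 then arccos (a \<bullet> b) else 0)"

lemma inner_unit_bounds:
  fixes a b :: "'a::real_inner"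
  assumes "norm a = 1" "norm b = 1"
  shows "-1 \<le> a \<bullet> b" "a \<bullet> b \<le> 1"
  using Cauchy_Schwarz_ineq2[of a b] assms by auto

lemma geodesic_dist_triangle:
  fixes a b c :: "'a::real_inner"
  assumes "norm a = 1" "norm b = 1" "norm c = 1"
  shows "arccos (a \<bullet> c) \<le> arccos (a \<bullet> b) + arccos (b \<bullet> c)"
proof (cases "arccos (a \<bullet> b) + arccos (b \<bullet> c) \<le> pi")
  case False
  then show ?thesis
    using arccos_ubound[OF inner_unit_bounds[OF assms(1,3)]] by linarith
next
  case True
  note ab = inner_unit_bounds[OF assms(1,2)] and bc = inner_unit_bounds[OF assms(2,3)]
    and ac = inner_unit_bounds[OF assms(1,3)]
  define u where "u = a - (a \<bullet> b) *\<^sub>R b"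
  define w where "w = c - (b \<bullet> c) *\<^sub>R b"
  have un: "a \<bullet> a = 1" "b \<bullet> b = 1" "c \<bullet> c = 1"
    using assms by (simp_all add: dot_square_norm)
  have uw: "u \<bullet> w = a \<bullet> c - (a \<bullet> b) * (b \<bullet> c)"
    by (simp add: u_def w_def inner_diff_left inner_diff_right un inner_commute algebra_simps)
  have nu: "norm u = sqrt (1 - (a \<bullet> b)\<^sup>2)"
    by (simp add: norm_eq_sqrt_inner u_def inner_diff_left inner_diff_right un inner_commute
        power2_eq_square algebra_simps)
  have nw: "norm w = sqrt (1 - (b \<bullet> c)\<^sup>2)"
    by (simp add: norm_eq_sqrt_inner w_def inner_diff_left inner_diff_right un inner_commute
        power2_eq_square algebra_simps)
  have "cos (arccos (a \<bullet> b) + arccos (b \<bullet> c)) = (a \<bullet> b) * (b \<bullet> c) - norm u * norm w"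
    using ab bc by (simp add: cos_add sin_arccos nu nw)
  also have "\<dots> \<le> a \<bullet> c"
    using Cauchy_Schwarz_ineq2[of u w] uw by linarith
  finally have "arccos (a \<bullet> c) \<le> arccos (cos (arccos (a \<bullet> b) + arccos (b \<bullet> c)))"
    using ac by (intro arccos_le_arccos) auto
  also have "\<dots> = arccos (a \<bullet> b) + arccos (b \<bullet> c)"
    using True arccos_lbound[OF ab] arccos_lbound[OF bc] by (intro arccos_cos) auto
  finally show ?thesis .
qed

lemma Metric_space_geodesic_dist:
  "Metric_space (sphere (0 :: 'a::real_inner) 1) geodesic_dist"
proof
  fix x y :: 'a
  show "0 \<le> geodesic_dist x y"
    by (auto simp: geodesic_dist_def intro!: arccos_lbound inner_unit_bounds)
  show "geodesic_dist x y = geodesic_dist y x"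
    by (simp add: geodesic_dist_def inner_commute)
next
  fix x y :: 'a
  assume "x \<in> sphere 0 1" "y \<in> sphere 0 1"
  then have n: "norm x = 1" "norm y = 1" by auto
  have "arccos (x \<bullet> y) = 0 \<longleftrightarrow> x \<bullet> y = 1"
    using cos_arccos[OF inner_unit_bounds[OF n]] by (metis arccos_1 cos_zero)
  also have "\<dots> \<longleftrightarrow> x = y"
    using norm_cauchy_schwarz_eq[of x y] n by (auto simp: dot_square_norm)
  finally show "geodesic_dist x y = 0 \<longleftrightarrow> x = y"
    using n by (simp add: geodesic_dist_def)
next
  fix x y z :: 'a
  assume "x \<in> sphere 0 1" "y \<in> sphere 0 1" "z \<in> sphere 0 1"
  then show "geodesic_dist x z \<le> geodesic_dist x y + geodesic_dist y z"
    using geodesic_dist_triangle[of x y z] by (simp add: geodesic_dist_def)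
qed


section \<open>Projective space and affine charts\<close>

definition proj_space :: "(real ^ 'k::finite) set set" where
  "proj_space = {L. subspace L \<and> dim L = 1}"

text \<open>The projective hyperplane $y^\perp$.\<close>

definition polar_hyperplane :: "(real ^ 'k::finite) set \<Rightarrow> (real ^ 'k) set set" where
  "polar_hyperplane y = {L\<in>proj_space. \<forall>a\<in>L. \<forall>b\<in>y. a \<bullet> b = 0}"

text \<open>Meant for homogeneous polynomials, for which vanishing on the line \<^term>\<open>L\<close> is the same as
  vanishing at one nonzero vector of \<^term>\<open>L\<close>.\<close>

definition proj_zero_set :: "'k::finite rpoly set \<Rightarrow> (real ^ 'k) set set" where
  "proj_zero_set \<P> = {L\<in>proj_space. \<forall>P\<in>\<P>. \<forall>x\<in>L. eval_poly P x = 0}"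

text \<open>
  An orthogonal change of coordinates after which \<^term>\<open>y\<close> is the point $[1,0,\dots,0]$: the new
  coordinates of \<^term>\<open>x\<close> are the components of \<^term>\<open>U x\<close>.
\<close>

definition adapted_coords ::
  "(real ^ 'n::finite option) set \<Rightarrow> (real ^ 'n option \<Rightarrow> real ^ 'n option) \<Rightarrow> bool" where
  "adapted_coords y U \<longleftrightarrow> orthogonal_transformation U \<and> U ` y = span {axis None 1}"

text \<open>The value does not depend on the chosen vector \<^term>\<open>x\<close> on the line \<^term>\<open>L\<close>.\<close>

definition affine_chart ::
  "(real ^ 'n::finite option \<Rightarrow> real ^ 'n option) \<Rightarrow> (real ^ 'n option) set \<Rightarrow> real ^ 'n" where
  "affine_chart U L = (let x = (SOME x. x \<in> L \<and> x \<noteq> 0) in (\<chi> i. U x $ Some i / U x $ None))"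

end

theory Submission
  imports Defs
begin

text \<open>
  The approximants for different \<open>t\<close> need not be related. It is therefore enough to find, for each
  prescribed error, one nonsingular complete intersection which on a given compact set is that close
  to \<open>V\<close> and to which \<open>V\<close> is that close. The equations of \<open>V\<close> are first combined into a single
  nonnegative form \<open>H\<close> of degree \<open>2d\<close>, the sum of the \<open>|x|^(2 (d - deg P)) P(x)^2\<close>, and everything happens with
  forms of degree \<open>2d\<close> in \<open>n + 1\<close> variables, read in the chart \<open>x\<^sub>0 = 1\<close>.

  The first of the \<open>n - m\<close> equations is a small modification \<open>f\<close> of \<open>H - t |x|^(2d)\<close>. Its zeros satisfy
  \<open>H \<le> 2 t |x|^(2d)\<close>, so by compactness they are close to \<open>V\<close> when \<open>t\<close> is small. The other \<open>n - m - 1\<close>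
  equations are the partial derivatives of \<open>f\<close> in the coordinates outside a set \<open>I\<close> of \<open>m + 1\<close>
  coordinates; together they define the polar variety of \<open>f = 0\<close> for the projection to the coordinates
  in \<open>I\<close>. What has to be shown is that there is a common zero near each of finitely many given points
  of \<open>V\<close>. Because \<open>V\<close> has dimension at most \<open>m\<close>, after a generic change of coordinates no other point
  of \<open>V\<close> on a small sphere around the given point \<open>x\<^sub>0\<close> has the same projection as \<open>x\<^sub>0\<close>, and there are
  points arbitrarily close to the projection of \<open>x\<^sub>0\<close> that are not projections of points of \<open>V\<close>. Walk
  from the projection of \<open>x\<^sub>0\<close>, over which there are points with \<open>f < 0\<close>, towards such a missed point:
  the last point over which the set \<open>f \<le> 0\<close> is met gives a polar point
  (\<open>polar_point_of_boundary_of_projection\<close>, \<open>polar_point_near_zero\<close>).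

  This polar point may be degenerate. Adding to \<open>f\<close> a small multiple of a quadratic polynomial makes
  the derivative of the polar system invertible there, and then Brouwer's fixed point theorem keeps a
  zero nearby under all further small perturbations (\<open>eventually_stable_zero_kick\<close>); so the
  given points can be treated one after the other (\<open>stable_polar_systems\<close>). Finally every equation is
  perturbed by a diagonal form \<open>\<Sum>\<^sub>k B\<^sub>i\<^sub>k x\<^sub>k^(2d)\<close>. The matrices \<open>B\<close> for which the resulting system has a
  singular zero are covered by finitely many differentiable images of subsets of a hyperplane, hence
  are negligible (\<open>negligible_singular_perturbations\<close>). This gives \<open>nonsingular_approximation\<close>.

  The Krull dimension is used only through the notion of a \<open>thin\<close> set: by the characterisation of
  Krull dimension of Coquand and Lombardi, dimension at most \<open>m\<close> provides for any \<open>m + 1\<close> polynomials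
  a polynomial identity on \<open>V\<close> which prevents their values from lying simultaneously in certain
  intervals (\<open>small_values_avoided_of_real_dim\<close>).

  For the limits in balls, \<open>V\<^sub>t\<close> is obtained from an approximation with error \<open>t\<^sup>2\<close> by shrinking with the
  factor \<open>1 - t\<close>, so that points of \<open>V\<close> on the boundary of a ball are approximated from inside
  (\<open>affine_family\<close>). On the sphere, coordinates are rotated such that a finite net of \<open>Z\<close> avoids the
  hyperplane at infinity of the chart, and the limit is \<open>Z\<close> itself (\<open>sphere_family\<close>). Nonsingularity
  passes from the cone to the chart and to the sphere because, by Euler's identity, the differentials
  of forms vanish on the radial direction at their zeros.
\<close>

(* The infix dollar sign denotes components of vectors only. *)
no_notation Formal_Power_Series.fps_nth (infixl \<open>$\<close> 75)

section \<open>Homogeneous polynomial functions\<close>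

text \<open>
  The functions given by homogeneous polynomials of degree \<open>D\<close>, generated so that closure properties
  follow by induction without any reference to coefficients.
\<close>

inductive hom_poly :: "nat \<Rightarrow> (real ^ 'v::finite \<Rightarrow> real) \<Rightarrow> bool" where
  const: "hom_poly 0 (\<lambda>x. c)"
| zero: "hom_poly D (\<lambda>x. 0)"
| add: "hom_poly D f \<Longrightarrow> hom_poly D g \<Longrightarrow> hom_poly D (\<lambda>x. f x + g x)"
| var: "hom_poly D f \<Longrightarrow> hom_poly (Suc D) (\<lambda>x. x $ i * f x)"

lemma hom_poly_cmult: "hom_poly D f \<Longrightarrow> hom_poly D (\<lambda>x. c * f x)"
proof (induction rule: hom_poly.induct)
  case (add D f g)
  then show ?case using hom_poly.add by (simp add: distrib_left)
next
  case (var D f i)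
  then show ?case using hom_poly.var[of D "\<lambda>x. c * f x" i] by (simp add: mult.left_commute)
qed (auto intro: hom_poly.intros)

lemma hom_poly_mult: "hom_poly D f \<Longrightarrow> hom_poly E g \<Longrightarrow> hom_poly (D + E) (\<lambda>x. f x * g x)"
proof (induction rule: hom_poly.induct)
  case (const c)
  then show ?case by (simp add: hom_poly_cmult)
next
  case (add D f h)
  then show ?case using hom_poly.add[of "D + E" "\<lambda>x. f x * g x" "\<lambda>x. h x * g x"]
    by (simp add: distrib_right)
next
  case (var D f i)
  then show ?case using hom_poly.var[of "D + E" "\<lambda>x. f x * g x" i] by (simp add: mult.assoc)
qed (simp add: hom_poly.zero)

lemma hom_poly_power: "hom_poly D f \<Longrightarrow> hom_poly (D * k) (\<lambda>x. f x ^ k)"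
proof (induction k)
  case (Suc k)
  then show ?case using hom_poly_mult[of D f "D * k" "\<lambda>x. f x ^ k"] by simp
qed (simp add: hom_poly.const)

lemma hom_poly_sum:
  assumes "\<And>i. i \<in> S \<Longrightarrow> hom_poly D (f i)"
  shows "hom_poly D (\<lambda>x. \<Sum>i\<in>S. f i x)"
  using assms
  by (induction S rule: infinite_finite_induct) (auto intro: hom_poly.zero hom_poly.add)

lemma hom_poly_diff: "hom_poly D f \<Longrightarrow> hom_poly D g \<Longrightarrow> hom_poly D (\<lambda>x. f x - g x)"
  using hom_poly.add[of D f "\<lambda>x. (-1) * g x"] hom_poly_cmult[of D g "-1"] by simp

lemma hom_poly_coord: "hom_poly 1 (\<lambda>x. x $ i)"
  using hom_poly.var[OF hom_poly.const[of 1], of i] by simp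

lemma hom_poly_coord_power: "hom_poly k (\<lambda>x. x $ i ^ k)"
  using hom_poly_power[OF hom_poly_coord[of i], of k] by simp

lemma hom_poly_linear:
  fixes L :: "real ^ 'v::finite \<Rightarrow> real"
  assumes "linear L"
  shows "hom_poly 1 L"
proof -
  have "L = (\<lambda>x. \<Sum>i\<in>UNIV. L (axis i 1) * x $ i)"
  proof
    fix x :: "real ^ 'v"
    have "L x = L (\<Sum>i\<in>UNIV. x $ i *s axis i 1)"
      by (simp add: basis_expansion)
    also have "\<dots> = (\<Sum>i\<in>UNIV. x $ i * L (axis i 1))"
      using assms by (simp add: linear_sum linear_scale scalar_mult_eq_scaleR)
    finally show "L x = (\<Sum>i\<in>UNIV. L (axis i 1) * x $ i)"
      by (simp add: mult.commute)
  qed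
  then show ?thesis
    using hom_poly_sum[of UNIV 1 "\<lambda>i x. L (axis i 1) * x $ i"]
    by (metis hom_poly_cmult hom_poly_coord)
qed

lemma hom_poly_norm_power: "hom_poly (2 * k) (\<lambda>x :: real ^ 'v::finite. norm x ^ (2 * k))"
proof -
  have "hom_poly (2 * k) (\<lambda>x :: real ^ 'v. (\<Sum>i\<in>UNIV. x $ i ^ 2) ^ k)"
    by (intro hom_poly_power hom_poly_sum hom_poly_coord_power)
  moreover have "(\<Sum>i\<in>UNIV. x $ i ^ 2) ^ k = norm x ^ (2 * k)" for x :: "real ^ 'v"
    by (simp add: norm_vec_def L2_set_def power_mult real_sqrt_pow2 sum_nonneg)
  ultimately show ?thesis by simp
qed

lemma hom_poly_compose_linear:
  fixes L :: "real ^ 'u::finite \<Rightarrow> real ^ 'v::finite"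
  assumes "hom_poly D f" "linear L"
  shows "hom_poly D (\<lambda>x. f (L x))"
  using assms(1)
proof (induction rule: hom_poly.induct)
  case (var D f i)
  have "linear (\<lambda>x. L x $ i)"
    using assms(2) by (intro linearI) (simp_all add: linear_add linear_scale)
  then show ?case
    using hom_poly_mult[OF hom_poly_linear var.IH] by simp
qed (auto intro: hom_poly.intros)

lemma hom_poly_scale: "hom_poly D f \<Longrightarrow> f (s *\<^sub>R x) = s ^ D * f x"
  by (induction rule: hom_poly.induct) (auto simp: algebra_simps)

lemma hom_poly_has_derivative:
  fixes f :: "real ^ 'v::finite \<Rightarrow> real"
  assumes "hom_poly D f"
  shows "\<exists>g. (\<forall>i. hom_poly (D - 1) (g i)) \<and>
             (\<forall>x. (f has_derivative (\<lambda>h. \<Sum>i\<in>UNIV. g i x * h $ i)) (at x))"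
  using assms
proof (induction rule: hom_poly.induct)
  case (const c)
  show ?case by (rule exI[of _ "\<lambda>i x. 0"]) (auto intro: hom_poly.zero)
next
  case (zero D)
  show ?case by (rule exI[of _ "\<lambda>i x. 0"]) (auto intro: hom_poly.zero)
next
  case (add D f1 f2)
  then obtain g1 g2 where
    "\<forall>i. hom_poly (D - 1) (g1 i)" "\<forall>x. (f1 has_derivative (\<lambda>h. \<Sum>i\<in>UNIV. g1 i x * h $ i)) (at x)"
    "\<forall>i. hom_poly (D - 1) (g2 i)" "\<forall>x. (f2 has_derivative (\<lambda>h. \<Sum>i\<in>UNIV. g2 i x * h $ i)) (at x)"
    by blast
  then show ?case
    using has_derivative_add[of f1 _ _ f2]
    by (intro exI[of _ "\<lambda>i x. g1 i x + g2 i x"])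
       (auto intro: hom_poly.add simp: distrib_right sum.distrib)
next
  case (var D f k)
  then obtain g where g: "\<And>i. hom_poly (D - 1) (g i)"
    "\<And>x. (f has_derivative (\<lambda>h. \<Sum>i\<in>UNIV. g i x * h $ i)) (at x)"
    by blast
  have "hom_poly D (\<lambda>x. x $ k * g i x)" for i
  proof (cases D)
    case 0
    \<comment> \<open>For \<open>D = 0\<close> the difference \<open>D - 1\<close> is 0, and the product with a coordinate has degree \<open>D\<close> only
      because it vanishes.\<close>
    from var.hyps 0 have "hom_poly 0 f" by simp
    then have "f y = f 0" for y using hom_poly_scale[of 0 f 0 y] by simp
    then have f: "f = (\<lambda>y. f 0)" by auto
    have "(f has_derivative (\<lambda>h. 0)) (at x)" for x
      by (subst f) simp
    then have "(\<lambda>h. \<Sum>i\<in>UNIV. g i x * h $ i) = (\<lambda>h. 0)" for x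
      using g(2) has_derivative_unique by blast
    then have "(\<Sum>j\<in>UNIV. g j x * axis i 1 $ j) = 0" for x i by metis
    then have "g i x = 0" for x i
      by (simp add: axis_def if_distrib[of "\<lambda>z. _ * z"] cong: if_cong)
    then show ?thesis by (simp add: hom_poly.zero)
  next
    case (Suc E)
    then show ?thesis using hom_poly.var[OF g(1), of k i] by simp
  qed
  moreover have "((\<lambda>x. x $ k * f x) has_derivative
      (\<lambda>h. \<Sum>i\<in>UNIV. ((if i = k then f x else 0) + x $ k * g i x) * h $ i)) (at x)" for x
  proof -
    have "((\<lambda>x. x $ k) has_derivative (\<lambda>h. h $ k)) (at x)"
      by (rule bounded_linear_imp_has_derivative) (rule bounded_linear_vec_nth)
    from has_derivative_mult[OF this g(2)]
    show ?thesis
      by (rule has_derivative_eq_rhs)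
         (auto simp: fun_eq_iff distrib_right sum.distrib sum_distrib_left mult.assoc
               if_distrib[of "\<lambda>z. z * _"] cong: if_cong)
  qed
  moreover have "hom_poly D (\<lambda>x. (if i = k then f x else 0) + x $ k * g i x)" for i
    using var.hyps calculation(1) hom_poly.add[of D f]
    by (cases "i = k") (auto intro: hom_poly.add)
  ultimately show ?case
    by (intro exI[of _ "\<lambda>i x. (if i = k then f x else 0) + x $ k * g i x"]) simp
qed

definition partial_deriv :: "'v \<Rightarrow> (real ^ 'v::finite \<Rightarrow> real) \<Rightarrow> real ^ 'v \<Rightarrow> real" where
  "partial_deriv i f x = frechet_derivative f (at x) (axis i 1)"

lemma partial_deriv_eqI:
  assumes "(f has_derivative f') (at x)"
  shows "partial_deriv i f x = f' (axis i 1)"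
  using frechet_derivative_at[OF assms] by (simp add: partial_deriv_def)

lemma has_derivative_partial_deriv:
  fixes f :: "real ^ 'v::finite \<Rightarrow> real"
  assumes "f differentiable at x"
  shows "(f has_derivative (\<lambda>h. \<Sum>i\<in>UNIV. partial_deriv i f x * h $ i)) (at x)"
proof -
  obtain f' where f': "(f has_derivative f') (at x)"
    using assms by (auto simp: differentiable_def)
  then have lin: "linear f'" by (rule has_derivative_linear)
  have "f' h = (\<Sum>i\<in>UNIV. partial_deriv i f x * h $ i)" for h
  proof -
    have "f' h = f' (\<Sum>i\<in>UNIV. h $ i *s axis i 1)" by (simp add: basis_expansion)
    then show ?thesis
      using lin by (simp add: linear_sum linear_scale scalar_mult_eq_scaleR partial_deriv_eqI[OF f'] mult.commute)
  qed
  then show ?thesis using f' by (metis (no_types, lifting) ext)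
qed

lemma hom_poly_differentiable: "hom_poly D f \<Longrightarrow> f differentiable at x"
  using hom_poly_has_derivative unfolding differentiable_def by blast

lemma hom_poly_continuous_on: "hom_poly D f \<Longrightarrow> continuous_on S f"
  by (meson continuous_at_imp_continuous_on differentiable_imp_continuous_within hom_poly_differentiable)

lemma hom_poly_partial_deriv:
  assumes "hom_poly D f"
  shows "hom_poly (D - 1) (partial_deriv i f)"
proof -
  obtain g where g: "\<And>i. hom_poly (D - 1) (g i)"
    "\<And>x. (f has_derivative (\<lambda>h. \<Sum>i\<in>UNIV. g i x * h $ i)) (at x)"
    using hom_poly_has_derivative[OF assms] by blast
  have "partial_deriv i f = g i"
    by (rule ext, subst partial_deriv_eqI[OF g(2)])
       (simp add: axis_def if_distrib[of "\<lambda>z. _ * z"] cong: if_cong)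
  then show ?thesis using g(1) by simp
qed

lemma euler_identity:
  assumes "hom_poly D f"
  shows "frechet_derivative f (at x) x = D * f x"
proof -
  let ?f' = "frechet_derivative f (at x)"
  have f': "(f has_derivative ?f') (at x)"
    using hom_poly_differentiable[OF assms] by (simp add: frechet_derivative_works)
  have "((\<lambda>s. f (s *\<^sub>R x)) has_derivative (\<lambda>s. ?f' (s *\<^sub>R x))) (at 1)"
    by (rule has_derivative_compose[of "\<lambda>s. s *\<^sub>R x" "\<lambda>s. s *\<^sub>R x"])
       (auto intro!: derivative_eq_intros f')
  then have "((\<lambda>s. s ^ D * f x) has_derivative (\<lambda>s. ?f' (s *\<^sub>R x))) (at 1)"
    by (simp add: hom_poly_scale[OF assms])
  moreover have "((\<lambda>s. s ^ D * f x) has_derivative (\<lambda>s. s * (D * f x))) (at (1::real))"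
    by (auto intro!: derivative_eq_intros)
  ultimately have "(\<lambda>s. ?f' (s *\<^sub>R x)) = (\<lambda>s. s * (D * f x))"
    by (rule has_derivative_unique)
  from fun_cong[OF this, of 1] show ?thesis by simp
qed

section \<open>Polynomials and polynomial functions\<close>

lemma rpoly_induct [case_names single add]:
  fixes p :: "'v rpoly"
  assumes "\<And>a c. P (Poly_Mapping.single a c)" "\<And>p q. P p \<Longrightarrow> P q \<Longrightarrow> P (p + q)"
  shows "P p"
proof (induction p rule: update_induct)
  case const
  show ?case using assms(1)[of 0 0] by simp
next
  case (update f a b)
  have "Poly_Mapping.update a b f = Poly_Mapping.single a b + f"
    using update by (intro poly_mapping_eqI)
      (auto simp: lookup_update lookup_add lookup_single when_def in_keys_iff)
  then show ?case using assms update by simp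
qed

lemma eval_poly_add: "eval_poly (p + q) x = eval_poly p x + eval_poly q x"
  unfolding eval_poly_def by (rule setsum_keys_plus_distrib) (auto simp: distrib_right)

lemma eval_poly_single:
  "eval_poly (Poly_Mapping.single a c) x = c * (\<Prod>i\<in>UNIV. (x $ i) ^ Poly_Mapping.lookup a i)"
  by (simp add: eval_poly_def)

lemma eval_poly_mult: "eval_poly (p * q) x = eval_poly p x * eval_poly q x"
proof (induction p rule: rpoly_induct)
  case (single a c)
  show ?case
  proof (induction q rule: rpoly_induct)
    case (single b e)
    show ?case
      by (simp add: mult_single eval_poly_single lookup_add power_add prod.distrib)
  qed (simp add: distrib_left eval_poly_add)
qed (simp add: distrib_right eval_poly_add)

lemma eval_poly_zero: "eval_poly 0 x = 0"
  by (simp add: eval_poly_def)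

lemma eval_poly_one: "eval_poly 1 x = 1"
  using eval_poly_single[of 0 1 x] by (simp add: single_one)

lemma eval_poly_minus: "eval_poly (- p) x = - eval_poly p x"
  using eval_poly_add[of p "- p" x] by (simp add: eval_poly_zero)

lemma eval_poly_power: "eval_poly (p ^ n) x = eval_poly p x ^ n"
  by (induction n) (auto simp: eval_poly_one eval_poly_mult)

lemma monom_degree_add: "monom_degree (a + b) = monom_degree a + monom_degree b"
  by (simp add: monom_degree_def lookup_add sum.distrib)

lemma monom_degree_single: "monom_degree (Poly_Mapping.single i 1) = 1"
proof -
  have "monom_degree (Poly_Mapping.single i 1) = (\<Sum>j\<in>UNIV. if i = j then 1 else 0)"
    unfolding monom_degree_def by (rule sum.cong) (auto simp: lookup_single when_def)
  then show ?thesis by simp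
qed

lemma eval_poly_var: "eval_poly (Poly_Mapping.single (Poly_Mapping.single i 1) 1) x = x $ i"
proof -
  have "(\<Prod>j\<in>UNIV. x $ j ^ Poly_Mapping.lookup (Poly_Mapping.single i 1) j) = (\<Prod>j\<in>UNIV. if j = i then x $ j else 1)"
    by (rule prod.cong) (auto simp: lookup_single when_def)
  then show ?thesis by (simp add: eval_poly_single)
qed

lemma total_degree_leI: "(\<And>a. a \<in> Poly_Mapping.keys p \<Longrightarrow> monom_degree a \<le> D) \<Longrightarrow> total_degree p \<le> D"
  unfolding total_degree_def by (subst Max_le_iff) auto

lemma hom_poly_eval_poly:
  fixes p :: "'v::finite rpoly"
  assumes "\<forall>a\<in>Poly_Mapping.keys p. monom_degree a = k"
  shows "hom_poly k (eval_poly p)"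
proof -
  have prod: "hom_poly (\<Sum>i\<in>S. e i) (\<lambda>x :: real ^ 'v. \<Prod>i\<in>S. (x $ i) ^ e i)"
    if "finite S" for S and e :: "'v \<Rightarrow> nat"
    using that
  proof (induction S)
    case (insert i S)
    then show ?case using hom_poly_mult[OF hom_poly_coord_power[of "e i" i] insert.IH] by simp
  qed (simp add: hom_poly.const)
  have "hom_poly k (\<lambda>x. \<Sum>a\<in>Poly_Mapping.keys p.
      Poly_Mapping.lookup p a * (\<Prod>i\<in>UNIV. (x $ i) ^ Poly_Mapping.lookup a i))"
  proof (intro hom_poly_sum hom_poly_cmult)
    fix a assume "a \<in> Poly_Mapping.keys p"
    then have "(\<Sum>i\<in>UNIV. Poly_Mapping.lookup a i) = k"
      using assms by (simp add: monom_degree_def)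
    then show "hom_poly k (\<lambda>x. \<Prod>i\<in>UNIV. (x $ i) ^ Poly_Mapping.lookup a i)"
      using prod[of UNIV "Poly_Mapping.lookup a"] by simp
  qed
  then show ?thesis by (simp add: eval_poly_def[abs_def])
qed

lemma hom_poly_rpoly:
  assumes "hom_poly D f"
  obtains p where "eval_poly p = f" "homogeneous p" "total_degree p \<le> D"
proof -
  have "\<exists>p. eval_poly p = f \<and> (\<forall>a\<in>Poly_Mapping.keys p. monom_degree a = D)"
    using assms
  proof (induction rule: hom_poly.induct)
    case (const c)
    show ?case
      by (rule exI[of _ "Poly_Mapping.single 0 c"])
         (auto simp: eval_poly_single[abs_def] monom_degree_def split: if_splits)
  next
    case (zero D)
    show ?case by (rule exI[of _ 0]) (auto simp: eval_poly_zero[abs_def])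
  next
    case (add D f g)
    then obtain p q where "eval_poly p = f" "\<forall>a\<in>Poly_Mapping.keys p. monom_degree a = D"
      "eval_poly q = g" "\<forall>a\<in>Poly_Mapping.keys q. monom_degree a = D" by blast
    then show ?case
      using keys_add[of p q] by (intro exI[of _ "p + q"]) (auto simp: eval_poly_add[abs_def])
  next
    case (var D f i)
    then obtain p where p: "eval_poly p = f" "\<forall>a\<in>Poly_Mapping.keys p. monom_degree a = D" by blast
    let ?v = "Poly_Mapping.single (Poly_Mapping.single i 1) 1 :: 'a rpoly"
    have "monom_degree a = Suc D" if "a \<in> Poly_Mapping.keys (?v * p)" for a
      using that keys_mult[of ?v p] p(2) by (auto simp: monom_degree_add monom_degree_single[unfolded One_nat_def])
    moreover have "eval_poly (?v * p) = (\<lambda>x. x $ i * f x)"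
      unfolding p(1)[symmetric] by (rule ext) (simp only: eval_poly_mult eval_poly_var)
    ultimately show ?case by blast
  qed
  then obtain p where p: "eval_poly p = f" "\<forall>a\<in>Poly_Mapping.keys p. monom_degree a = D"
    by blast
  show ?thesis
    by (rule that[OF p(1)]) (use p(2) in \<open>auto simp: homogeneous_def intro: total_degree_leI\<close>)
qed

definition affine_pt :: "real ^ 'n::finite \<Rightarrow> real ^ 'n option" where
  "affine_pt v = (\<chi> i. case i of None \<Rightarrow> 1 | Some j \<Rightarrow> v $ j)"

lemma affine_pt_nth [simp]: "affine_pt v $ None = 1" "affine_pt v $ Some j = v $ j"
  by (simp_all add: affine_pt_def)

lemma dehomogenization_rpoly:
  fixes F :: "real ^ 'n::finite option \<Rightarrow> real"
  assumes "hom_poly D F"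
  obtains p where "eval_poly p = (\<lambda>v. F (affine_pt v))" "total_degree p \<le> D"
proof -
  have "\<exists>p. eval_poly p = (\<lambda>v. F (affine_pt v)) \<and> (\<forall>a\<in>Poly_Mapping.keys p. monom_degree a \<le> D)"
    using assms
  proof (induction rule: hom_poly.induct)
    case (const c)
    show ?case
      by (rule exI[of _ "Poly_Mapping.single 0 c"])
         (auto simp: eval_poly_single[abs_def] monom_degree_def split: if_splits)
  next
    case (zero D)
    show ?case by (rule exI[of _ 0]) (auto simp: eval_poly_zero[abs_def])
  next
    case (add D f g)
    then obtain p q where "eval_poly p = (\<lambda>v. f (affine_pt v))" "\<forall>a\<in>Poly_Mapping.keys p. monom_degree a \<le> D"
      "eval_poly q = (\<lambda>v. g (affine_pt v))" "\<forall>a\<in>Poly_Mapping.keys q. monom_degree a \<le> D" by blast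
    then show ?case
      using keys_add[of p q] by (intro exI[of _ "p + q"]) (auto simp: eval_poly_add[abs_def])
  next
    case (var D f i)
    then obtain p where p: "eval_poly p = (\<lambda>v. f (affine_pt v))" "\<forall>a\<in>Poly_Mapping.keys p. monom_degree a \<le> D"
      by blast
    show ?case
    proof (cases i)
      case None
      then show ?thesis using p by (intro exI[of _ p]) auto
    next
      case (Some j)
      let ?v = "Poly_Mapping.single (Poly_Mapping.single j 1) 1 :: 'n rpoly"
      have "monom_degree a \<le> Suc D" if "a \<in> Poly_Mapping.keys (?v * p)" for a
        using that keys_mult[of ?v p] p(2) by (auto simp: monom_degree_add monom_degree_single[unfolded One_nat_def])
      moreover have "eval_poly (?v * p) = (\<lambda>v. affine_pt v $ i * f (affine_pt v))"
        unfolding Some by (rule ext) (simp only: eval_poly_mult eval_poly_var affine_pt_nth p(1))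
      ultimately show ?thesis by blast
    qed
  qed
  then show ?thesis using that total_degree_leI by metis
qed

section \<open>Krull dimension and thin sets\<close>

abbreviation type_ring :: "'a::comm_ring_1 ring" where
  "type_ring \<equiv> ring_of_type_algebra"

lemma type_ring_simps:
  "carrier (type_ring :: 'a::comm_ring_1 ring) = UNIV"
  "mult type_ring x y = x * (y :: 'a)" "one type_ring = (1 :: 'a)"
  "zero type_ring = (0 :: 'a)" "add type_ring x y = x + (y :: 'a)"
  by (simp_all add: ring_of_type_algebra_def)

lemma ideal_type_ring_iff:
  "ideal J (type_ring :: 'a::comm_ring_1 ring) \<longleftrightarrow>
     0 \<in> J \<and> (\<forall>x\<in>J. \<forall>y\<in>J. x + y \<in> J) \<and> (\<forall>x\<in>J. \<forall>a. a * x \<in> J)" (is "?l = ?r")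
proof
  assume ?l
  then interpret ideal J "type_ring :: 'a ring" .
  show ?r
  proof (intro conjI ballI allI)
    show "0 \<in> J" using additive_subgroup.zero_closed[OF additive_subgroup_axioms] by (simp add: type_ring_simps)
    show "x + y \<in> J" if "x \<in> J" "y \<in> J" for x y using additive_subgroup.a_closed[OF additive_subgroup_axioms that] by (simp add: type_ring_simps)
    show "a * x \<in> J" if "x \<in> J" for a x using I_l_closed[OF that, of a] by (simp add: type_ring_simps)
  qed
next
  assume r: ?r
  interpret R: cring "type_ring :: 'a ring" by (rule cring_from_type_algebra)
  have "a_inv type_ring x = - x" for x :: 'a
  proof -
    have "add type_ring (- x) x = zero type_ring" by (simp add: type_ring_simps)
    then show ?thesis using R.minus_equality[of "- x" x] by (simp add: type_ring_simps)
  qed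
  moreover have "- x \<in> J" if "x \<in> J" for x
  proof -
    have "(- 1) * x \<in> J" using r that by blast
    then show ?thesis by simp
  qed
  ultimately have inv: "a_inv type_ring x \<in> J" if "x \<in> J" for x using that by simp
  have sub: "subgroup J (add_monoid type_ring)"
  proof (rule R.add.subgroupI)
    show "J \<subseteq> carrier type_ring" by (simp add: type_ring_simps)
    have "0 \<in> J" using r by (rule conjunct1)
    then show "J \<noteq> {}" by auto
    show "a_inv type_ring x \<in> J" if "x \<in> J" for x using inv[OF that] .
    show "add type_ring x y \<in> J" if "x \<in> J" "y \<in> J" for x y
      using r that unfolding type_ring_simps by blast
  qed
  show ?l
  proof (rule idealI[OF R.ring_axioms sub])
    fix a x assume "a \<in> J"
    then have "x * a \<in> J" using r by blast
    then show "mult type_ring x a \<in> J" "mult type_ring a x \<in> J"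
      unfolding type_ring_simps by (simp_all add: mult.commute[of a x])
  qed
qed

lemma ideal_adjoin:
  fixes P :: "'a::comm_ring_1 set"
  assumes "ideal P type_ring"
  shows "ideal {p + r * a | p r. p \<in> P} type_ring" (is "ideal ?L _")
    and "P \<subseteq> {p + r * a | p r. p \<in> P}" and "a \<in> {p + r * a | p r. p \<in> P}"
proof -
  have P: "0 \<in> P" "\<And>x y. x \<in> P \<Longrightarrow> y \<in> P \<Longrightarrow> x + y \<in> P" "\<And>b x. x \<in> P \<Longrightarrow> b * x \<in> P"
    using assms unfolding ideal_type_ring_iff by auto
  show "ideal ?L type_ring"
    unfolding ideal_type_ring_iff
  proof (intro conjI ballI allI)
    show "0 \<in> ?L" by (intro CollectI exI[of _ 0] conjI P(1)) simp
    fix x assume "x \<in> ?L"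
    then obtain p r where x: "x = p + r * a" "p \<in> P" by blast
    show "b * x \<in> ?L" for b
      by (rule CollectI, rule exI[of _ "b * p"], rule exI[of _ "b * r"])
         (use P x in \<open>simp add: distrib_left mult.assoc\<close>)
    fix y assume "y \<in> ?L"
    then obtain q s where y: "y = q + s * a" "q \<in> P" by blast
    show "x + y \<in> ?L"
      by (rule CollectI, rule exI[of _ "p + q"], rule exI[of _ "r + s"])
         (use P x y in \<open>simp add: algebra_simps\<close>)
  qed
  show "P \<subseteq> ?L"
  proof
    fix p assume "p \<in> P"
    then show "p \<in> ?L" by (intro CollectI exI[of _ p] exI[of _ 0]) simp
  qed
  show "a \<in> ?L" by (intro CollectI exI[of _ 0] exI[of _ 1]) (simp add: P(1))
qed

text \<open>
  Zorn's lemma gives an ideal that is maximal among those containing \<open>J\<close> and avoiding \<open>S\<close>. Adjoining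
  to it an element outside makes it meet \<open>S\<close>; two such elements with product in the ideal would, by
  multiplying the two members of \<open>S\<close> so obtained, make the ideal itself meet \<open>S\<close>.
\<close>

lemma prime_avoiding_multiplicative_set:
  fixes S :: "'a::comm_ring_1 set"
  assumes S: "1 \<in> S" "\<And>a b. a \<in> S \<Longrightarrow> b \<in> S \<Longrightarrow> a * b \<in> S"
    and J: "ideal J type_ring" and dis: "J \<inter> S = {}"
  obtains P where "primeideal P type_ring" "J \<subseteq> P" "P \<inter> S = {}"
proof -
  let ?A = "{K. ideal K (type_ring :: 'a ring) \<and> J \<subseteq> K \<and> K \<inter> S = {}}"
  have "\<exists>M\<in>?A. \<forall>L\<in>?A. M \<subseteq> L \<longrightarrow> L = M"
  proof (rule subset_Zorn_nonempty)
    show "?A \<noteq> {}" using J dis by blast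
    fix \<C> assume ne: "\<C> \<noteq> {}" and ch: "subset.chain ?A \<C>"
    then have sub: "\<C> \<subseteq> ?A" and tot: "\<And>L Y. L \<in> \<C> \<Longrightarrow> Y \<in> \<C> \<Longrightarrow> L \<subseteq> Y \<or> Y \<subseteq> L"
      unfolding subset_chain_def by auto
    have idl: "0 \<in> K" "\<And>x y. x \<in> K \<Longrightarrow> y \<in> K \<Longrightarrow> x + y \<in> K" "\<And>a x. x \<in> K \<Longrightarrow> a * x \<in> K"
      if "K \<in> \<C>" for K
    proof -
      have "ideal K (type_ring :: 'a ring)" using sub that by blast
      then show "0 \<in> K" "\<And>x y. x \<in> K \<Longrightarrow> y \<in> K \<Longrightarrow> x + y \<in> K" "\<And>a x. x \<in> K \<Longrightarrow> a * x \<in> K"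
        unfolding ideal_type_ring_iff by simp_all
    qed
    have "ideal (\<Union>\<C>) (type_ring :: 'a ring)"
      unfolding ideal_type_ring_iff
    proof (intro conjI ballI allI)
      obtain K where "K \<in> \<C>" using ne by blast
      then show "0 \<in> \<Union>\<C>" using idl(1) by blast
      show "x + y \<in> \<Union>\<C>" if xy: "x \<in> \<Union>\<C>" "y \<in> \<Union>\<C>" for x y
      proof -
        obtain K L where "K \<in> \<C>" "L \<in> \<C>" "x \<in> K" "y \<in> L" using xy by blast
        then obtain Z where Z: "Z \<in> \<C>" "x \<in> Z" "y \<in> Z" using tot[of K L] by blast
        then show ?thesis using idl(2)[OF Z] by blast
      qed
      show "a * x \<in> \<Union>\<C>" if x: "x \<in> \<Union>\<C>" for a x
      proof -
        obtain K where K: "K \<in> \<C>" "x \<in> K" using x by blast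
        then show ?thesis using idl(3)[OF K] by blast
      qed
    qed
    moreover have "J \<subseteq> \<Union>\<C>"
    proof -
      obtain K where "K \<in> \<C>" using ne by blast
      moreover from this sub have "J \<subseteq> K" by auto
      ultimately show ?thesis by blast
    qed
    moreover have "K \<inter> S = {}" if "K \<in> \<C>" for K using sub that by auto
    then have "\<Union>\<C> \<inter> S = {}" by (simp add: Int_Union2)
    ultimately show "\<Union>\<C> \<in> ?A" by simp
  qed
  then obtain P where "P \<in> ?A" and maxA: "\<forall>L\<in>?A. P \<subseteq> L \<longrightarrow> L = P" by (rule bexE)
  then have P: "ideal P (type_ring :: 'a ring)" "J \<subseteq> P" "P \<inter> S = {}" by simp_all
  have max: "L = P" if "ideal L (type_ring :: 'a ring)" "J \<subseteq> L" "L \<inter> S = {}" "P \<subseteq> L" for L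
    using maxA that by simp
  have Pi: "0 \<in> P" "\<And>x y. x \<in> P \<Longrightarrow> y \<in> P \<Longrightarrow> x + y \<in> P" "\<And>a x. x \<in> P \<Longrightarrow> a * x \<in> P"
    using P(1) unfolding ideal_type_ring_iff by auto
  have meets: "\<exists>p\<in>P. \<exists>r. p + r * a \<in> S" if "a \<notin> P" for a
  proof -
    let ?L = "{p + r * a | p r. p \<in> P}"
    have "?L \<inter> S \<noteq> {}"
      using max[OF ideal_adjoin(1)[OF P(1)]] ideal_adjoin(2,3)[OF P(1), of a] P(2) that by blast
    then show ?thesis by blast
  qed
  have "primeideal P (type_ring :: 'a ring)"
  proof (rule primeidealI[OF P(1) cring_from_type_algebra])
    show "carrier type_ring \<noteq> P" using P(3) S(1) by (auto simp: type_ring_simps)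
    fix a b :: 'a assume "mult type_ring a b \<in> P"
    then have ab: "a * b \<in> P" by (simp add: type_ring_simps)
    show "a \<in> P \<or> b \<in> P"
    proof (rule ccontr)
      assume "\<not> (a \<in> P \<or> b \<in> P)"
      then obtain p r q s where *: "p \<in> P" "p + r * a \<in> S" "q \<in> P" "q + s * b \<in> S"
        using meets by blast
      have "(p + r * a) * (q + s * b) = (q + s * b) * p + (r * a) * q + (r * s) * (a * b)"
        by (simp add: algebra_simps)
      moreover have "\<dots> \<in> P"
        by (intro Pi(2,3) *(1,3) ab)
      moreover have "(p + r * a) * (q + s * b) \<in> S" using S(2) * by blast
      ultimately show False using P(3) by auto
    qed
  qed
  with P that show ?thesis by blast
qed

text \<open>
  These are the iterated boundary monoids of Coquand and Lombardi: a ring has Krull dimension at most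
  \<open>m\<close> if and only if the monoid of \<open>[x\<^sub>0, \<dots>, x\<^sub>m]\<close> contains 0 for all \<open>x\<^sub>0, \<dots>, x\<^sub>m\<close>.
\<close>

fun boundary_monoid :: "'a::comm_ring_1 list \<Rightarrow> 'a set" where
  "boundary_monoid [] = {1}"
| "boundary_monoid (x # xs) = {x ^ k * (s + a * x) | k s a. s \<in> boundary_monoid xs}"

lemma boundary_monoid_one: "1 \<in> boundary_monoid xs"
proof (induction xs)
  case (Cons x xs)
  have "1 = x ^ 0 * (1 + 0 * x)" by simp
  then show ?case using Cons.IH unfolding boundary_monoid.simps by blast
qed simp

lemma boundary_monoid_mult:
  "p \<in> boundary_monoid xs \<Longrightarrow> q \<in> boundary_monoid xs \<Longrightarrow> p * q \<in> boundary_monoid xs"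
proof (induction xs arbitrary: p q)
  case (Cons x xs)
  from Cons.prems obtain k s a l t b where
    pq: "p = x ^ k * (s + a * x)" "s \<in> boundary_monoid xs"
       "q = x ^ l * (t + b * x)" "t \<in> boundary_monoid xs" by auto
  have "p * q = x ^ (k + l) * (s * t + (a * t + b * s + a * b * x) * x)"
    unfolding pq(1,3) power_add by (simp add: algebra_simps)
  then show ?case using Cons.IH[OF pq(2,4)] unfolding boundary_monoid.simps by blast
qed simp

text \<open>
  A prime \<open>P \<supseteq> J\<close> that avoids the monoid of \<open>x # xs\<close> does not contain \<open>x\<close>, which is in the monoid, and
  \<open>P + (x)\<close> avoids the monoid of \<open>xs\<close>. So \<open>P\<close> can be put below a chain obtained for \<open>xs\<close> and \<open>P + (x)\<close>.
\<close>

lemma prime_chain_of_boundary_monoid: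
  fixes xs :: "'a::comm_ring_1 list"
  assumes "ideal J type_ring" "J \<inter> boundary_monoid xs = {}"
  shows "\<exists>\<pp>. J \<subseteq> \<pp> 0 \<and> (\<forall>i\<le>length xs. primeideal (\<pp> i) type_ring) \<and>
             (\<forall>i<length xs. \<pp> i \<subset> \<pp> (Suc i))"
  using assms
proof (induction xs arbitrary: J)
  case Nil
  then obtain P where "primeideal P type_ring" "J \<subseteq> P"
    using prime_avoiding_multiplicative_set[of "boundary_monoid []" J] by auto
  then show ?case by (intro exI[of _ "\<lambda>_. P"]) auto
next
  case (Cons x xs)
  obtain P where P: "primeideal P type_ring" "J \<subseteq> P" "P \<inter> boundary_monoid (x # xs) = {}"
    using prime_avoiding_multiplicative_set[of "boundary_monoid (x # xs)" J]
      boundary_monoid_one boundary_monoid_mult Cons.prems by blast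
  let ?K = "{p + r * x | p r. p \<in> P}"
  note adjoin = ideal_adjoin[OF primeideal.axioms(1)[OF P(1)], of x]
  have "?K \<inter> boundary_monoid xs = {}"
  proof (rule ccontr)
    assume "?K \<inter> boundary_monoid xs \<noteq> {}"
    then obtain p r where pr: "p \<in> P" "p + r * x \<in> boundary_monoid xs" by blast
    have "p = x ^ 0 * ((p + r * x) + (- r) * x)" by simp
    then have "p \<in> boundary_monoid (x # xs)" using pr(2) unfolding boundary_monoid.simps by blast
    with P(3) pr(1) show False by blast
  qed
  from Cons.IH[OF adjoin(1) this] obtain \<qq> where \<qq>: "?K \<subseteq> \<qq> 0" "\<forall>i\<le>length xs. primeideal (\<qq> i) type_ring"
    "\<forall>i<length xs. \<qq> i \<subset> \<qq> (Suc i)" by blast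
  have "P \<subset> \<qq> 0"
  proof
    show "P \<subseteq> \<qq> 0" using adjoin(2) \<qq>(1) by (rule order_trans)
    have "x = x ^ 1 * (1 + 0 * x)" by simp
    then have "x \<in> boundary_monoid (x # xs)"
      using boundary_monoid_one[of xs] unfolding boundary_monoid.simps by blast
    then have "x \<notin> P" using P(3) by blast
    moreover have "x \<in> \<qq> 0" using \<qq>(1) adjoin(3) by (rule subsetD)
    ultimately show "P \<noteq> \<qq> 0" by blast
  qed
  then show ?case
    using \<qq> P(1,2)
    by (intro exI[of _ "\<lambda>i. case i of 0 \<Rightarrow> P | Suc j \<Rightarrow> \<qq> j"]) (auto split: nat.split)
qed

lemma primeideal_image_quotient:
  fixes J P :: "'a::comm_ring_1 set"
  assumes J: "ideal J type_ring" and P: "primeideal P type_ring" and "J \<subseteq> P"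
  shows "primeideal ((\<lambda>x. a_r_coset type_ring J x) ` P) (type_ring Quot J)"
    and "a_r_coset type_ring J x \<in> (\<lambda>x. a_r_coset type_ring J x) ` P \<longleftrightarrow> x \<in> P"
proof -
  interpret R: cring "type_ring :: 'a ring" by (rule cring_from_type_algebra)
  interpret J: ideal J "type_ring :: 'a ring" by fact
  interpret P: primeideal P "type_ring :: 'a ring" by fact
  let ?h = "\<lambda>x. a_r_coset type_ring J x"
  have mem: "?h x \<in> ?h ` P \<longleftrightarrow> x \<in> P" for x
  proof
    assume "?h x \<in> ?h ` P"
    then obtain y where y: "y \<in> P" "?h x = ?h y" by blast
    have "x \<in> ?h x" using J.a_rcos_self[of x] by (simp add: type_ring_simps)
    then have "x \<in> ?h y" using y(2) by simp
    then obtain j where "j \<in> J" "x = j + y"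
      by (auto simp: a_r_coset_def' type_ring_simps)
    then show "x \<in> P"
      using y(1) \<open>J \<subseteq> P\<close> P.is_ideal unfolding ideal_type_ring_iff by blast
  qed blast
  then show "?h x \<in> ?h ` P \<longleftrightarrow> x \<in> P" .
  have carr: "carrier (type_ring Quot J) = range ?h"
    by (auto simp: FactRing_def A_RCOSETS_def' type_ring_simps)
  show "primeideal (?h ` P) (type_ring Quot J)"
  proof (rule primeidealI)
    show "ideal (?h ` P) (type_ring Quot J)"
      using R.ring_ideal_imp_quot_ideal[OF J P.is_ideal] .
    show "cring (type_ring Quot J)" using J.quotient_is_cring[OF R.is_cring] .
    show "carrier (type_ring Quot J) \<noteq> ?h ` P"
      using P.I_notcarr mem unfolding carr type_ring_simps by blast
    fix a b assume "a \<in> carrier (type_ring Quot J)" "b \<in> carrier (type_ring Quot J)"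
      "mult (type_ring Quot J) a b \<in> ?h ` P"
    then obtain u v where uv: "a = ?h u" "b = ?h v" "mult (type_ring Quot J) (?h u) (?h v) \<in> ?h ` P"
      unfolding carr by blast
    then have "?h (u * v) \<in> ?h ` P"
      using J.rcoset_mult_add[of u v] by (simp add: FactRing_def type_ring_simps)
    then have "u \<in> P \<or> v \<in> P"
      using P.I_prime[of u v] unfolding mem type_ring_simps by blast
    then show "a \<in> ?h ` P \<or> b \<in> ?h ` P" using uv by blast
  qed
qed

lemma boundary_monoid_meets_ideal_of_krull_dim:
  fixes J :: "'a::comm_ring_1 set" and xs :: "'a list"
  assumes J: "ideal J type_ring"
    and dim: "krull_dim (type_ring Quot J) \<le> ereal (real m)" and len: "length xs = Suc m"
  shows "J \<inter> boundary_monoid xs \<noteq> {}"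
proof
  assume "J \<inter> boundary_monoid xs = {}"
  from prime_chain_of_boundary_monoid[OF J this]
  obtain \<pp> where \<pp>: "J \<subseteq> \<pp> 0" "\<And>i. i \<le> Suc m \<Longrightarrow> primeideal (\<pp> i) type_ring"
    "\<And>i. i < Suc m \<Longrightarrow> \<pp> i \<subset> \<pp> (Suc i)" unfolding len by blast
  have J\<pp>: "J \<subseteq> \<pp> i" if "i \<le> Suc m" for i
    using that
  proof (induction i)
    case 0
    then show ?case using \<pp>(1) by simp
  next
    case (Suc i)
    then show ?case using \<pp>(3)[of i] by auto
  qed
  let ?h = "\<lambda>x. a_r_coset type_ring J x"
  define \<qq> where "\<qq> i = ?h ` \<pp> i" for i
  have "primeideal (\<qq> i) (type_ring Quot J)" if "i \<le> Suc m" for i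
    unfolding \<qq>_def by (rule primeideal_image_quotient(1)[OF J \<pp>(2) J\<pp>]) (use that in auto)
  moreover have "\<qq> i \<subset> \<qq> (Suc i)" if i: "i < Suc m" for i
  proof -
    obtain x where "x \<in> \<pp> (Suc i)" "x \<notin> \<pp> i" using \<pp>(3)[OF i] by blast
    then have "?h x \<in> \<qq> (Suc i)" "?h x \<notin> \<qq> i"
      using primeideal_image_quotient(2)[OF J \<pp>(2) J\<pp>, of i x] i by (auto simp: \<qq>_def)
    moreover have "\<qq> i \<subseteq> \<qq> (Suc i)" using \<pp>(3)[OF i] by (auto simp: \<qq>_def)
    ultimately show ?thesis by blast
  qed
  ultimately have "ereal (real (Suc m)) \<le> krull_dim (type_ring Quot J)"
    unfolding krull_dim_def by (intro Sup_upper CollectI exI[of _ "Suc m"] conjI refl exI[of _ \<qq>]) auto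
  also note dim
  finally show False by simp
qed

text \<open>
  If \<open>|s| \<ge> \<beta>\<close> and \<open>|a x| \<le> \<beta> / 2\<close>, then \<open>|x\<^sup>k (s + a x)| \<ge> |x|\<^sup>k \<beta> / 2\<close>. Inductively, a member of the monoid
  of \<open>[x\<^sub>0, \<dots>, x\<^sub>m]\<close> is bounded away from zero at points where \<open>x\<^sub>m\<close> is small but not too close to zero,
  \<open>x\<^bsub>m-1\<^esub>\<close> is of a smaller order still, and so on.
\<close>

lemma boundary_monoid_bounded_below:
  fixes xs :: "('v::finite) rpoly list"
  assumes bdd: "\<And>q. bounded (eval_poly q ` K)" and "0 < c" "c \<le> 1" "0 < r"
    and "p \<in> boundary_monoid xs"
  shows "\<exists>\<rho> \<beta>. 0 < \<beta> \<and> length \<rho> = length xs \<and> (\<forall>i<length xs. 0 < \<rho> ! i \<and> \<rho> ! i \<le> r) \<and>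
     (\<forall>v\<in>K. (\<forall>i<length xs. c * \<rho> ! i \<le> \<bar>eval_poly (xs ! i) v\<bar> \<and> \<bar>eval_poly (xs ! i) v\<bar> \<le> \<rho> ! i)
        \<longrightarrow> \<beta> \<le> \<bar>eval_poly p v\<bar>)"
  using assms(5)
proof (induction xs arbitrary: p)
  case Nil
  then show ?case by (intro exI[of _ "[]"] exI[of _ 1]) (simp add: eval_poly_one)
next
  case (Cons x xs)
  then obtain k s a where p: "p = x ^ k * (s + a * x)" and s: "s \<in> boundary_monoid xs" by auto
  from Cons.IH[OF s] obtain \<rho> \<beta> where IH: "0 < \<beta>" "length \<rho> = length xs"
    "\<forall>i<length xs. 0 < \<rho> ! i \<and> \<rho> ! i \<le> r"
    "\<And>v. v \<in> K \<Longrightarrow> (\<forall>i<length xs. c * \<rho> ! i \<le> \<bar>eval_poly (xs ! i) v\<bar> \<and> \<bar>eval_poly (xs ! i) v\<bar> \<le> \<rho> ! i)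
        \<Longrightarrow> \<beta> \<le> \<bar>eval_poly s v\<bar>" by blast
  obtain M where M: "M > 0" "\<And>v. v \<in> K \<Longrightarrow> \<bar>eval_poly a v\<bar> \<le> M"
    using bdd[of a] unfolding bounded_pos by auto
  define \<rho>0 where "\<rho>0 = min r (\<beta> / (2 * M))"
  have \<rho>0: "0 < \<rho>0" "\<rho>0 \<le> r" "M * \<rho>0 \<le> \<beta> / 2"
    using assms(4) IH(1) M(1) by (auto simp: \<rho>0_def min_def field_simps)
  define \<beta>' where "\<beta>' = (c * \<rho>0) ^ k * (\<beta> / 2)"
  have "\<beta>' > 0" using \<rho>0 IH(1) assms(2) by (simp add: \<beta>'_def)
  moreover have "\<beta>' \<le> \<bar>eval_poly p v\<bar>"
    if v: "v \<in> K" and h: "\<forall>i<length (x # xs). c * (\<rho>0 # \<rho>) ! i \<le> \<bar>eval_poly ((x # xs) ! i) v\<bar> \<and>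
        \<bar>eval_poly ((x # xs) ! i) v\<bar> \<le> (\<rho>0 # \<rho>) ! i" for v
  proof -
    have h0: "c * \<rho>0 \<le> \<bar>eval_poly x v\<bar>" "\<bar>eval_poly x v\<bar> \<le> \<rho>0" using h by force+
    have "\<beta> \<le> \<bar>eval_poly s v\<bar>" using IH(4)[OF v] h by force
    moreover have "\<bar>eval_poly a v * eval_poly x v\<bar> \<le> M * \<rho>0"
      unfolding abs_mult using M(2)[OF v] h0(2) by (intro mult_mono) auto
    ultimately have "\<beta> / 2 \<le> \<bar>eval_poly s v + eval_poly a v * eval_poly x v\<bar>"
      using \<rho>0(3) by linarith
    moreover have "(c * \<rho>0) ^ k \<le> \<bar>eval_poly x v\<bar> ^ k"
      using h0(1) assms(2) \<rho>0(1) by (intro power_mono) auto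
    ultimately show ?thesis
      unfolding p \<beta>'_def eval_poly_mult eval_poly_add eval_poly_power abs_mult power_abs
      using IH(1) by (intro mult_mono) auto
  qed
  moreover have "\<forall>i<length (x # xs). 0 < (\<rho>0 # \<rho>) ! i \<and> (\<rho>0 # \<rho>) ! i \<le> r"
    using IH(3) \<rho>0(1,2) by (auto simp: nth_Cons split: nat.split)
  moreover have "length (\<rho>0 # \<rho>) = length (x # xs)" using IH(2) by simp
  ultimately show ?case by blast
qed

lemma eval_poly_continuous_on: "continuous_on S (eval_poly p)"
  unfolding eval_poly_def[abs_def] by (intro continuous_intros)

lemma ideal_vanishing_ideal: "ideal (vanishing_ideal A) type_ring"
  unfolding ideal_type_ring_iff vanishing_ideal_def
  by (auto simp: eval_poly_zero eval_poly_add eval_poly_mult)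

text \<open>
  Some member of the boundary monoid of the polynomials \<open>x i\<close> vanishes on \<open>A\<close>, by the bound on the Krull
  dimension; but at a point where all \<open>|x i|\<close> lie in the intervals \<open>[c \<rho> i, \<rho> i]\<close> it would be bounded
  away from zero.
\<close>

lemma small_values_avoided_of_real_dim:
  fixes A K :: "(real ^ 'v::finite) set" and x :: "'i \<Rightarrow> 'v rpoly"
  assumes dim: "real_dim A \<le> ereal (real m)" and K: "compact K" "K \<subseteq> A"
    and I: "finite I" "card I = Suc m" and c: "0 < c" "c \<le> 1" and "0 < r"
  obtains \<rho> where "\<And>i. i \<in> I \<Longrightarrow> 0 < \<rho> i \<and> \<rho> i \<le> r"
    "\<And>v. v \<in> K \<Longrightarrow> \<exists>i\<in>I. \<not> (c * \<rho> i \<le> \<bar>eval_poly (x i) v\<bar> \<and> \<bar>eval_poly (x i) v\<bar> \<le> \<rho> i)"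
proof -
  obtain ks where ks: "set ks = I" "distinct ks" using finite_distinct_list[OF I(1)] by blast
  then have len: "length ks = Suc m" using I(2) distinct_card by fastforce
  have bdd: "bounded (eval_poly q ` K)" for q
    by (intro compact_imp_bounded compact_continuous_image eval_poly_continuous_on K(1))
  obtain p where p: "p \<in> vanishing_ideal A" "p \<in> boundary_monoid (map x ks)"
    using boundary_monoid_meets_ideal_of_krull_dim[OF ideal_vanishing_ideal dim[unfolded real_dim_def], of "map x ks"] len
    by auto
  from boundary_monoid_bounded_below[OF bdd c \<open>0 < r\<close> p(2)]
  obtain \<rho> \<beta> where \<rho>: "0 < \<beta>" "length \<rho> = length ks" "\<And>k. k < length ks \<Longrightarrow> 0 < \<rho> ! k \<and> \<rho> ! k \<le> r"
    "\<And>v. v \<in> K \<Longrightarrow> (\<forall>k<length ks. c * \<rho> ! k \<le> \<bar>eval_poly (x (ks ! k)) v\<bar> \<and> \<bar>eval_poly (x (ks ! k)) v\<bar> \<le> \<rho> ! k)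
        \<Longrightarrow> \<beta> \<le> \<bar>eval_poly p v\<bar>" by auto
  define f where "f = the_inv_into {..<length ks} ((!) ks)"
  have f: "f (ks ! k) = k" if "k < length ks" for k
    unfolding f_def using that ks(2) by (intro the_inv_into_f_f) (auto simp: inj_on_def nth_eq_iff_index_eq)
  show ?thesis
  proof (rule that[of "\<lambda>i. \<rho> ! f i"])
    fix i assume "i \<in> I"
    then obtain k where "k < length ks" "ks ! k = i" using ks(1) by (auto simp: in_set_conv_nth)
    then show "0 < \<rho> ! f i \<and> \<rho> ! f i \<le> r" using f \<rho>(3) by auto
  next
    fix v assume v: "v \<in> K"
    have "eval_poly p v = 0" using p(1) v K(2) by (auto simp: vanishing_ideal_def)
    then obtain k where "k < length ks"
      "\<not> (c * \<rho> ! k \<le> \<bar>eval_poly (x (ks ! k)) v\<bar> \<and> \<bar>eval_poly (x (ks ! k)) v\<bar> \<le> \<rho> ! k)"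
      using \<rho>(4)[OF v] \<rho>(1) by fastforce
    then show "\<exists>i\<in>I. \<not> (c * \<rho> ! f i \<le> \<bar>eval_poly (x i) v\<bar> \<and> \<bar>eval_poly (x i) v\<bar> \<le> \<rho> ! f i)"
      using ks(1) f nth_mem[of k ks] by (intro bexI[of _ "ks ! k"]) auto
  qed
qed

text \<open>
  The consequence of dimension at most \<open>m\<close> on which the geometry rests. For \<open>c = 1\<close> it says that the
  image of \<open>K\<close> under \<open>m + 1\<close> affine functions misses points arbitrarily close to 0. The intervals of
  positive length for \<open>c < 1\<close> leave room for a bounded factor, which depends on the point of \<open>K\<close>; such
  factors arise in generic projections and in passing from the sphere to a chart. The functions are
  indexed by coordinates because this is how they are used.
\<close>

definition thin :: "nat \<Rightarrow> (real ^ 'n::finite) set \<Rightarrow> bool" where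
  "thin m V \<longleftrightarrow> (\<forall>K (a :: 'n \<Rightarrow> real) (b :: 'n \<Rightarrow> real ^ 'n) I c r.
     compact K \<and> K \<subseteq> V \<and> card I = Suc m \<and> 0 < c \<and> c \<le> 1 \<and> 0 < r \<longrightarrow>
     (\<exists>\<rho>. (\<forall>i\<in>I. 0 < \<rho> i \<and> \<rho> i \<le> r) \<and>
        (\<forall>v\<in>K. \<exists>i\<in>I. \<not> (c * \<rho> i \<le> \<bar>a i + b i \<bullet> v\<bar> \<and> \<bar>a i + b i \<bullet> v\<bar> \<le> \<rho> i))))"

lemma thinD:
  fixes V :: "(real ^ 'n::finite) set" and I :: "'n set"
  assumes "thin m V" "compact K" "K \<subseteq> V" "card I = Suc m" "0 < c" "c \<le> 1" "0 < r"
  obtains \<rho> where "\<And>i. i \<in> I \<Longrightarrow> 0 < \<rho> i \<and> \<rho> i \<le> r"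
    "\<And>v. v \<in> K \<Longrightarrow> \<exists>i\<in>I. \<not> (c * \<rho> i \<le> \<bar>a i + b i \<bullet> v\<bar> \<and> \<bar>a i + b i \<bullet> v\<bar> \<le> \<rho> i)"
proof -
  have "\<exists>\<rho>. (\<forall>i\<in>I. 0 < \<rho> i \<and> \<rho> i \<le> r) \<and>
        (\<forall>v\<in>K. \<exists>i\<in>I. \<not> (c * \<rho> i \<le> \<bar>a i + b i \<bullet> v\<bar> \<and> \<bar>a i + b i \<bullet> v\<bar> \<le> \<rho> i))"
    using assms(1)[unfolded thin_def, rule_format, of K I c r a b] assms by blast
  then show thesis using that by blast
qed

lemma inner_eq_sum: "(b :: real ^ 'n::finite) \<bullet> v = (\<Sum>j\<in>UNIV. b $ j * v $ j)"
  by (simp add: inner_vec_def)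

lemma hom_poly_affine_form:
  "hom_poly 1 (\<lambda>x :: real ^ 'n::finite option. a * x $ None + (\<Sum>j\<in>UNIV. b $ j * x $ Some j))"
  by (intro hom_poly.add hom_poly_sum hom_poly_cmult hom_poly_coord)

lemma thin_of_real_dim:
  fixes V :: "(real ^ 'n::finite) set"
  assumes "real_dim V \<le> ereal (real m)"
  shows "thin m V"
  unfolding thin_def
proof (intro allI impI)
  fix K and a :: "'n \<Rightarrow> real" and b :: "'n \<Rightarrow> real ^ 'n" and I :: "'n set" and c r :: real
  assume *: "compact K \<and> K \<subseteq> V \<and> card I = Suc m \<and> 0 < c \<and> c \<le> 1 \<and> 0 < r"
  have "\<exists>p. eval_poly p = (\<lambda>v. a i + b i \<bullet> v)" for i
    using dehomogenization_rpoly[OF hom_poly_affine_form[of "a i" "b i"]]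
    by (metis (no_types, lifting) affine_pt_nth(1,2) ext inner_eq_sum mult.right_neutral sum.cong)
  then obtain p where p: "\<And>i. eval_poly (p i) = (\<lambda>v. a i + b i \<bullet> v)" by metis
  have "finite I" by simp
  with * small_values_avoided_of_real_dim[OF assms, of K I c r p]
  obtain \<rho> where "\<And>i. i \<in> I \<Longrightarrow> 0 < \<rho> i \<and> \<rho> i \<le> r"
    "\<And>v. v \<in> K \<Longrightarrow> \<exists>i\<in>I. \<not> (c * \<rho> i \<le> \<bar>eval_poly (p i) v\<bar> \<and> \<bar>eval_poly (p i) v\<bar> \<le> \<rho> i)"
    by metis
  then show "\<exists>\<rho>. (\<forall>i\<in>I. 0 < \<rho> i \<and> \<rho> i \<le> r) \<and>
        (\<forall>v\<in>K. \<exists>i\<in>I. \<not> (c * \<rho> i \<le> \<bar>a i + b i \<bullet> v\<bar> \<and> \<bar>a i + b i \<bullet> v\<bar> \<le> \<rho> i))"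
    unfolding p by blast
qed

text \<open>
  An affine function on \<open>V\<close> extends to a linear form, whose values on \<open>V\<close> and on the radial projection
  of \<open>V\<close> into \<open>Z\<close> differ by the factor \<open>N\<close>. On a compact set \<open>N\<close> lies between 1 and some \<open>M\<close>, so
  avoiding the larger intervals with \<open>c / M\<close> on \<open>Z\<close> suffices.
\<close>

lemma thin_of_real_dim_cone:
  fixes V :: "(real ^ 'n::finite) set" and Z :: "(real ^ 'n option) set"
  assumes dim: "real_dim Z \<le> ereal (real m)" and W: "linear W"
    and cont: "continuous_on V \<phi>" "continuous_on V N"
    and \<phi>: "\<And>v. v \<in> V \<Longrightarrow> \<phi> v \<in> Z"
    and N: "\<And>v. v \<in> V \<Longrightarrow> N v \<ge> 1" "\<And>v. v \<in> V \<Longrightarrow> N v *\<^sub>R W (\<phi> v) = affine_pt v"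
  shows "thin m V"
  unfolding thin_def
proof (intro allI impI)
  fix K and a :: "'n \<Rightarrow> real" and b :: "'n \<Rightarrow> real ^ 'n" and I :: "'n set" and c r :: real
  assume *: "compact K \<and> K \<subseteq> V \<and> card I = Suc m \<and> 0 < c \<and> c \<le> 1 \<and> 0 < r"
  define l where "l i x = a i * x $ None + (\<Sum>j\<in>UNIV. b i $ j * x $ Some j)" for i and x :: "real ^ 'n option"
  have hl: "hom_poly 1 (l i)" for i
    unfolding l_def[abs_def] by (rule hom_poly_affine_form)
  have "\<exists>p. eval_poly p = (\<lambda>x. l i (W x))" for i
    using hom_poly_rpoly[OF hom_poly_compose_linear[OF hl W]] by metis
  then obtain p where p: "\<And>i. eval_poly (p i) = (\<lambda>x. l i (W x))" by metis
  have comp: "compact (\<phi> ` K)" "\<phi> ` K \<subseteq> Z"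
    using * \<phi> cont by (auto intro!: compact_continuous_image elim: continuous_on_subset)
  have "bounded (N ` K)"
    using * cont by (intro compact_imp_bounded compact_continuous_image) (auto elim: continuous_on_subset)
  then obtain M0 where M0: "\<And>v. v \<in> K \<Longrightarrow> \<bar>N v\<bar> \<le> M0" unfolding bounded_iff by auto
  define M where "M = max 1 M0"
  have M: "M \<ge> 1" "\<And>v. v \<in> K \<Longrightarrow> N v \<le> M" using M0 by (force simp: M_def)+
  have c': "0 < c / M" "c / M \<le> 1" using * M(1) by (auto simp: field_simps)
  have fin: "finite I" by simp
  obtain \<rho> where \<rho>: "\<And>i. i \<in> I \<Longrightarrow> 0 < \<rho> i \<and> \<rho> i \<le> r"
    "\<And>v. v \<in> \<phi> ` K \<Longrightarrow> \<exists>i\<in>I. \<not> (c / M * \<rho> i \<le> \<bar>eval_poly (p i) v\<bar> \<and> \<bar>eval_poly (p i) v\<bar> \<le> \<rho> i)"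
    using small_values_avoided_of_real_dim[OF dim comp fin _ c', of r p] * by metis
  have "\<exists>i\<in>I. \<not> (c * \<rho> i \<le> \<bar>a i + b i \<bullet> v\<bar> \<and> \<bar>a i + b i \<bullet> v\<bar> \<le> \<rho> i)" if v: "v \<in> K" for v
  proof (rule ccontr)
    assume "\<not> ?thesis"
    then have h: "\<And>i. i \<in> I \<Longrightarrow> c * \<rho> i \<le> \<bar>a i + b i \<bullet> v\<bar> \<and> \<bar>a i + b i \<bullet> v\<bar> \<le> \<rho> i" by blast
    have vV: "v \<in> V" using v * by blast
    obtain i where i: "i \<in> I" "\<not> (c / M * \<rho> i \<le> \<bar>l i (W (\<phi> v))\<bar> \<and> \<bar>l i (W (\<phi> v))\<bar> \<le> \<rho> i)"
      using \<rho>(2)[of "\<phi> v"] v unfolding p by blast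
    have "a i + b i \<bullet> v = l i (affine_pt v)" by (simp add: l_def inner_eq_sum)
    also have "\<dots> = N v * l i (W (\<phi> v))"
      unfolding N(2)[OF vV, symmetric] using hom_poly_scale[OF hl] by simp
    finally have eq: "\<bar>a i + b i \<bullet> v\<bar> = N v * \<bar>l i (W (\<phi> v))\<bar>"
      using N(1)[OF vV] by (simp add: abs_mult)
    have "N v * \<bar>l i (W (\<phi> v))\<bar> \<le> M * \<bar>l i (W (\<phi> v))\<bar>" "1 * \<bar>l i (W (\<phi> v))\<bar> \<le> N v * \<bar>l i (W (\<phi> v))\<bar>"
      using M(2)[OF v] N(1)[OF vV] by (intro mult_right_mono; simp)+
    with h[OF i(1)] have "c * \<rho> i \<le> M * \<bar>l i (W (\<phi> v))\<bar>" "\<bar>l i (W (\<phi> v))\<bar> \<le> \<rho> i"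
      unfolding eq by linarith+
    with i(2) M(1) show False by (simp add: field_simps)
  qed
  with \<rho>(1) show "\<exists>\<rho>. (\<forall>i\<in>I. 0 < \<rho> i \<and> \<rho> i \<le> r) \<and>
        (\<forall>v\<in>K. \<exists>i\<in>I. \<not> (c * \<rho> i \<le> \<bar>a i + b i \<bullet> v\<bar> \<and> \<bar>a i + b i \<bullet> v\<bar> \<le> \<rho> i))"
    by blast
qed

lemma thin_linear_vimage:
  fixes A B :: "real ^ 'n::finite \<Rightarrow> real ^ 'n"
  assumes "thin m V" "linear A" "linear B" "\<And>y. A (B y) = y"
  shows "thin m {y. B y \<in> V}"
  unfolding thin_def
proof (intro allI impI)
  fix K and a :: "'n \<Rightarrow> real" and b :: "'n \<Rightarrow> real ^ 'n" and I :: "'n set" and c r :: real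
  assume *: "compact K \<and> K \<subseteq> {y. B y \<in> V} \<and> card I = Suc m \<and> 0 < c \<and> c \<le> 1 \<and> 0 < r"
  have "compact (B ` K)" "B ` K \<subseteq> V"
    using * assms(3) by (auto intro!: compact_continuous_image linear_continuous_on linear_conv_bounded_linear[THEN iffD1])
  with * obtain \<rho> where \<rho>: "\<And>i. i \<in> I \<Longrightarrow> 0 < \<rho> i \<and> \<rho> i \<le> r"
    "\<And>v. v \<in> B ` K \<Longrightarrow> \<exists>i\<in>I. \<not> (c * \<rho> i \<le> \<bar>a i + adjoint A (b i) \<bullet> v\<bar> \<and> \<bar>a i + adjoint A (b i) \<bullet> v\<bar> \<le> \<rho> i)"
    using thinD[OF assms(1), of "B ` K" I c r a "\<lambda>i. adjoint A (b i)"] by blast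
  have eq: "adjoint A (b i) \<bullet> B y = b i \<bullet> y" for i y
    using adjoint_works[OF assms(2), of "B y" "b i"] assms(4)[of y] by (simp add: inner_commute)
  show "\<exists>\<rho>. (\<forall>i\<in>I. 0 < \<rho> i \<and> \<rho> i \<le> r) \<and>
        (\<forall>v\<in>K. \<exists>i\<in>I. \<not> (c * \<rho> i \<le> \<bar>a i + b i \<bullet> v\<bar> \<and> \<bar>a i + b i \<bullet> v\<bar> \<le> \<rho> i))"
  proof (intro exI[of _ \<rho>] conjI ballI)
    fix v assume "v \<in> K"
    then show "\<exists>i\<in>I. \<not> (c * \<rho> i \<le> \<bar>a i + b i \<bullet> v\<bar> \<and> \<bar>a i + b i \<bullet> v\<bar> \<le> \<rho> i)"
      using \<rho>(2)[of "B v"] unfolding eq by blast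
  qed (use \<rho>(1) in blast)+
qed

lemma not_thin_UNIV:
  assumes "Suc m \<le> CARD('n::finite)"
  shows "\<not> thin m (UNIV :: (real ^ 'n) set)"
proof
  assume th: "thin m (UNIV :: (real ^ 'n) set)"
  obtain I :: "'n set" where I: "card I = Suc m" using obtain_subset_with_card_n[OF assms] by metis
  obtain \<rho> where \<rho>: "\<And>i. i \<in> I \<Longrightarrow> 0 < \<rho> i \<and> \<rho> i \<le> 1"
    "\<And>v :: real ^ 'n. v \<in> cball 0 (real CARD('n)) \<Longrightarrow>
       \<exists>i\<in>I. \<not> (1 * \<rho> i \<le> \<bar>0 + axis i 1 \<bullet> v\<bar> \<and> \<bar>0 + axis i 1 \<bullet> v\<bar> \<le> \<rho> i)"
    by (rule thinD[OF th compact_cball _ I, of 0 "real CARD('n)" 1 1 "\<lambda>_. 0" "\<lambda>i. axis i 1"]) auto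
  define v :: "real ^ 'n" where "v = (\<chi> i. if i \<in> I then \<rho> i else 0)"
  have "norm v \<le> (\<Sum>i\<in>UNIV. \<bar>v $ i\<bar>)" by (rule norm_le_l1_cart)
  also have "\<dots> \<le> (\<Sum>i\<in>(UNIV :: 'n set). 1)" using \<rho>(1) by (intro sum_mono) (force simp: v_def abs_le_iff)
  finally have "v \<in> cball 0 (real CARD('n))" by simp
  from \<rho>(2)[OF this] obtain i where "i \<in> I" "\<not> (\<rho> i \<le> \<bar>v $ i\<bar> \<and> \<bar>v $ i\<bar> \<le> \<rho> i)"
    by (auto simp: inner_axis')
  with \<rho>(1)[of i] show False by (auto simp: v_def)
qed

text \<open>
  Only finitely many compact pieces \<open>K x l\<close> of \<open>V\<close> matter, on which the \<open>l\<close>-th coordinate of \<open>y - x\<close> is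
  bounded away from zero. For each piece the matrices with the required property form an open set,
  by compactness, and a dense one, by thinness: changing the \<open>l\<close>-th column of a matrix slightly adds to
  its linear forms multiples of a coordinate that is neither small nor large. By Baire's theorem
  some invertible matrix belongs to all these sets.
\<close>

lemma generic_projection:
  fixes V :: "(real ^ 'n::finite) set"
  assumes th: "thin m V" and V: "closed V" and T: "finite T" and "\<epsilon> > 0" and I: "card I = Suc m"
  obtains A :: "real ^ 'n ^ 'n" where "invertible A"
    "\<And>x y. x \<in> T \<Longrightarrow> y \<in> V \<Longrightarrow> dist x y = \<epsilon> \<Longrightarrow> \<exists>i\<in>I. (A *v (y - x)) $ i \<noteq> 0"
proof -
  define \<delta> where "\<delta> = \<epsilon> / CARD('n)"
  have \<delta>: "0 < \<delta>" "\<delta> \<le> \<epsilon>" using \<open>\<epsilon> > 0\<close> by (auto simp: \<delta>_def field_simps)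
  define K where "K x l = {y \<in> V. dist x y = \<epsilon> \<and> \<delta> \<le> \<bar>(y - x) $ l\<bar>}" for x and l :: 'n
  have K: "compact (K x l)" for x l
  proof -
    have "closed {y. \<delta> \<le> \<bar>(y - x) $ l\<bar>}"
      by (intro closed_Collect_le continuous_intros)
    then have "compact (sphere x \<epsilon> \<inter> (V \<inter> {y. \<delta> \<le> \<bar>(y - x) $ l\<bar>}))"
      using V by (intro compact_Int_closed compact_sphere closed_Int)
    moreover have "K x l = sphere x \<epsilon> \<inter> (V \<inter> {y. \<delta> \<le> \<bar>(y - x) $ l\<bar>})" by (auto simp: K_def)
    ultimately show ?thesis by simp
  qed
  define G where "G x l = {A :: real ^ 'n ^ 'n. \<forall>y\<in>K x l. \<exists>i\<in>I. (A *v (y - x)) $ i \<noteq> 0}" for x l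
  have opn: "open (G x l)" for x l
  proof -
    have "closed {p :: (real ^ 'n) \<times> (real ^ 'n ^ 'n). \<forall>i\<in>I. (snd p *v (fst p - x)) $ i = 0}"
    proof -
      have "closed {p :: (real ^ 'n) \<times> (real ^ 'n ^ 'n). (snd p *v (fst p - x)) $ i = 0}" for i
        unfolding matrix_vector_mult_def
        by (intro closed_Collect_eq) (auto intro!: continuous_intros)
      then have "closed (\<Inter>i\<in>I. {p :: (real ^ 'n) \<times> (real ^ 'n ^ 'n). (snd p *v (fst p - x)) $ i = 0})"
        by blast
      then show ?thesis by (rule back_subst[of closed]) auto
    qed
    then have "closed {A. \<exists>y. y \<in> K x l \<and> (y, A) \<in>
        {p :: (real ^ 'n) \<times> (real ^ 'n ^ 'n). \<forall>i\<in>I. (snd p *v (fst p - x)) $ i = 0}}"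
      by (rule closed_compact_projection[OF K])
    then have "closed (- G x l)" by (rule back_subst[of closed]) (auto simp: G_def)
    then show ?thesis by (simp add: closed_def)
  qed
  have dense: "UNIV \<subseteq> closure (G x l)" for x l
  proof
    fix A :: "real ^ 'n ^ 'n"
    show "A \<in> closure (G x l)"
      unfolding closure_approachable
    proof (intro allI impI)
      fix e :: real assume "e > 0"
      define r where "r = min \<epsilon> (e * \<epsilon> / (2 * CARD('n)))"
      have r: "r > 0" "r \<le> e * \<epsilon> / (2 * CARD('n))" using \<open>\<epsilon> > 0\<close> \<open>e > 0\<close> by (auto simp: r_def)
      have sub: "K x l \<subseteq> V" by (auto simp: K_def)
      obtain \<rho> where \<rho>: "\<And>i. i \<in> I \<Longrightarrow> 0 < \<rho> i \<and> \<rho> i \<le> r"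
        "\<And>y. y \<in> K x l \<Longrightarrow> \<exists>i\<in>I. \<not> (\<delta> / \<epsilon> * \<rho> i \<le> \<bar>- (A $ i \<bullet> x) + A $ i \<bullet> y\<bar> \<and> \<bar>- (A $ i \<bullet> x) + A $ i \<bullet> y\<bar> \<le> \<rho> i)"
        using thinD[OF th K sub I, of "\<delta> / \<epsilon>" r "\<lambda>i. - (A $ i \<bullet> x)" "\<lambda>i. A $ i"] \<delta> r(1) by auto
      \<comment> \<open>The new form vanishes only where the old one was \<open>\<rho> i / \<epsilon>\<close> times the \<open>l\<close>-th coordinate. That
        coordinate lies between \<open>\<delta>\<close> and \<open>\<epsilon>\<close> in modulus, so the old value was in an avoided interval.\<close>
      define A' :: "real ^ 'n ^ 'n" where
        "A' = (\<chi> i. if i \<in> I then A $ i - (\<rho> i / \<epsilon>) *\<^sub>R axis l 1 else A $ i)"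
      have "A' \<in> G x l"
        unfolding G_def
      proof (intro CollectI ballI)
        fix y assume y: "y \<in> K x l"
        then obtain i where i: "i \<in> I" "\<not> (\<delta> / \<epsilon> * \<rho> i \<le> \<bar>A $ i \<bullet> (y - x)\<bar> \<and> \<bar>A $ i \<bullet> (y - x)\<bar> \<le> \<rho> i)"
          using \<rho>(2) by (auto simp: inner_diff_right)
        have "(A' *v (y - x)) $ i = A $ i \<bullet> (y - x) - \<rho> i / \<epsilon> * (y - x) $ l"
          using i(1) by (simp add: A'_def matrix_vector_mul_component inner_diff_left inner_axis')
        moreover have "A $ i \<bullet> (y - x) \<noteq> \<rho> i / \<epsilon> * (y - x) $ l"
        proof
          assume eq: "A $ i \<bullet> (y - x) = \<rho> i / \<epsilon> * (y - x) $ l"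
          have "\<delta> \<le> \<bar>(y - x) $ l\<bar>" using y by (simp add: K_def)
          moreover have "\<bar>(y - x) $ l\<bar> \<le> \<epsilon>"
            using y component_le_norm_cart[of "y - x" l] by (simp add: K_def dist_norm norm_minus_commute)
          moreover have pos: "0 < \<rho> i / \<epsilon>" using \<rho>(1)[OF i(1)] \<open>\<epsilon> > 0\<close> by simp
          ultimately have "\<rho> i / \<epsilon> * \<delta> \<le> \<bar>A $ i \<bullet> (y - x)\<bar>" "\<bar>A $ i \<bullet> (y - x)\<bar> \<le> \<rho> i / \<epsilon> * \<epsilon>"
            unfolding eq abs_mult abs_of_pos[OF pos] by (simp_all only: mult_le_cancel_left_pos[OF pos])
          with i(2) \<open>\<epsilon> > 0\<close> show False by (simp add: mult.commute)
        qed
        ultimately have "(A' *v (y - x)) $ i \<noteq> 0" by simp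
        then show "\<exists>i\<in>I. (A' *v (y - x)) $ i \<noteq> 0" using i(1) by blast
      qed
      moreover have "dist A' A < e"
      proof -
        have "norm ((A' - A) $ i) \<le> e / (2 * CARD('n))" for i
        proof (cases "i \<in> I")
          case True
          then have "norm ((A' - A) $ i) = \<rho> i / \<epsilon>"
            using \<rho>(1)[OF True] \<open>\<epsilon> > 0\<close> by (simp add: A'_def)
          also have "\<dots> \<le> r / \<epsilon>" using \<rho>(1)[OF True] \<open>\<epsilon> > 0\<close> by (simp add: divide_right_mono)
          also have "\<dots> \<le> e / (2 * CARD('n))" using r(2) \<open>\<epsilon> > 0\<close> by (simp add: pos_divide_le_eq)
          finally show ?thesis .
        next
          case False
          then show ?thesis using \<open>e > 0\<close> by (simp add: A'_def)
        qed
        then have "(\<Sum>i\<in>UNIV. norm ((A' - A) $ i)) \<le> (\<Sum>i\<in>(UNIV :: 'n set). e / (2 * CARD('n)))"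
          by (intro sum_mono)
        moreover have "norm (A' - A) \<le> (\<Sum>i\<in>UNIV. norm ((A' - A) $ i))"
          unfolding norm_vec_def by (rule L2_set_le_sum) simp
        ultimately show ?thesis using \<open>e > 0\<close> by (simp add: dist_norm)
      qed
      ultimately show "\<exists>y\<in>G x l. dist y A < e" by blast
    qed
  qed
  let ?\<G> = "(\<lambda>(x, l). G x l) ` (T \<times> UNIV)"
  have cl: "UNIV \<subseteq> closure (\<Inter> ?\<G>)"
  proof (rule Baire)
    show "countable ?\<G>" using T by (intro countable_finite finite_imageI) auto
    fix U assume "U \<in> ?\<G>"
    then obtain x l where U: "U = G x l" by auto
    show "openin (top_of_set UNIV) U \<and> UNIV \<subseteq> closure U"
      unfolding U using opn dense by simp
  qed auto
  have "open {A :: real ^ 'n ^ 'n. det A \<noteq> 0}"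
    by (intro open_Collect_neq continuous_intros) (auto simp: det_def intro!: continuous_intros)
  moreover have "mat 1 \<in> {A :: real ^ 'n ^ 'n. det A \<noteq> 0}" by simp
  ultimately have "{A :: real ^ 'n ^ 'n. det A \<noteq> 0} \<inter> \<Inter> ?\<G> \<noteq> {}"
    using cl open_Int_closure_eq_empty by blast
  then obtain A where A: "det A \<noteq> 0" "A \<in> \<Inter> ?\<G>" by blast
  show ?thesis
  proof (rule that[of A])
    show "invertible A" using A(1) by (simp add: invertible_det_nz)
    fix x y assume xy: "x \<in> T" "y \<in> V" "dist x y = \<epsilon>"
    have "\<exists>l. \<delta> \<le> \<bar>(y - x) $ l\<bar>"
    proof (rule ccontr)
      assume "\<not> ?thesis"
      then have "(\<Sum>l\<in>UNIV. \<bar>(y - x) $ l\<bar>) < (\<Sum>l\<in>(UNIV :: 'n set). \<delta>)"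
        by (intro sum_strict_mono) (auto simp: not_le)
      then have "norm (y - x) < \<epsilon>"
        using norm_le_l1_cart[of "y - x"] by (simp add: \<delta>_def)
      with xy(3) show False by (simp add: dist_norm norm_minus_commute)
    qed
    then obtain l where "y \<in> K x l" using xy by (auto simp: K_def)
    moreover have "A \<in> G x l" using A(2) xy(1) by blast
    ultimately show "\<exists>i\<in>I. (A *v (y - x)) $ i \<noteq> 0" by (auto simp: G_def)
  qed
qed

section \<open>Stable zeros of polar systems\<close>

lemma has_derivative_vec_componentwise:
  fixes f :: "'a::real_normed_vector \<Rightarrow> 'b::euclidean_space ^ 'n::finite"
  assumes "\<And>i. ((\<lambda>x. f x $ i) has_derivative (\<lambda>h. f' h $ i)) (at a within S)"
  shows "(f has_derivative f') (at a within S)"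
  unfolding has_derivative_componentwise_within[of f]
proof
  fix b :: "'b ^ 'n" assume "b \<in> Basis"
  then obtain i u where b: "b = axis i u" by (auto simp: Basis_vec_def)
  show "((\<lambda>x. f x \<bullet> b) has_derivative (\<lambda>h. f' h \<bullet> b)) (at a within S)"
    unfolding b inner_axis by (intro has_derivative_inner_left assms)
qed

text \<open>
  With \<open>T\<close> the inverse of the derivative, \<open>x \<mapsto> x - T (\<Psi> x)\<close> maps a small ball around \<open>p\<close> to itself, so
  Brouwer's theorem gives a fixed point, which is a zero of \<open>\<Psi>\<close>.
\<close>

lemma nearby_zero_of_injective_derivative:
  fixes \<Phi> :: "'a::euclidean_space \<Rightarrow> 'a"
  assumes der: "(\<Phi> has_derivative \<Phi>') (at p)" and inj: "\<And>v. \<Phi>' v = 0 \<Longrightarrow> v = 0"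
    and "\<Phi> p = 0" and "r > 0"
  shows "\<exists>\<delta>>0. \<forall>\<Psi>. continuous_on (cball p r) \<Psi> \<and> (\<forall>x\<in>cball p r. norm (\<Psi> x - \<Phi> x) \<le> \<delta>)
           \<longrightarrow> (\<exists>x\<in>cball p r. \<Psi> x = 0)"
proof -
  have lin: "linear \<Phi>'" using der by (rule has_derivative_linear)
  then have "inj \<Phi>'" using inj by (simp add: linear_injective_0)
  then obtain T where T: "linear T" "\<And>x. T (\<Phi>' x) = x" "\<And>x. \<Phi>' (T x) = x"
    using linear_injective_isomorphism[OF lin] by blast
  obtain B where B: "B > 0" "\<And>x. norm (T x) \<le> B * norm x"
    using linear_bounded_pos[OF T(1)] by blast
  have "1 / (2 * B) > 0" using B by simp
  then obtain d where d: "d > 0"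
    "\<And>y. norm (y - p) < d \<Longrightarrow> norm (\<Phi> y - \<Phi> p - \<Phi>' (y - p)) \<le> 1 / (2 * B) * norm (y - p)"
    using der unfolding has_derivative_at_alt by blast
  define r' where "r' = min r (d / 2)"
  have r': "0 < r'" "r' \<le> r" "r' < d" using \<open>r > 0\<close> d(1) by (auto simp: r'_def)
  define \<delta> where "\<delta> = r' / (2 * B)"
  have "\<exists>x\<in>cball p r. \<Psi> x = 0"
    if cont: "continuous_on (cball p r) \<Psi>" and close: "\<And>x. x \<in> cball p r \<Longrightarrow> norm (\<Psi> x - \<Phi> x) \<le> \<delta>" for \<Psi>
  proof -
    define f where "f x = x - T (\<Psi> x)" for x
    have sub: "cball p r' \<subseteq> cball p r" using r'(2) by auto
    have "continuous_on (cball p r') f"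
      unfolding f_def
      by (intro continuous_intros linear_continuous_on_compose[OF _ T(1)] continuous_on_subset[OF cont sub])
    moreover have "f \<in> cball p r' \<rightarrow> cball p r'"
    proof
      fix x assume x: "x \<in> cball p r'"
      have nx: "norm (x - p) \<le> r'" using x by (simp add: dist_norm norm_minus_commute)
      have "f x - p = T (\<Phi>' (x - p)) - T (\<Psi> x)" by (simp add: f_def T(2))
      also have "\<dots> = - T (\<Phi> x - \<Phi> p - \<Phi>' (x - p)) - T (\<Psi> x - \<Phi> x)"
        using \<open>\<Phi> p = 0\<close> by (simp add: linear_diff[OF T(1)])
      also have "norm \<dots> \<le> norm (T (\<Phi> x - \<Phi> p - \<Phi>' (x - p))) + norm (T (\<Psi> x - \<Phi> x))"
        using norm_triangle_ineq4[of "- T (\<Phi> x - \<Phi> p - \<Phi>' (x - p))"] by simp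
      also have "\<dots> \<le> B * (1 / (2 * B) * r') + B * \<delta>"
      proof (intro add_mono order_trans[OF B(2)] mult_left_mono)
        have "norm (\<Phi> x - \<Phi> p - \<Phi>' (x - p)) \<le> 1 / (2 * B) * norm (x - p)"
          using d(2) nx r'(3) by simp
        also have "\<dots> \<le> 1 / (2 * B) * r'" using nx B(1) by (intro mult_left_mono) auto
        finally show "norm (\<Phi> x - \<Phi> p - \<Phi>' (x - p)) \<le> 1 / (2 * B) * r'" .
        show "norm (\<Psi> x - \<Phi> x) \<le> \<delta>" using close x sub by blast
      qed (use B(1) in auto)
      also have "\<dots> = r'" using B(1) by (simp add: \<delta>_def)
      finally show "f x \<in> cball p r'" by (simp add: dist_norm norm_minus_commute)
    qed
    ultimately obtain x where x: "x \<in> cball p r'" "f x = x"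
      using brouwer_ball[OF r'(1)] by blast
    then have "T (\<Psi> x) = 0" by (simp add: f_def)
    then have "\<Psi> x = 0" using T(3)[of "\<Psi> x"] linear_0[OF lin] by simp
    then show ?thesis using x(1) sub by blast
  qed
  moreover have "\<delta> > 0" using r'(1) B(1) by (simp add: \<delta>_def)
  ultimately show ?thesis by blast
qed

definition stable_zero :: "'i set \<Rightarrow> ('i \<Rightarrow> real ^ 'n::finite \<Rightarrow> real) \<Rightarrow> (real ^ 'n) set \<Rightarrow> bool" where
  "stable_zero idx F U \<longleftrightarrow> (\<exists>\<delta>>0. \<forall>G. (\<forall>i\<in>idx. continuous_on UNIV (G i) \<and> (\<forall>x\<in>U. \<bar>G i x - F i x\<bar> \<le> \<delta>))
     \<longrightarrow> (\<exists>x\<in>U. \<forall>i\<in>idx. G i x = 0))"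

lemma stable_zero_perturb:
  assumes "stable_zero idx F U"
  shows "\<exists>\<delta>>0. \<forall>F'. (\<forall>i\<in>idx. \<forall>x\<in>U. \<bar>F' i x - F i x\<bar> \<le> \<delta>) \<longrightarrow> stable_zero idx F' U"
proof -
  from assms obtain \<delta> where \<delta>: "\<delta> > 0"
    and zero: "\<forall>G. (\<forall>i\<in>idx. continuous_on UNIV (G i) \<and> (\<forall>x\<in>U. \<bar>G i x - F i x\<bar> \<le> \<delta>))
     \<longrightarrow> (\<exists>x\<in>U. \<forall>i\<in>idx. G i x = 0)"
    unfolding stable_zero_def by (elim exE conjE)
  have "stable_zero idx F' U" if F': "\<And>i x. i \<in> idx \<Longrightarrow> x \<in> U \<Longrightarrow> \<bar>F' i x - F i x\<bar> \<le> \<delta> / 2" for F'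
    unfolding stable_zero_def
  proof (intro exI[of _ "\<delta> / 2"] conjI allI impI)
    fix G assume G: "\<forall>i\<in>idx. continuous_on UNIV (G i) \<and> (\<forall>x\<in>U. \<bar>G i x - F' i x\<bar> \<le> \<delta> / 2)"
    show "\<exists>x\<in>U. \<forall>i\<in>idx. G i x = 0"
    proof (rule zero[rule_format])
      fix i assume i: "i \<in> idx"
      have "\<bar>G i x - F i x\<bar> \<le> \<delta>" if "x \<in> U" for x
      proof -
        have "\<bar>G i x - F' i x\<bar> \<le> \<delta> / 2" using G i that by blast
        then show ?thesis using F'[OF i that] by linarith
      qed
      then show "continuous_on UNIV (G i) \<and> (\<forall>x\<in>U. \<bar>G i x - F i x\<bar> \<le> \<delta>)" using G i by blast
    qed
  qed (use \<delta> in simp)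
  then show ?thesis using \<delta> by (intro exI[of _ "\<delta> / 2"]) simp
qed

text \<open>
  The determinant of \<open>N + c\<close> is a polynomial in \<open>c\<close>, and it is not zero for \<open>c\<close> larger than the norm
  of \<open>N\<close>.
\<close>

lemma finite_singular_shifts:
  fixes N :: "real ^ 'n::finite ^ 'n"
  shows "finite {c. \<exists>v. v \<noteq> 0 \<and> N *v v + c *\<^sub>R v = 0}"
proof -
  define P :: "real poly" where
    "P = (\<Sum>p\<in>{p. p permutes (UNIV :: 'n set)}. Polynomial.smult (of_int (sign p)) (\<Prod>i\<in>UNIV. [:N $ i $ p i, if i = p i then 1 else 0:]))"
  have P: "poly P c = det (N + mat c)" for c
    unfolding P_def det_def poly_sum poly_smult poly_prod
    by (intro sum.cong refl arg_cong2[where f = "(*)"] prod.cong) (auto simp: mat_def)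
  have shift: "(N + mat c) *v v = N *v v + c *\<^sub>R v" for c v
  proof -
    have "mat c *v v = c *\<^sub>R v"
      by (simp add: vec_eq_iff matrix_vector_mult_def mat_def if_distrib[of "\<lambda>z. z * _"] cong: if_cong)
    then show ?thesis by (simp add: matrix_vector_mult_add_rdistrib)
  qed
  have inv: "det (N + mat c) \<noteq> 0 \<longleftrightarrow> (\<forall>v. N *v v + c *\<^sub>R v = 0 \<longrightarrow> v = 0)" for c
    using matrix_left_invertible_ker[of "N + mat c"] unfolding shift
    by (simp add: invertible_det_nz[symmetric] invertible_left_inverse)
  obtain B where B: "B > 0" "\<And>v. norm (N *v v) \<le> B * norm v"
    using linear_bounded_pos[of "(*v) N"] by auto
  have "v = 0" if "N *v v + (2 * B) *\<^sub>R v = 0" for v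
  proof -
    have "N *v v = - ((2 * B) *\<^sub>R v)" using that by (simp add: eq_neg_iff_add_eq_0)
    then have "2 * B * norm v \<le> B * norm v" using B(2)[of v] B(1) by simp
    then show ?thesis using B(1) by (simp add: mult_le_cancel_right zero_compare_simps)
  qed
  then have "poly P (2 * B) \<noteq> 0" unfolding P inv by blast
  then have "P \<noteq> 0" by auto
  then have "finite {c. poly P c = 0}" by (rule poly_roots_finite)
  then show ?thesis by (rule rev_finite_subset) (use inv in \<open>auto simp: P\<close>)
qed

lemma eventually_not_in_finite_at_right:
  fixes a :: real
  assumes "finite S"
  shows "eventually (\<lambda>c. c \<notin> S) (at_right a)"
  using assms
proof (induction S)
  case (insert s S)
  have "eventually (\<lambda>c. c \<noteq> s) (at_right a)"
    using eventually_neq_at_within[of s a "{a<..}"] by simp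
  with insert.IH show ?case by eventually_elim auto
qed simp

text \<open>
  On the index set \<open>insert i0 (- I)\<close> with \<open>i0 \<in> I\<close>, this is the system of equations of the polar variety
  of \<open>f = 0\<close> for the projection to the coordinates in \<open>I\<close>. Storing the equation \<open>f\<close> at a coordinate \<open>i0\<close>
  lets the system be completed to a square one by the remaining coordinates in \<open>I\<close>.
\<close>

definition polar_system :: "'n \<Rightarrow> (real ^ 'n::finite \<Rightarrow> real) \<Rightarrow> 'n \<Rightarrow> real ^ 'n \<Rightarrow> real" where
  "polar_system i0 f i = (if i = i0 then f else partial_deriv i f)"

text \<open>
  This function and its partial derivatives in the directions \<open>J\<close> vanish at \<open>p\<close>, so adding a multiple of
  it to \<open>f\<close> does not destroy the polar point \<open>p\<close>; its linear part changes the partial derivative of \<open>f\<close>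
  in the direction \<open>i0\<close>, and its quadratic part shifts the Hessian in the directions \<open>J\<close> by a multiple
  of the identity.
\<close>

definition kick :: "'n \<Rightarrow> 'n set \<Rightarrow> real ^ 'n \<Rightarrow> real ^ 'n::finite \<Rightarrow> real" where
  "kick i0 J p x = (x $ i0 - p $ i0) + (\<Sum>j\<in>J. (x $ j - p $ j)\<^sup>2)"

lemma has_derivative_vec_nth: "((\<lambda>x. x $ i) has_derivative (\<lambda>h. h $ i)) F"
  by (rule bounded_linear_imp_has_derivative) (rule bounded_linear_vec_nth)

lemma has_derivative_kick:
  "(kick i0 J p has_derivative (\<lambda>h. h $ i0 + (\<Sum>j\<in>J. 2 * (x $ j - p $ j) * h $ j))) (at x)"
  unfolding kick_def[abs_def]
  by (auto intro!: derivative_eq_intros has_derivative_vec_nth simp: fun_eq_iff mult.commute mult.left_commute)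

lemma partial_deriv_kick:
  assumes "i0 \<notin> J" "j \<in> J" "f differentiable (at x)"
  shows "partial_deriv j (\<lambda>x. f x + \<eta> * kick i0 J p x) x = partial_deriv j f x + \<eta> * (2 * (x $ j - p $ j))"
proof -
  have "((\<lambda>x. f x + \<eta> * kick i0 J p x) has_derivative
      (\<lambda>h. frechet_derivative f (at x) h + \<eta> * (h $ i0 + (\<Sum>j\<in>J. 2 * (x $ j - p $ j) * h $ j)))) (at x)"
    using assms(3) by (auto intro!: derivative_eq_intros has_derivative_kick simp: frechet_derivative_works[symmetric])
  from partial_deriv_eqI[OF this, of j] show ?thesis
    using assms(1,2)
    by (auto simp: partial_deriv_def axis_def if_distrib[of "\<lambda>z. _ * z"] sum.delta' finite_subset[OF subset_UNIV] cong: if_cong)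
qed

text \<open>
  Complete the polar system to a square one by the coordinates in \<open>I - {i0}\<close>. Since the derivatives
  of \<open>f\<close> outside \<open>I\<close> vanish at \<open>p\<close>, its derivative at \<open>p\<close> is block triangular, with diagonal blocks an identity,
  the number \<open>\<partial>\<^sub>i\<^sub>0 f(p) + \<eta>\<close>, and the shift by \<open>2 \<eta>\<close> of the Hessian of \<open>f\<close> in the directions outside \<open>I\<close>.
  So it is invertible for all but finitely many \<open>\<eta>\<close>.
\<close>

lemma eventually_stable_zero_kick:
  fixes f :: "real ^ 'n::finite \<Rightarrow> real" and I :: "'n set"
  assumes i0: "i0 \<in> I" and U: "open U" "p \<in> U"
    and f: "\<And>x. f differentiable (at x)" "\<And>i. partial_deriv i f differentiable (at p)"
    and p: "f p = 0" "\<And>j. j \<notin> I \<Longrightarrow> partial_deriv j f p = 0"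
  shows "eventually (\<lambda>\<eta>. stable_zero (insert i0 (- I)) (polar_system i0 (\<lambda>x. f x + \<eta> * kick i0 (- I) p x)) U) (at_right 0)"
proof -
  define H where "H i l = partial_deriv l (partial_deriv i f) p" for i l
  define N :: "real ^ 'n ^ 'n" where "N = (\<chi> i l. if i \<notin> I \<and> l \<notin> I then H i l else 0)"
  define bad where "bad = insert (- partial_deriv i0 f p) ((\<lambda>c. c / 2) ` {c. \<exists>v. v \<noteq> 0 \<and> N *v v + c *\<^sub>R v = 0})"
  have "finite bad" unfolding bad_def by (intro finite.insertI finite_imageI finite_singular_shifts)
  then have "eventually (\<lambda>\<eta>. \<eta> \<notin> bad) (at_right 0)" by (rule eventually_not_in_finite_at_right)
  then show ?thesis
  proof eventually_elim
    fix \<eta> assume \<eta>: "\<eta> \<notin> bad"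
    define g where "g x = f x + \<eta> * kick i0 (- I) p x" for x
    have pg: "partial_deriv j g x = partial_deriv j f x + \<eta> * (2 * (x $ j - p $ j))" if "j \<notin> I" for j x
      unfolding g_def using partial_deriv_kick[OF _ _ f(1), of i0 "- I" j] that i0 by auto
    define \<Phi> where "\<Phi> x = (\<chi> i. if i \<in> insert i0 (- I) then polar_system i0 g i x else x $ i - p $ i)" for x
    define \<Phi>' :: "real ^ 'n \<Rightarrow> real ^ 'n" where "\<Phi>' h = (\<chi> i. if i = i0 then (\<Sum>l\<in>UNIV. partial_deriv l f p * h $ l) + \<eta> * h $ i0
        else if i \<notin> I then (\<Sum>l\<in>UNIV. H i l * h $ l) + 2 * \<eta> * h $ i else h $ i)" for h
    have der: "(\<Phi> has_derivative \<Phi>') (at p)"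
    proof (rule has_derivative_vec_componentwise)
      fix i
      consider "i = i0" | "i \<noteq> i0" "i \<notin> I" | "i \<noteq> i0" "i \<in> I" by blast
      then show "((\<lambda>x. \<Phi> x $ i) has_derivative (\<lambda>h. \<Phi>' h $ i)) (at p)"
      proof cases
        case 1
        have "(g has_derivative (\<lambda>h. (\<Sum>l\<in>UNIV. partial_deriv l f p * h $ l) + \<eta> * h $ i0)) (at p)"
          unfolding g_def[abs_def]
          by (auto intro!: derivative_eq_intros has_derivative_partial_deriv[OF f(1)] has_derivative_kick)
        then show ?thesis using 1 by (simp add: \<Phi>_def \<Phi>'_def polar_system_def)
      next
        case 2
        have "((\<lambda>x. partial_deriv i f x + \<eta> * (2 * (x $ i - p $ i))) has_derivative
            (\<lambda>h. (\<Sum>l\<in>UNIV. H i l * h $ l) + 2 * \<eta> * h $ i)) (at p)"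
          unfolding H_def
          by (auto intro!: derivative_eq_intros has_derivative_partial_deriv[OF f(2)] has_derivative_vec_nth)
        then show ?thesis using 2 by (simp add: \<Phi>_def \<Phi>'_def polar_system_def pg)
      next
        case 3
        then show ?thesis
          by (auto simp: \<Phi>_def \<Phi>'_def intro!: derivative_eq_intros has_derivative_vec_nth)
      qed
    qed
    have inj: "h = 0" if h0: "\<Phi>' h = 0" for h
    proof -
      have comp: "\<Phi>' h $ i = 0" for i using h0 by simp
      have hI: "h $ i = 0" if "i \<in> I" "i \<noteq> i0" for i
        using comp[of i] that by (simp add: \<Phi>'_def)
      have "(\<Sum>l\<in>UNIV. partial_deriv l f p * h $ l) = (\<Sum>l\<in>UNIV. if l = i0 then partial_deriv i0 f p * h $ i0 else 0)"
        using hI p(2) by (intro sum.cong) auto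
      then have "(partial_deriv i0 f p + \<eta>) * h $ i0 = 0"
        using comp[of i0] by (simp add: \<Phi>'_def distrib_right)
      moreover have "partial_deriv i0 f p + \<eta> \<noteq> 0" using \<eta> by (auto simp: bad_def)
      ultimately have hI': "h $ i = 0" if "i \<in> I" for i using hI that by (cases "i = i0") auto
      have "N *v h + (2 * \<eta>) *\<^sub>R h = 0"
      proof (subst vec_eq_iff, intro allI)
        fix i
        show "(N *v h + (2 * \<eta>) *\<^sub>R h) $ i = 0 $ i"
        proof (cases "i \<in> I")
          case True
          then show ?thesis using hI' by (simp add: matrix_vector_mult_def N_def)
        next
          case False
          then have "(N *v h) $ i = (\<Sum>l\<in>UNIV. H i l * h $ l)"
            unfolding matrix_vector_mult_def N_def using hI' by (auto intro!: sum.cong)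
          moreover have "i \<noteq> i0" using False i0 by blast
          ultimately show ?thesis using comp[of i] False by (simp add: \<Phi>'_def)
        qed
      qed
      moreover have "2 * \<eta> \<notin> {c. \<exists>v. v \<noteq> 0 \<and> N *v v + c *\<^sub>R v = 0}"
        using \<eta> unfolding bad_def by (metis (no_types, lifting) image_eqI insertCI nonzero_mult_div_cancel_left zero_neq_numeral)
      ultimately show ?thesis by blast
    qed
    have "\<Phi> p = 0"
      using p i0 by (simp add: vec_eq_iff \<Phi>_def polar_system_def pg) (simp add: g_def kick_def)
    obtain r where r: "r > 0" "cball p r \<subseteq> U" using U open_contains_cball by blast
    obtain \<delta> where \<delta>: "\<delta> > 0"
      "\<And>\<Psi>. continuous_on (cball p r) \<Psi> \<Longrightarrow> (\<And>x. x \<in> cball p r \<Longrightarrow> norm (\<Psi> x - \<Phi> x) \<le> \<delta>)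
           \<Longrightarrow> (\<exists>x\<in>cball p r. \<Psi> x = 0)"
      using nearby_zero_of_injective_derivative[OF der inj \<open>\<Phi> p = 0\<close> r(1)] by blast
    show "stable_zero (insert i0 (- I)) (polar_system i0 (\<lambda>x. f x + \<eta> * kick i0 (- I) p x)) U"
      unfolding stable_zero_def g_def[symmetric]
    proof (intro exI[of _ "\<delta> / CARD('n)"] conjI allI impI)
      show "\<delta> / CARD('n) > 0" using \<delta>(1) by simp
      fix G assume G: "\<forall>i\<in>insert i0 (- I). continuous_on UNIV (G i) \<and> (\<forall>x\<in>U. \<bar>G i x - polar_system i0 g i x\<bar> \<le> \<delta> / CARD('n))"
      define \<Psi> where "\<Psi> x = (\<chi> i. if i \<in> insert i0 (- I) then G i x else x $ i - p $ i)" for x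
      have "continuous_on (cball p r) \<Psi>"
        unfolding \<Psi>_def
      proof (rule continuous_on_vec_lambda)
        fix i
        show "continuous_on (cball p r) (\<lambda>x. if i \<in> insert i0 (- I) then G i x else x $ i - p $ i)"
        proof (cases "i \<in> insert i0 (- I)")
          case True
          then have "continuous_on UNIV (G i)" using G by blast
          then show ?thesis using True by (simp add: continuous_on_subset[of UNIV])
        next
          case False
          then show ?thesis by (simp, intro continuous_intros)
        qed
      qed
      moreover have "norm (\<Psi> x - \<Phi> x) \<le> \<delta>" if x: "x \<in> cball p r" for x
      proof -
        have "\<bar>(\<Psi> x - \<Phi> x) $ i\<bar> \<le> \<delta> / CARD('n)" for i
          using G x r(2) \<delta>(1) by (cases "i \<in> insert i0 (- I)") (auto simp: \<Psi>_def \<Phi>_def)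
        then have "(\<Sum>i\<in>UNIV. \<bar>(\<Psi> x - \<Phi> x) $ i\<bar>) \<le> (\<Sum>i\<in>(UNIV :: 'n set). \<delta> / CARD('n))"
          by (intro sum_mono)
        then show ?thesis using norm_le_l1_cart[of "\<Psi> x - \<Phi> x"] by simp
      qed
      ultimately obtain x where x: "x \<in> cball p r" "\<Psi> x = 0" using \<delta>(2) by blast
      have "G i x = 0" if i: "i \<in> insert i0 (- I)" for i
      proof -
        have "\<Psi> x $ i = G i x" unfolding \<Psi>_def using i by simp
        then show ?thesis using x(2) by simp
      qed
      then show "\<exists>x\<in>U. \<forall>i\<in>insert i0 (- I). G i x = 0" using x(1) r(2) by blast
    qed
  qed
qed

definition proj_coords :: "'n set \<Rightarrow> real ^ 'n \<Rightarrow> real ^ 'n::finite" where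
  "proj_coords I x = (\<chi> i. if i \<in> I then x $ i else 0)"

lemma proj_coords_nth [simp]: "proj_coords I x $ i = (if i \<in> I then x $ i else 0)"
  by (simp add: proj_coords_def)

lemma linear_proj_coords: "linear (proj_coords I)"
  by (intro linearI) (simp_all add: vec_eq_iff)

lemma continuous_on_proj_coords: "continuous_on S (proj_coords I)"
  by (rule linear_continuous_on[OF linear_conv_bounded_linear[THEN iffD1, OF linear_proj_coords]])

text \<open>
  Move along the segment from the projection of \<open>x0\<close> to that of \<open>y\<close>, and let \<open>z\<close> be a point of
  \<open>f \<le> 0\<close> over the last point of the segment where there is one. It lies in the open set \<open>U\<close>,
  since the frontier points with \<open>f \<le> 0\<close> project too far away. If \<open>f\<close> were negative at \<open>z\<close>, or
  had there a nonzero derivative along the fibre of the projection, then from \<open>z\<close> one could move on over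
  the segment while keeping \<open>f \<le> 0\<close>, correcting the direction along the fibre.
\<close>

lemma polar_point_of_boundary_of_projection:
  fixes f :: "real ^ 'n::finite \<Rightarrow> real" and I :: "'n set"
  assumes f: "\<And>x. f differentiable (at x)"
    and U: "open U" "bounded U" and x0: "x0 \<in> U" "f x0 < 0"
    and front: "\<And>z. z \<in> frontier U \<Longrightarrow> f z \<le> 0 \<Longrightarrow> r \<le> norm (proj_coords I (z - x0))"
    and y: "norm (proj_coords I (y - x0)) < r"
    and missed: "\<And>z. z \<in> closure U \<Longrightarrow> f z \<le> 0 \<Longrightarrow> proj_coords I (z - x0) \<noteq> proj_coords I (y - x0)"
  shows "\<exists>x\<in>U. f x = 0 \<and> (\<forall>j. j \<notin> I \<longrightarrow> partial_deriv j f x = 0)"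
proof -
  define h where "h = proj_coords I (y - x0)"
  have fc: "continuous_on S f" for S
    using f by (meson continuous_at_imp_continuous_on differentiable_imp_continuous_within)
  have "closed {z. f z \<le> 0}" by (intro closed_Collect_le fc continuous_on_const)
  then have E: "compact (closure U \<inter> {z. f z \<le> 0})"
    using U(2) by (intro compact_Int_closed) (simp_all add: compact_closure)
  define C where "C = {(s, z). s \<in> {0..1} \<and> z \<in> closure U \<inter> {z. f z \<le> 0} \<and> proj_coords I (z - x0) = s *\<^sub>R h}"
  have Ceq: "C = ({0..1} \<times> (closure U \<inter> {z. f z \<le> 0})) \<inter> {p. proj_coords I (snd p - x0) = fst p *\<^sub>R h}"
    by (auto simp: C_def)
  have "closed {p. proj_coords I (snd p - x0) = fst p *\<^sub>R h}"
    by (intro closed_Collect_eq continuous_intros continuous_on_compose2[OF continuous_on_proj_coords]) auto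
  then have "compact C"
    unfolding Ceq by (intro compact_Int_closed compact_Times compact_Icc E)
  then have comp: "compact (fst ` C)" by (intro compact_continuous_image continuous_intros)
  have "(0, x0) \<in> C"
    using x0 closure_subset[of U] by (auto simp: C_def linear_0[OF linear_proj_coords])
  then have "fst ` C \<noteq> {}" by blast
  then obtain s where s: "s \<in> fst ` C" "\<And>t. t \<in> fst ` C \<Longrightarrow> t \<le> s"
    using compact_attains_sup[OF comp] by blast
  then obtain z where z: "0 \<le> s" "s \<le> 1" "z \<in> closure U" "f z \<le> 0" "proj_coords I (z - x0) = s *\<^sub>R h"
    by (auto simp: C_def)
  have s1: "s < 1"
  proof (rule ccontr)
    assume "\<not> s < 1"
    then have "s = 1" using z(2) by simp
    then show False using missed[OF z(3,4)] z(5) by (simp add: h_def)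
  qed
  have "norm (s *\<^sub>R h) \<le> norm h" using z(1,2) by (simp add: mult_left_le_one_le)
  then have "norm (proj_coords I (z - x0)) < r" using y z(5) by (simp add: h_def)
  then have zU: "z \<in> U"
    using front[of z] z(3,4) U(1) by (force simp: frontier_def interior_open)
  \<comment> \<open>Nothing in the sublevel set lies over the points just beyond the last one; \<open>v\<close> is the correction
    along the fibre.\<close>
  have stuck: False if v: "proj_coords I v = 0" and ev: "eventually (\<lambda>t. f (z + t *\<^sub>R (h + v)) \<le> 0) (at_right 0)" for v
  proof -
    have "((\<lambda>t. z + t *\<^sub>R (h + v)) \<longlongrightarrow> z + 0 *\<^sub>R (h + v)) (at_right 0)"
      by (intro tendsto_intros)
    then have "eventually (\<lambda>t. z + t *\<^sub>R (h + v) \<in> U) (at_right 0)"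
      using U(1) zU by (simp add: topological_tendstoD)
    moreover have "eventually (\<lambda>t. t < 1 - s) (at_right 0)"
      unfolding eventually_at_right_field using s1 by (intro exI[of _ "1 - s"]) simp
    moreover have "eventually (\<lambda>t. 0 < t) (at_right (0::real))" by (rule eventually_at_right_less)
    ultimately have "eventually (\<lambda>t. False) (at_right (0::real))"
      using ev
    proof eventually_elim
      fix t :: real assume t: "z + t *\<^sub>R (h + v) \<in> U" "t < 1 - s" "0 < t" "f (z + t *\<^sub>R (h + v)) \<le> 0"
      have "proj_coords I (z + t *\<^sub>R (h + v) - x0) = proj_coords I (z - x0) + t *\<^sub>R (proj_coords I h + proj_coords I v)"
        by (simp add: vec_eq_iff)
      also have "\<dots> = (s + t) *\<^sub>R h"
        unfolding z(5) v by (simp add: vec_eq_iff h_def algebra_simps)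
      finally have "(s + t, z + t *\<^sub>R (h + v)) \<in> C"
        using t z(1) closure_subset[of U] by (auto simp: C_def)
      then have "s + t \<in> fst ` C" by (rule image_eqI[rotated]) simp
      with s(2) have "s + t \<le> s" by blast
      with t(3) show False by simp
    qed
    then show False by simp
  qed
  have "f z = 0"
  proof (rule ccontr)
    assume "f z \<noteq> 0"
    then have "f z < 0" using z(4) by simp
    have "((\<lambda>t. z + t *\<^sub>R (h + 0)) \<longlongrightarrow> z + 0 *\<^sub>R (h + 0)) (at_right 0)"
      by (intro tendsto_intros)
    moreover have "isCont f (z + 0 *\<^sub>R (h + 0))"
      by (rule differentiable_imp_continuous_within) (rule f)
    ultimately have "((\<lambda>t. f (z + t *\<^sub>R (h + 0))) \<longlongrightarrow> f (z + 0 *\<^sub>R (h + 0))) (at_right 0)"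
      using isCont_tendsto_compose by blast
    then have "eventually (\<lambda>t. f (z + t *\<^sub>R (h + 0)) < 0) (at_right 0)"
      using \<open>f z < 0\<close> by (intro order_tendstoD) auto
    then have "eventually (\<lambda>t. f (z + t *\<^sub>R (h + 0)) \<le> 0) (at_right 0)"
      by eventually_elim simp
    then show False using stuck[of 0] by (simp add: linear_0[OF linear_proj_coords])
  qed
  moreover have "partial_deriv j f z = 0" if j: "j \<notin> I" for j
  proof (rule ccontr)
    assume nz: "partial_deriv j f z \<noteq> 0"
    define f' where "f' = frechet_derivative f (at z)"
    have f': "(f has_derivative f') (at z)" using f by (simp add: f'_def frechet_derivative_works[symmetric])
    have lin: "linear f'" using f' by (rule has_derivative_linear)
    define v :: "real ^ 'n" where "v = ((- 1 - f' h) / partial_deriv j f z) *\<^sub>R axis j 1"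
    have "f' (h + v) = -1"
      using nz by (simp add: v_def linear_add[OF lin] linear_scale[OF lin] partial_deriv_def f'_def[symmetric])
    have "((\<lambda>t. f (z + t *\<^sub>R (h + v))) has_derivative (\<lambda>t. f' (t *\<^sub>R (h + v)))) (at 0)"
      by (rule has_derivative_compose[of "\<lambda>t. z + t *\<^sub>R (h + v)" "\<lambda>t. t *\<^sub>R (h + v)"])
         (auto intro!: derivative_eq_intros f')
    moreover have "(\<lambda>t. f' (t *\<^sub>R (h + v))) = (*) (- 1)"
      using \<open>f' (h + v) = -1\<close> by (simp add: fun_eq_iff linear_scale[OF lin])
    ultimately have "DERIV (\<lambda>t. f (z + t *\<^sub>R (h + v))) 0 :> - 1"
      unfolding has_field_derivative_def by (simp only:)
    then obtain d where d: "d > 0" "\<And>t. 0 < t \<Longrightarrow> t < d \<Longrightarrow> f (z + t *\<^sub>R (h + v)) < f z"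
      using DERIV_neg_dec_right[of "\<lambda>t. f (z + t *\<^sub>R (h + v))" "-1" 0] by (auto simp del: minus_add_distrib)
    have "eventually (\<lambda>t. f (z + t *\<^sub>R (h + v)) \<le> 0) (at_right 0)"
      unfolding eventually_at_right_field using \<open>f z = 0\<close> d by (intro exI[of _ d]) (simp add: less_imp_le)
    moreover have "proj_coords I v = 0" using j by (simp add: vec_eq_iff v_def axis_def)
    ultimately show False by (rule stuck[rotated])
  qed
  ultimately show ?thesis using zU by blast
qed

text \<open>
  The continuous function \<open>Q / w\<close> attains a positive minimum on the compact set. The factor 2 matches
  the bound \<open>H \<le> 2 t |x|^(2d)\<close> satisfied by the zeros of the perturbed equation.
\<close>

lemma compact_ratio_bound:
  fixes Q w :: "'a::topological_space \<Rightarrow> real"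
  assumes "compact C" "continuous_on C Q" "continuous_on C w" "\<And>z. z \<in> C \<Longrightarrow> 0 < Q z" "\<And>z. z \<in> C \<Longrightarrow> 0 < w z"
  shows "\<exists>t>0. \<forall>z\<in>C. 2 * t * w z < Q z"
proof (cases "C = {}")
  case False
  have "continuous_on C (\<lambda>z. Q z / w z)"
    using assms by (intro continuous_intros) force+
  then obtain a where a: "a \<in> C" "\<And>z. z \<in> C \<Longrightarrow> Q a / w a \<le> Q z / w z"
    using continuous_attains_inf[OF assms(1) False] by blast
  define q where "q = Q a / w a"
  have q: "q > 0" "\<And>z. z \<in> C \<Longrightarrow> q \<le> Q z / w z" using a assms by (auto simp: q_def)
  have "2 * (q / 4) * w z < Q z" if "z \<in> C" for z
  proof -
    have "q * w z \<le> Q z" using q(2)[OF that] assms(5)[OF that] by (simp add: pos_le_divide_eq)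
    moreover have "0 < q * w z" using q(1) assms(5)[OF that] by simp
    ultimately show ?thesis by simp
  qed
  then show ?thesis using q(1) by (intro exI[of _ "q / 4"]) auto
qed (auto intro: exI[of _ 1])

text \<open>
  Thinness provides a point \<open>y\<close> whose projection is close to that of \<open>x0\<close> and missed by the zeros of \<open>Q\<close>.
  Then \<open>Q\<close> is positive on the compact set of the points of \<open>closure U\<close> over the projection of \<open>y\<close> and of
  the frontier points that project close to \<open>x0\<close>. For small \<open>t\<close> the function \<open>f\<close> is still positive there,
  while \<open>f x0 < 0\<close>. The bound on \<open>t\<close> does not depend on \<open>f\<close>, which makes room for later changes of \<open>f\<close>.
\<close>

lemma polar_point_near_zero:
  fixes Q w :: "real ^ 'n::finite \<Rightarrow> real" and I :: "'n set"
  assumes Q: "continuous_on UNIV Q" "\<And>v. 0 \<le> Q v" and w: "continuous_on UNIV w" "\<And>v. 0 < w v"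
    and th: "thin m {v. Q v = 0}" and I: "card I = Suc m"
    and U: "open U" "bounded U" and x0: "x0 \<in> U" "Q x0 = 0"
    and front: "\<And>z. z \<in> frontier U \<Longrightarrow> Q z = 0 \<Longrightarrow> \<exists>i\<in>I. z $ i \<noteq> x0 $ i"
  shows "\<exists>t1>0. \<forall>t f. 0 < t \<and> t \<le> t1 \<and> (\<forall>x. f differentiable (at x)) \<and> (\<forall>v. \<bar>f v - (Q v - t * w v)\<bar> \<le> t / 2 * w v) \<longrightarrow>
     (\<exists>x\<in>U. f x = 0 \<and> (\<forall>j. j \<notin> I \<longrightarrow> partial_deriv j f x = 0))"
proof -
  have cQ: "continuous_on S Q" for S using Q(1) by (rule continuous_on_subset) simp
  have cw: "continuous_on S w" for S using w(1) by (rule continuous_on_subset) simp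
  have cl0: "closed {v. Q v = 0}" by (intro closed_Collect_eq Q(1) continuous_on_const)
  have cpi: "continuous_on S (\<lambda>z. norm (proj_coords I (z - x0)))" for S
    by (intro continuous_intros continuous_on_compose2[OF continuous_on_proj_coords]) auto
  have cpd: "continuous_on S (\<lambda>z. proj_coords I (z - x0))" for S
    by (intro continuous_intros continuous_on_compose2[OF continuous_on_proj_coords]) auto
  have fr: "compact (frontier U)" using U(2) by (simp add: compact_frontier_bounded)
  have cU: "compact (closure U)" using U(2) by (simp add: compact_closure)
  have "\<exists>r>0. \<forall>z\<in>frontier U \<inter> {v. Q v = 0}. 2 * r * 1 < norm (proj_coords I (z - x0))"
  proof (rule compact_ratio_bound)
    show "compact (frontier U \<inter> {v. Q v = 0})" using fr cl0 by (rule compact_Int_closed)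
    fix z assume "z \<in> frontier U \<inter> {v. Q v = 0}"
    then obtain i where "i \<in> I" "z $ i \<noteq> x0 $ i" using front by blast
    then have "proj_coords I (z - x0) $ i \<noteq> 0 $ i" by simp
    then have "proj_coords I (z - x0) \<noteq> 0" by (rule contrapos_nn) simp
    then show "0 < norm (proj_coords I (z - x0))" by simp
  qed (auto intro: cpi)
  then obtain r where r: "r > 0" "\<And>z. z \<in> frontier U \<Longrightarrow> Q z = 0 \<Longrightarrow> 2 * r < norm (proj_coords I (z - x0))"
    by auto
  have K: "compact (closure U \<inter> {v. Q v = 0})" using cU cl0 by (rule compact_Int_closed)
  define r' where "r' = r / (2 * CARD('n))"
  have r': "r' > 0" using r(1) by (simp add: r'_def)
  obtain \<rho> where \<rho>: "\<And>i. i \<in> I \<Longrightarrow> 0 < \<rho> i \<and> \<rho> i \<le> r'"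
    "\<And>v. v \<in> closure U \<inter> {v. Q v = 0} \<Longrightarrow> \<exists>i\<in>I. \<not> (1 * \<rho> i \<le> \<bar>- (x0 $ i) + axis i 1 \<bullet> v\<bar> \<and> \<bar>- (x0 $ i) + axis i 1 \<bullet> v\<bar> \<le> \<rho> i)"
    by (rule thinD[OF th K _ I _ _ r', of 1 "\<lambda>i. - (x0 $ i)" "\<lambda>i. axis i 1"]) auto
  define y where "y = x0 + (\<chi> i. if i \<in> I then \<rho> i else 0)"
  have "norm (proj_coords I (y - x0)) \<le> (\<Sum>i\<in>UNIV. \<bar>proj_coords I (y - x0) $ i\<bar>)" by (rule norm_le_l1_cart)
  also have "\<dots> \<le> (\<Sum>i\<in>(UNIV :: 'n set). r')"
  proof (rule sum_mono)
    show "\<bar>proj_coords I (y - x0) $ i\<bar> \<le> r'" for i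
      using \<rho>(1)[of i] r' by (cases "i \<in> I") (auto simp: y_def)
  qed
  also have "\<dots> < r" using r(1) by (simp add: r'_def)
  finally have y: "norm (proj_coords I (y - x0)) < r" .
  have miss: "proj_coords I (z - x0) \<noteq> proj_coords I (y - x0)" if z: "z \<in> closure U" "Q z = 0" for z
  proof
    assume eq: "proj_coords I (z - x0) = proj_coords I (y - x0)"
    obtain i where i: "i \<in> I" "\<not> (\<rho> i \<le> \<bar>- (x0 $ i) + z $ i\<bar> \<and> \<bar>- (x0 $ i) + z $ i\<bar> \<le> \<rho> i)"
      using \<rho>(2)[of z] z by (auto simp: inner_axis')
    have "z $ i - x0 $ i = \<rho> i" using arg_cong[OF eq, of "\<lambda>p. p $ i"] i(1) by (simp add: y_def)
    then show False using i(2) \<rho>(1)[OF i(1)] by simp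
  qed
  define C1 where "C1 = frontier U \<inter> {z. norm (proj_coords I (z - x0)) \<le> r}"
  define C2 where "C2 = closure U \<inter> {z. proj_coords I (z - x0) = proj_coords I (y - x0)}"
  have "compact C1" unfolding C1_def
    by (intro compact_Int_closed fr closed_Collect_le cpi continuous_on_const)
  moreover have "compact C2" unfolding C2_def
    by (intro compact_Int_closed cU closed_Collect_eq cpd continuous_on_const)
  ultimately have C: "compact (C1 \<union> C2)" by (rule compact_Un)
  have "0 < Q z" if "z \<in> C1 \<union> C2" for z
  proof -
    have "Q z \<noteq> 0" using that r(2)[of z] r(1) miss[of z] by (auto simp: C1_def C2_def)
    then show ?thesis using Q(2)[of z] by simp
  qed
  then obtain t1 where t1: "t1 > 0" "\<And>z. z \<in> C1 \<union> C2 \<Longrightarrow> 2 * t1 * w z < Q z"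
    using compact_ratio_bound[OF C cQ cw] w(2) by blast
  show ?thesis
  proof (intro exI[of _ t1] conjI allI impI t1(1))
    fix t f assume *: "0 < t \<and> t \<le> t1 \<and> (\<forall>x. f differentiable (at x)) \<and> (\<forall>v. \<bar>f v - (Q v - t * w v)\<bar> \<le> t / 2 * w v)"
    have neg: "z \<notin> C1 \<union> C2" if "f z \<le> 0" for z
    proof
      assume "z \<in> C1 \<union> C2"
      then have "2 * t1 * w z < Q z" by (rule t1(2))
      moreover have "t * w z \<le> t1 * w z" using * w(2)[of z] by (simp add: mult_right_mono)
      moreover have "0 < t * w z" using * w(2)[of z] by simp
      moreover have "\<bar>f z - (Q z - t * w z)\<bar> \<le> t * w z / 2" using * by simp
      ultimately show False using that by linarith
    qed
    show "\<exists>x\<in>U. f x = 0 \<and> (\<forall>j. j \<notin> I \<longrightarrow> partial_deriv j f x = 0)"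
    proof (rule polar_point_of_boundary_of_projection[OF _ U x0(1) _ _ y])
      show "f differentiable at x" for x using * by blast
      have "0 < t * w x0" using * w(2)[of x0] by simp
      moreover have "\<bar>f x0 - (Q x0 - t * w x0)\<bar> \<le> t * w x0 / 2" using * by simp
      ultimately show "f x0 < 0" using x0(2) by linarith
      show "r \<le> norm (proj_coords I (z - x0))" if "z \<in> frontier U" "f z \<le> 0" for z
        using neg[OF that(2)] that(1) by (auto simp: C1_def)
      show "proj_coords I (z - x0) \<noteq> proj_coords I (y - x0)" if "z \<in> closure U" "f z \<le> 0" for z
        using neg[OF that(2)] that(1) by (auto simp: C2_def)
    qed
  qed
qed

text \<open>
  Polynomial functions of degree at most \<open>D\<close> on affine space. Taking them as dehomogenised forms of
  degree exactly \<open>D\<close> makes it immediate to return to forms.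
\<close>

definition deg_le :: "nat \<Rightarrow> (real ^ 'n::finite \<Rightarrow> real) \<Rightarrow> bool" where
  "deg_le D f \<longleftrightarrow> (\<exists>F :: real ^ 'n option \<Rightarrow> real. hom_poly D F \<and> f = (\<lambda>v. F (affine_pt v)))"

lemma deg_leI: "hom_poly D F \<Longrightarrow> deg_le D (\<lambda>v. F (affine_pt v))"
  unfolding deg_le_def by blast

lemma deg_leE:
  assumes "deg_le D f"
  obtains F where "hom_poly D F" "f = (\<lambda>v. F (affine_pt v))"
  using assms unfolding deg_le_def by blast

lemma deg_le_mono:
  assumes "deg_le D f" "D \<le> E"
  shows "deg_le E f"
proof -
  from assms(1) obtain F where F: "hom_poly D F" "f = (\<lambda>v. F (affine_pt v))" by (rule deg_leE)
  have "hom_poly (D + (E - D)) (\<lambda>x. F x * x $ None ^ (E - D))"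
    by (intro hom_poly_mult F(1) hom_poly_coord_power)
  from deg_leI[OF this] show ?thesis using assms(2) by (simp add: F(2))
qed

lemma deg_le_add: "deg_le D f \<Longrightarrow> deg_le D g \<Longrightarrow> deg_le D (\<lambda>v. f v + g v)"
proof (elim deg_leE)
  fix F G :: "real ^ 'a option \<Rightarrow> real"
  assume "hom_poly D F" "f = (\<lambda>v. F (affine_pt v))" "hom_poly D G" "g = (\<lambda>v. G (affine_pt v))"
  then show "deg_le D (\<lambda>v. f v + g v)" using deg_leI[OF hom_poly.add[of D F G]] by simp
qed

lemma deg_le_mult: "deg_le D f \<Longrightarrow> deg_le E g \<Longrightarrow> deg_le (D + E) (\<lambda>v. f v * g v)"
proof (elim deg_leE)
  fix F G :: "real ^ 'a option \<Rightarrow> real"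
  assume "hom_poly D F" "f = (\<lambda>v. F (affine_pt v))" "hom_poly E G" "g = (\<lambda>v. G (affine_pt v))"
  then show "deg_le (D + E) (\<lambda>v. f v * g v)" using deg_leI[OF hom_poly_mult[of D F E G]] by simp
qed

lemma deg_le_const: "deg_le D (\<lambda>v. c)"
proof (rule deg_le_mono)
  show "deg_le 0 (\<lambda>v. c)" using deg_leI[OF hom_poly.const] .
qed simp

lemma deg_le_coord: "deg_le 1 (\<lambda>v. v $ i)"
  using deg_leI[OF hom_poly_coord[of "Some i"]] by simp

lemma deg_le_sum: "(\<And>i. i \<in> S \<Longrightarrow> deg_le D (f i)) \<Longrightarrow> deg_le D (\<lambda>v. \<Sum>i\<in>S. f i v)"
  by (induction S rule: infinite_finite_induct) (auto intro: deg_le_const deg_le_add)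

lemma deg_le_kick: "deg_le 2 (kick i0 J p)"
proof -
  have l: "deg_le 1 (\<lambda>v. v $ i - p $ i)" for i
    using deg_le_add[OF deg_le_coord deg_le_const, of i "- p $ i"] by simp
  have "deg_le (1 + 1) (\<lambda>v. (v $ i - p $ i) * (v $ i - p $ i))" for i
    by (intro deg_le_mult l)
  then have "deg_le 2 (\<lambda>v. (v $ i - p $ i)\<^sup>2)" for i
    by (simp add: power2_eq_square numeral_2_eq_2)
  moreover have "deg_le 2 (\<lambda>v. v $ i0 - p $ i0)" by (rule deg_le_mono[OF l]) simp
  ultimately show ?thesis
    unfolding kick_def[abs_def] by (intro deg_le_add deg_le_sum)
qed

lemma has_derivative_affine_pt:
  "(affine_pt has_derivative (\<lambda>h. \<chi> i. case i of None \<Rightarrow> 0 | Some j \<Rightarrow> h $ j)) (at v)"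
proof (rule has_derivative_vec_componentwise)
  fix i :: "'a option"
  show "((\<lambda>x. affine_pt x $ i) has_derivative (\<lambda>h. (\<chi> i. case i of None \<Rightarrow> 0 | Some j \<Rightarrow> h $ j) $ i)) (at v)"
    by (cases i) (auto intro!: derivative_eq_intros has_derivative_vec_nth)
qed

lemma has_derivative_dehomogenization:
  assumes "hom_poly D F"
  shows "((\<lambda>v. F (affine_pt v)) has_derivative
     (\<lambda>h. frechet_derivative F (at (affine_pt v)) (\<chi> i. case i of None \<Rightarrow> 0 | Some j \<Rightarrow> h $ j))) (at v)"
proof -
  have "(F has_derivative frechet_derivative F (at (affine_pt v))) (at (affine_pt v))"
    using hom_poly_differentiable[OF assms] by (simp add: frechet_derivative_works)
  from has_derivative_compose[OF has_derivative_affine_pt this] show ?thesis .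
qed

lemma deg_le_differentiable: "deg_le D f \<Longrightarrow> f differentiable (at x)"
  unfolding deg_le_def differentiable_def using has_derivative_dehomogenization by blast

lemma deg_le_continuous_on: "deg_le D f \<Longrightarrow> continuous_on S f"
  by (meson continuous_at_imp_continuous_on differentiable_imp_continuous_within deg_le_differentiable)

lemma deg_le_partial_deriv:
  assumes "deg_le D f"
  shows "deg_le D (partial_deriv j f)"
proof -
  from assms obtain F where F: "hom_poly D F" "f = (\<lambda>v. F (affine_pt v))" by (rule deg_leE)
  have ax: "(\<chi> i. case i of None \<Rightarrow> 0 | Some k \<Rightarrow> axis j 1 $ k) = axis (Some j) (1::real)"
    by (auto simp: vec_eq_iff axis_def split: option.split)
  have "partial_deriv j f v = partial_deriv (Some j) F (affine_pt v)" for v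
    unfolding F(2) partial_deriv_eqI[OF has_derivative_dehomogenization[OF F(1)]] ax
    by (simp add: partial_deriv_def)
  then have "partial_deriv j f = (\<lambda>v. partial_deriv (Some j) F (affine_pt v))" by auto
  then have "deg_le (D - 1) (partial_deriv j f)"
    using deg_leI[OF hom_poly_partial_deriv[OF F(1), of "Some j"]] by simp
  then show ?thesis by (rule deg_le_mono) simp
qed

lemma deg_le_compose_linear:
  fixes L :: "real ^ 'n::finite \<Rightarrow> real ^ 'm::finite"
  assumes "deg_le D f" "linear L"
  shows "deg_le D (\<lambda>v. f (L v))"
proof -
  from assms(1) obtain F where F: "hom_poly D F" "f = (\<lambda>v. F (affine_pt v))" by (rule deg_leE)
  define L' :: "real ^ 'n option \<Rightarrow> real ^ 'm option" where
    "L' x = (\<chi> i. case i of None \<Rightarrow> x $ None | Some j \<Rightarrow> L (\<chi> k. x $ Some k) $ j)" for x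
  have "linear L'"
  proof (rule linearI)
    fix x y :: "real ^ 'n option" and c :: real
    have "(\<chi> k. x $ Some k + y $ Some k) = (\<chi> k. x $ Some k) + (\<chi> k. y $ Some k)"
      "(\<chi> k. c * x $ Some k) = c *\<^sub>R (\<chi> k. x $ Some k)" by (simp_all add: vec_eq_iff)
    then have "L (\<chi> k. x $ Some k + y $ Some k) = L (\<chi> k. x $ Some k) + L (\<chi> k. y $ Some k)"
      "L (\<chi> k. c * x $ Some k) = c *\<^sub>R L (\<chi> k. x $ Some k)"
      by (simp_all only: linear_add[OF assms(2)] linear_scale[OF assms(2)])
    then show "L' (x + y) = L' x + L' y" "L' (c *\<^sub>R x) = c *\<^sub>R L' x"
      by (auto simp: L'_def vec_eq_iff split: option.split)
  qed
  moreover have "L' (affine_pt v) = affine_pt (L v)" for v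
    by (auto simp: L'_def vec_eq_iff affine_pt_def split: option.split)
  ultimately show ?thesis
    using deg_leI[OF hom_poly_compose_linear[OF F(1), of L']] by (simp add: F(2))
qed

lemma deg_le_polar_system: "deg_le D f \<Longrightarrow> deg_le D (polar_system i0 f i)"
  by (simp add: polar_system_def deg_le_partial_deriv)

text \<open>
  The kick grows at most quadratically, hence is dominated by the weight \<open>|x|^(2d)\<close>, for \<open>d > 0\<close>, uniformly
  on the whole space.
\<close>

lemma kick_bound: "\<bar>kick i0 J p v\<bar> \<le> (5 + 4 * (norm p)\<^sup>2) * (1 + (norm v)\<^sup>2)"
proof -
  have sq: "\<bar>a\<bar> \<le> 1 + a\<^sup>2" for a :: real
    using zero_le_power2[of "\<bar>a\<bar> - 1"] by (simp add: power2_eq_square algebra_simps)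
  have norm2: "(norm (v - p))\<^sup>2 = (\<Sum>j\<in>UNIV. (v $ j - p $ j)\<^sup>2)"
    by (simp add: norm_vec_def L2_set_def sum_nonneg)
  have "(\<Sum>j\<in>J. (v $ j - p $ j)\<^sup>2) \<le> (norm (v - p))\<^sup>2"
    unfolding norm2 by (intro sum_mono2) auto
  moreover have "(v $ i0 - p $ i0)\<^sup>2 \<le> (norm (v - p))\<^sup>2"
    unfolding norm2 by (rule member_le_sum) auto
  moreover have "0 \<le> (\<Sum>j\<in>J. (v $ j - p $ j)\<^sup>2)" by (simp add: sum_nonneg)
  ultimately have "\<bar>kick i0 J p v\<bar> \<le> 1 + 2 * (norm (v - p))\<^sup>2"
    using sq[of "v $ i0 - p $ i0"] unfolding kick_def by linarith
  also have "(norm (v - p))\<^sup>2 \<le> (norm v + norm p)\<^sup>2"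
    by (intro power_mono norm_triangle_ineq4) simp
  also have "\<dots> \<le> 2 * (norm v)\<^sup>2 + 2 * (norm p)\<^sup>2"
    using zero_le_power2[of "norm v - norm p"] by (simp add: power2_eq_square algebra_simps)
  also have "1 + 2 * (2 * (norm v)\<^sup>2 + 2 * (norm p)\<^sup>2) \<le> (5 + 4 * (norm p)\<^sup>2) * (1 + (norm v)\<^sup>2)"
    by (simp add: algebra_simps)
  finally show ?thesis by simp
qed

lemma eventually_mult_le_at_right_0:
  fixes c C :: real
  assumes "0 < c" "0 \<le> C"
  shows "eventually (\<lambda>\<eta>. \<eta> * C \<le> c) (at_right 0)"
proof -
  have "((\<lambda>\<eta>. \<eta> * C) \<longlongrightarrow> 0 * C) (at_right 0)" by (intro tendsto_intros)
  then have "eventually (\<lambda>\<eta>. \<eta> * C < c) (at_right 0)" using assms(1) by (intro order_tendstoD) auto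
  then show ?thesis by eventually_elim simp
qed

lemma eventually_stable_zero_persists:
  fixes f :: "real ^ 'n::finite \<Rightarrow> real" and I :: "'n set"
  assumes st: "stable_zero (insert i0 (- I)) (polar_system i0 f) U" and i0: "i0 \<in> I"
    and U: "bounded U" and f: "\<And>x. f differentiable (at x)"
  shows "eventually (\<lambda>\<eta>. stable_zero (insert i0 (- I)) (polar_system i0 (\<lambda>x. f x + \<eta> * kick i0 (- I) p x)) U) (at_right 0)"
proof -
  obtain \<delta> where \<delta>: "\<delta> > 0" "\<And>F'. (\<forall>i\<in>insert i0 (- I). \<forall>x\<in>U. \<bar>F' i x - polar_system i0 f i x\<bar> \<le> \<delta>) \<Longrightarrow> stable_zero (insert i0 (- I)) F' U"
    using stable_zero_perturb[OF st] by blast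
  obtain B where B: "B > 0" "\<And>x. x \<in> U \<Longrightarrow> norm x \<le> B"
    using U unfolding bounded_pos by blast
  define C where "C = (5 + 4 * (norm p)\<^sup>2) * (1 + B\<^sup>2) + 2 * (B + norm p)"
  have Cnn: "0 \<le> (5 + 4 * (norm p)\<^sup>2) * (1 + B\<^sup>2)" "0 \<le> 2 * (B + norm p)" using B(1) by simp_all
  have C1: "\<bar>kick i0 (- I) p x\<bar> \<le> C" if "x \<in> U" for x
  proof -
    have "(norm x)\<^sup>2 \<le> B\<^sup>2" using B(2)[OF that] by (intro power_mono) auto
    then have "(5 + 4 * (norm p)\<^sup>2) * (1 + (norm x)\<^sup>2) \<le> (5 + 4 * (norm p)\<^sup>2) * (1 + B\<^sup>2)"
      by (intro mult_left_mono) auto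
    then show ?thesis using kick_bound[of i0 "- I" p x] Cnn by (simp add: C_def)
  qed
  have C2: "\<bar>2 * (x $ j - p $ j)\<bar> \<le> C" if "x \<in> U" for x j
  proof -
    have "\<bar>x $ j - p $ j\<bar> \<le> norm (x - p)" using component_le_norm_cart[of "x - p" j] by simp
    also have "\<dots> \<le> B + norm p" using norm_triangle_ineq4[of x p] B(2)[OF that] by linarith
    finally have "\<bar>2 * (x $ j - p $ j)\<bar> \<le> 2 * (B + norm p)" by (simp only: abs_mult) simp
    then show ?thesis using Cnn unfolding C_def by linarith
  qed
  have "C \<ge> 0" using Cnn by (simp add: C_def)
  have "eventually (\<lambda>\<eta>. \<eta> * C \<le> \<delta>) (at_right 0)"
    by (rule eventually_mult_le_at_right_0[OF \<delta>(1) \<open>C \<ge> 0\<close>])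
  moreover have "eventually (\<lambda>\<eta>. 0 < \<eta>) (at_right (0::real))" by (rule eventually_at_right_less)
  ultimately show ?thesis
  proof eventually_elim
    fix \<eta> :: real assume \<eta>: "\<eta> * C \<le> \<delta>" "0 < \<eta>"
    have small: "\<bar>\<eta> * a\<bar> \<le> \<delta>" if "\<bar>a\<bar> \<le> C" for a
    proof -
      have "\<bar>\<eta> * a\<bar> \<le> \<eta> * C" using that \<eta>(2) by (simp add: abs_mult)
      then show ?thesis using \<eta>(1) by linarith
    qed
    show "stable_zero (insert i0 (- I)) (polar_system i0 (\<lambda>x. f x + \<eta> * kick i0 (- I) p x)) U"
    proof (rule \<delta>(2), intro ballI)
      fix i x assume i: "i \<in> insert i0 (- I)" and x: "x \<in> U"
      show "\<bar>polar_system i0 (\<lambda>x. f x + \<eta> * kick i0 (- I) p x) i x - polar_system i0 f i x\<bar> \<le> \<delta>"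
      proof (cases "i = i0")
        case True
        then show ?thesis using small[OF C1[OF x]] by (simp add: polar_system_def)
      next
        case False
        then have "partial_deriv i (\<lambda>x. f x + \<eta> * kick i0 (- I) p x) x = partial_deriv i f x + \<eta> * (2 * (x $ i - p $ i))"
          using i i0 by (intro partial_deriv_kick f) auto
        then show ?thesis using small[OF C2[OF x, of i]] False by (simp add: polar_system_def)
      qed
    qed
  qed
qed

text \<open>
  Start with \<open>f = Q - t w\<close> and treat the points of \<open>T\<close> one after the other: near the next point there is
  a polar point of the current \<open>f\<close>, and a sufficiently small kick at it makes the zero stable without
  destroying the stability achieved before. Each step uses up half of the remaining tolerance \<open>\<kappa>\<close>.
\<close>

lemma stable_polar_systems:
  fixes Q w :: "real ^ 'n::finite \<Rightarrow> real" and I :: "'n set" and U :: "real ^ 'n \<Rightarrow> (real ^ 'n) set"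
  assumes D: "2 \<le> D" and Q: "deg_le D Q" "\<And>v. 0 \<le> Q v" and w: "deg_le D w" "\<And>v. 0 < w v"
    and M: "0 < M" "\<And>v. 1 + (norm v)\<^sup>2 \<le> M * w v"
    and th: "thin m {v. Q v = 0}" and I: "card I = Suc m" "i0 \<in> I" and T: "finite T"
    and U: "\<And>x. x \<in> T \<Longrightarrow> open (U x)" "\<And>x. x \<in> T \<Longrightarrow> bounded (U x)" "\<And>x. x \<in> T \<Longrightarrow> x \<in> U x"
    and T0: "\<And>x. x \<in> T \<Longrightarrow> Q x = 0"
    and front: "\<And>x z. x \<in> T \<Longrightarrow> z \<in> frontier (U x) \<Longrightarrow> Q z = 0 \<Longrightarrow> \<exists>i\<in>I. z $ i \<noteq> x $ i"
  shows "\<exists>t0>0. \<forall>t. 0 < t \<and> t < t0 \<longrightarrow> (\<exists>f. deg_le D f \<and> (\<forall>v. \<bar>f v - (Q v - t * w v)\<bar> \<le> t / 2 * w v) \<and>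
     (\<forall>x\<in>T. stable_zero (insert i0 (- I)) (polar_system i0 f) (U x)))"
proof -
  have "\<forall>x\<in>T. \<exists>t1>0. \<forall>t f. 0 < t \<and> t \<le> t1 \<and> (\<forall>x. f differentiable (at x)) \<and> (\<forall>v. \<bar>f v - (Q v - t * w v)\<bar> \<le> t / 2 * w v) \<longrightarrow>
     (\<exists>z\<in>U x. f z = 0 \<and> (\<forall>j. j \<notin> I \<longrightarrow> partial_deriv j f z = 0))"
  proof
    fix x assume x: "x \<in> T"
    show "\<exists>t1>0. \<forall>t f. 0 < t \<and> t \<le> t1 \<and> (\<forall>x. f differentiable (at x)) \<and> (\<forall>v. \<bar>f v - (Q v - t * w v)\<bar> \<le> t / 2 * w v) \<longrightarrow>
     (\<exists>z\<in>U x. f z = 0 \<and> (\<forall>j. j \<notin> I \<longrightarrow> partial_deriv j f z = 0))"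
      by (rule polar_point_near_zero[OF deg_le_continuous_on[OF Q(1)] Q(2) deg_le_continuous_on[OF w(1)] w(2) th I(1)
            U(1)[OF x] U(2)[OF x] U(3)[OF x] T0[OF x] front[OF x]])
  qed
  then obtain t1 where t1: "\<And>x. x \<in> T \<Longrightarrow> 0 < t1 x"
    and polar: "\<And>x t f. x \<in> T \<Longrightarrow> 0 < t \<Longrightarrow> t \<le> t1 x \<Longrightarrow> (\<And>z. f differentiable (at z)) \<Longrightarrow>
       (\<And>v. \<bar>f v - (Q v - t * w v)\<bar> \<le> t / 2 * w v) \<Longrightarrow> \<exists>z\<in>U x. f z = 0 \<and> (\<forall>j. j \<notin> I \<longrightarrow> partial_deriv j f z = 0)"
    by metis
  define t0 where "t0 = Min (insert 1 (t1 ` T))"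
  have t0: "t0 > 0" "\<And>x. x \<in> T \<Longrightarrow> t0 \<le> t1 x" using T t1 by (auto simp: t0_def)
  have claim: "\<exists>f. deg_le D f \<and> (\<forall>v. \<bar>f v - (Q v - t * w v)\<bar> \<le> \<kappa> * w v) \<and>
     (\<forall>x\<in>S. stable_zero (insert i0 (- I)) (polar_system i0 f) (U x))"
    if t: "0 < t" "t < t0" and "finite S" "S \<subseteq> T" "0 < \<kappa>" "\<kappa> \<le> t / 2" for t S \<kappa>
    using that(3-)
  proof (induction S arbitrary: \<kappa>)
    case empty
    have "deg_le (0 + D) (\<lambda>v. (- t) * w v)" by (intro deg_le_mult deg_le_const w(1))
    then have "deg_le D (\<lambda>v. (- t) * w v)" by (simp only: add_0)
    then have "deg_le D (\<lambda>v. Q v + (- t) * w v)" by (rule deg_le_add[OF Q(1)])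
    then show ?case using empty w(2) by (intro exI[of _ "\<lambda>v. Q v + (- t) * w v"]) (simp add: less_imp_le)
  next
    case (insert x S)
    then have \<kappa>2: "0 < \<kappa> / 2" "\<kappa> / 2 \<le> t / 2" and xT: "x \<in> T" and ST: "S \<subseteq> T" by auto
    from insert.IH[OF ST \<kappa>2] obtain f where f: "deg_le D f" "\<And>v. \<bar>f v - (Q v - t * w v)\<bar> \<le> \<kappa> / 2 * w v"
      "\<And>x. x \<in> S \<Longrightarrow> stable_zero (insert i0 (- I)) (polar_system i0 f) (U x)" by blast
    have fd: "f differentiable (at z)" for z by (rule deg_le_differentiable[OF f(1)])
    have "\<bar>f v - (Q v - t * w v)\<bar> \<le> t / 2 * w v" for v
    proof -
      have "\<kappa> / 2 * w v \<le> t / 2 * w v" using \<kappa>2 w(2)[of v] by (intro mult_right_mono) auto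
      then show ?thesis using f(2)[of v] by linarith
    qed
    moreover have "t \<le> t1 x" using t0(2)[OF xT] t(2) by simp
    ultimately obtain p where p: "p \<in> U x" "f p = 0" "\<And>j. j \<notin> I \<Longrightarrow> partial_deriv j f p = 0"
      using polar[OF xT t(1) _ fd] by blast
    define q where "q = kick i0 (- I) p"
    define C where "C = (5 + 4 * (norm p)\<^sup>2) * M"
    have C: "0 \<le> C" "\<And>v. \<bar>q v\<bar> \<le> C * w v"
    proof -
      show "0 \<le> C" using M(1) by (simp add: C_def)
      fix v
      have "(5 + 4 * (norm p)\<^sup>2) * (1 + (norm v)\<^sup>2) \<le> (5 + 4 * (norm p)\<^sup>2) * (M * w v)"
        using M(2)[of v] by (intro mult_left_mono) auto
      then show "\<bar>q v\<bar> \<le> C * w v"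
        using kick_bound[of i0 "- I" p v] by (simp add: q_def C_def mult.assoc)
    qed
    have "eventually (\<lambda>\<eta>. \<forall>y\<in>S. stable_zero (insert i0 (- I)) (polar_system i0 (\<lambda>x. f x + \<eta> * q x)) (U y)) (at_right 0)"
      unfolding q_def
      using insert.hyps(1) ST U(2)
      by (intro eventually_ball_finite ballI eventually_stable_zero_persists f(3) I(2) fd) auto
    moreover have "eventually (\<lambda>\<eta>. stable_zero (insert i0 (- I)) (polar_system i0 (\<lambda>x. f x + \<eta> * q x)) (U x)) (at_right 0)"
      unfolding q_def
      by (intro eventually_stable_zero_kick I(2) U(1) xT p fd deg_le_differentiable[OF deg_le_partial_deriv[OF f(1)]])
    moreover have "eventually (\<lambda>\<eta>. \<eta> * C \<le> \<kappa> / 2) (at_right 0)"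
      by (rule eventually_mult_le_at_right_0[OF \<kappa>2(1) C(1)])
    moreover have "eventually (\<lambda>\<eta>. 0 < \<eta>) (at_right (0::real))" by (rule eventually_at_right_less)
    ultimately have "eventually (\<lambda>\<eta>. (\<forall>y\<in>insert x S. stable_zero (insert i0 (- I)) (polar_system i0 (\<lambda>x. f x + \<eta> * q x)) (U y))
        \<and> \<eta> * C \<le> \<kappa> / 2 \<and> 0 < \<eta>) (at_right 0)"
      by eventually_elim simp
    then obtain \<eta> where \<eta>: "\<forall>y\<in>insert x S. stable_zero (insert i0 (- I)) (polar_system i0 (\<lambda>x. f x + \<eta> * q x)) (U y)"
       "\<eta> * C \<le> \<kappa> / 2" "0 < \<eta>"
      using eventually_happens[of _ "at_right (0::real)"] trivial_limit_at_right_real[of 0] by blast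
    show ?case
    proof (intro exI[of _ "\<lambda>x. f x + \<eta> * q x"] conjI allI \<eta>(1))
      have "deg_le (0 + D) (\<lambda>x. \<eta> * q x)"
        unfolding q_def by (intro deg_le_mult deg_le_const deg_le_mono[OF deg_le_kick D])
      then show "deg_le D (\<lambda>x. f x + \<eta> * q x)" using deg_le_add[OF f(1)] by simp
      fix v
      have "\<bar>\<eta> * q v\<bar> \<le> \<eta> * (C * w v)" using C(2)[of v] \<eta>(3) by (simp add: abs_mult)
      also have "\<dots> = (\<eta> * C) * w v" by simp
      also have "\<dots> \<le> \<kappa> / 2 * w v" using \<eta>(2) w(2)[of v] by (intro mult_right_mono) auto
      finally have "\<bar>\<eta> * q v\<bar> \<le> \<kappa> / 2 * w v" .
      moreover have "\<kappa> * w v = \<kappa> / 2 * w v + \<kappa> / 2 * w v" by simp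
      ultimately show "\<bar>f v + \<eta> * q v - (Q v - t * w v)\<bar> \<le> \<kappa> * w v"
        using f(2)[of v] by linarith
    qed
  qed
  show ?thesis
  proof (intro exI[of _ t0] conjI t0(1) allI impI)
    fix t assume "0 < t \<and> t < t0"
    then show "\<exists>f. deg_le D f \<and> (\<forall>v. \<bar>f v - (Q v - t * w v)\<bar> \<le> t / 2 * w v) \<and>
       (\<forall>x\<in>T. stable_zero (insert i0 (- I)) (polar_system i0 f) (U x))"
      using claim[of t T "t / 2"] T by simp
  qed
qed

section \<open>Generic complete intersections are nonsingular\<close>

lemma differentiable_vec_componentwise:
  fixes f :: "'a::real_normed_vector \<Rightarrow> 'b::euclidean_space ^ 'n::finite"
  assumes "\<And>i. (\<lambda>x. f x $ i) differentiable (at a within S)"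
  shows "f differentiable (at a within S)"
proof -
  obtain f' where f': "\<And>i. ((\<lambda>x. f x $ i) has_derivative f' i) (at a within S)"
    using assms unfolding differentiable_def by metis
  have "(f has_derivative (\<lambda>h. \<chi> i. f' i h)) (at a within S)"
    by (rule has_derivative_vec_componentwise) (simp add: f')
  then show ?thesis by (rule differentiableI)
qed

definition diagonal_perturb :: "nat \<Rightarrow> ('n \<Rightarrow> real ^ 'o \<Rightarrow> real) \<Rightarrow> real ^ 'o ^ 'n \<Rightarrow> 'n::finite \<Rightarrow> real ^ 'o::finite \<Rightarrow> real" where
  "diagonal_perturb e F B i x = F i x + (\<Sum>k\<in>UNIV. B $ i $ k * x $ k ^ e)"

text \<open>
  The differentials are required to be independent on the whole space and not only along a chart or a
  sphere; the origin, where forms of degree at least 2 are always singular, is excluded.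
\<close>

definition nonsingular_system :: "'i set \<Rightarrow> ('i \<Rightarrow> real ^ 'o::finite \<Rightarrow> real) \<Rightarrow> bool" where
  "nonsingular_system idx G \<longleftrightarrow> (\<forall>x c. x \<noteq> 0 \<longrightarrow> (\<forall>i\<in>idx. G i x = 0) \<longrightarrow>
     (\<forall>k. (\<Sum>i\<in>idx. c i * partial_deriv k (G i) x) = 0) \<longrightarrow> (\<forall>i\<in>idx. c i = 0))"

lemma hom_poly_diagonal_perturb:
  "hom_poly e (F i) \<Longrightarrow> hom_poly e (diagonal_perturb e F B i)"
  unfolding diagonal_perturb_def[abs_def]
  by (intro hom_poly.add hom_poly_sum hom_poly_cmult hom_poly_coord_power)

lemma partial_deriv_diagonal_perturb:
  assumes "F i differentiable (at x)"
  shows "partial_deriv k (diagonal_perturb e F B i) x = partial_deriv k (F i) x + e * B $ i $ k * x $ k ^ (e - 1)"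
proof -
  have "(diagonal_perturb e F B i has_derivative
      (\<lambda>h. frechet_derivative (F i) (at x) h + (\<Sum>k\<in>UNIV. B $ i $ k * (e * h $ k * x $ k ^ (e - 1))))) (at x)"
    unfolding diagonal_perturb_def[abs_def]
    using assms by (auto intro!: derivative_eq_intros has_derivative_vec_nth simp: frechet_derivative_works[symmetric] fun_eq_iff)
  from partial_deriv_eqI[OF this, of k] show ?thesis
    by (simp add: partial_deriv_def axis_def if_distrib[of "\<lambda>z. _ * z"] if_distrib[of "\<lambda>z. z * _"] cong: if_cong)
qed

context
  fixes F :: "'n::finite \<Rightarrow> real ^ 'o::finite \<Rightarrow> real" and idx :: "'n set" and e :: nat
    and i0 :: 'n and l :: 'o and S :: "'o set"
begin

text \<open>
  Suppose that the system perturbed by \<open>B\<close> has a singular zero \<open>x\<close> with support \<open>S\<close> and \<open>x\<^sub>l = 1\<close>, where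
  the differentials satisfy a linear relation with multipliers \<open>\<mu>\<^sub>i\<close> and \<open>\<mu>\<^bsub>i0\<^esub> = 1\<close>. For \<open>k \<in> S - {l}\<close> the
  \<open>k\<close>-th component of the relation determines \<open>B\<^sub>i\<^sub>0\<^sub>k\<close>, because \<open>x\<^sub>k \<noteq> 0\<close>, and the \<open>i\<close>-th equation determines
  \<open>B\<^sub>i\<^sub>l\<close>. So \<open>B\<close> can be recovered from \<open>x\<close>, the multipliers and its other entries. These data are
  packed into a matrix \<open>C\<close> of the same size: \<open>x\<^sub>k\<close> is stored at \<open>(i0, k)\<close> and \<open>\<mu>\<^sub>i\<close> at \<open>(i, l)\<close>. The
  place \<open>(i0, l)\<close> remains empty and gets the entry 0, which confines \<open>C\<close> to a hyperplane.
\<close>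

definition packed_point :: "real ^ 'o ^ 'n \<Rightarrow> real ^ 'o" where
  "packed_point C = (\<chi> k. if k = l then 1 else if k \<in> S then C $ i0 $ k else 0)"

definition solved_entry :: "real ^ 'o ^ 'n \<Rightarrow> 'o \<Rightarrow> real" where
  "solved_entry C k = - (partial_deriv k (F i0) (packed_point C) +
      (\<Sum>i\<in>idx - {i0}. C $ i $ l * (partial_deriv k (F i) (packed_point C) + e * C $ i $ k * packed_point C $ k ^ (e - 1))))
      / (e * packed_point C $ k ^ (e - 1))"

definition unpack :: "real ^ 'o ^ 'n \<Rightarrow> real ^ 'o ^ 'n" where
  "unpack C = (\<chi> i k.
     if i = i0 then
       (if k = l then - F i0 (packed_point C) - (\<Sum>k\<in>S - {l}. solved_entry C k * packed_point C $ k ^ e)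
        else if k \<in> S then solved_entry C k else C $ i $ k)
     else if i \<in> idx \<and> k = l then - F i (packed_point C) - (\<Sum>k\<in>S - {l}. C $ i $ k * packed_point C $ k ^ e)
     else C $ i $ k)"

lemma negligible_unpack_image:
  assumes F: "\<And>i. i \<in> idx \<Longrightarrow> hom_poly e (F i)" and "0 < e" "i0 \<in> idx"
  shows "negligible (unpack ` {C :: real ^ 'o ^ 'n. C $ i0 $ l = 0 \<and> (\<forall>k\<in>S - {l}. C $ i0 $ k \<noteq> 0)})"
proof (rule negligible_differentiable_image_negligible)
  let ?D = "{C :: real ^ 'o ^ 'n. C $ i0 $ l = 0 \<and> (\<forall>k\<in>S - {l}. C $ i0 $ k \<noteq> 0)}"
  have "negligible {C :: real ^ 'o ^ 'n. axis i0 (axis l 1) \<bullet> C = 0}"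
    by (rule negligible_hyperplane) (simp add: axis_eq_0_iff)
  moreover have "?D \<subseteq> {C. axis i0 (axis l 1) \<bullet> C = 0}" by (auto simp: inner_axis')
  ultimately show "negligible ?D" by (rule negligible_subset)
  have entry: "(\<lambda>C :: real ^ 'o ^ 'n. C $ i $ k) differentiable (at a within D)" for i k a D
    by (intro bounded_linear_imp_differentiable bounded_linear_compose[OF bounded_linear_vec_nth bounded_linear_vec_nth])
  have pt: "(\<lambda>C. packed_point C $ k) differentiable (at a within D)" for k a D
    unfolding packed_point_def using entry[of i0 k] by (cases "k = l"; cases "k \<in> S") auto
  have pp: "packed_point differentiable (at a within D)" for a D
    by (rule differentiable_vec_componentwise) (rule pt)
  have val: "(\<lambda>C. F i (packed_point C)) differentiable (at a within D)" if "i \<in> idx" for i a D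
    by (rule differentiable_compose[OF hom_poly_differentiable[OF F[OF that]] pp])
  have der: "(\<lambda>C. partial_deriv k (F i) (packed_point C)) differentiable (at a within D)" if "i \<in> idx" for i k a D
    by (rule differentiable_compose[OF hom_poly_differentiable[OF hom_poly_partial_deriv[OF F[OF that]]] pp])
  have solved: "(\<lambda>C. solved_entry C k) differentiable (at a within D)" if a: "a \<in> ?D" and k: "k \<in> S - {l}" for a k D
  proof -
    have "packed_point a $ k \<noteq> 0" using a k by (simp add: packed_point_def)
    then have "e * packed_point a $ k ^ (e - 1) \<noteq> 0" using \<open>0 < e\<close> by simp
    moreover have "(\<lambda>C. C $ i $ l * (partial_deriv k (F i) (packed_point C) + e * C $ i $ k * packed_point C $ k ^ (e - 1)))
        differentiable (at a within D)" if "i \<in> idx" for i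
      by (intro differentiable_add differentiable_mult differentiable_power differentiable_const der that pt entry)
    then have "(\<lambda>C. \<Sum>i\<in>idx - {i0}. C $ i $ l * (partial_deriv k (F i) (packed_point C) + e * C $ i $ k * packed_point C $ k ^ (e - 1)))
        differentiable (at a within D)"
      by (intro differentiable_sum ballI) auto
    ultimately show ?thesis
      unfolding solved_entry_def
      by (intro differentiable_divide differentiable_minus differentiable_add differentiable_mult
          differentiable_power differentiable_const der pt \<open>i0 \<in> idx\<close>) auto
  qed
  show "unpack differentiable_on ?D"
    unfolding differentiable_on_def
  proof (intro ballI differentiable_vec_componentwise)
    fix a i k assume a: "a \<in> ?D"
    consider "i = i0" "k = l" | "i = i0" "k \<noteq> l" "k \<in> S" | "i \<noteq> i0" "i \<in> idx" "k = l"
      | "\<not> (i = i0 \<and> (k = l \<or> k \<in> S))" "\<not> (i \<noteq> i0 \<and> i \<in> idx \<and> k = l)" by blast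
    then show "(\<lambda>C. unpack C $ i $ k) differentiable (at a within ?D)"
    proof cases
      case 1
      then have eq: "(\<lambda>C. unpack C $ i $ k) = (\<lambda>C. - F i0 (packed_point C) - (\<Sum>k\<in>S - {l}. solved_entry C k * packed_point C $ k ^ e))"
        by (simp add: unpack_def)
      show ?thesis unfolding eq
        by (intro differentiable_diff differentiable_minus differentiable_sum differentiable_mult differentiable_power
            val pt \<open>i0 \<in> idx\<close> ballI solved[OF a]) auto
    next
      case 2
      then have eq: "(\<lambda>C. unpack C $ i $ k) = (\<lambda>C. solved_entry C k)" by (simp add: unpack_def)
      show ?thesis unfolding eq using 2 by (intro solved[OF a]) auto
    next
      case 3
      then have eq: "(\<lambda>C. unpack C $ i $ k) = (\<lambda>C. - F i (packed_point C) - (\<Sum>k\<in>S - {l}. C $ i $ k * packed_point C $ k ^ e))"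
        by (simp add: unpack_def)
      show ?thesis unfolding eq using 3
        by (intro differentiable_diff differentiable_minus differentiable_sum differentiable_mult differentiable_power
            val pt entry ballI) auto
    next
      case 4
      then have eq: "(\<lambda>C. unpack C $ i $ k) = (\<lambda>C. C $ i $ k)" by (auto simp: unpack_def)
      show ?thesis unfolding eq by (rule entry)
    qed
  qed
qed simp

lemma singular_system_in_unpack_image:
  assumes F: "\<And>i. i \<in> idx \<Longrightarrow> hom_poly e (F i)" and e: "0 < e" and i0: "i0 \<in> idx"
    and x: "x $ l = 1" "S = {k. x $ k \<noteq> 0}"
    and zero: "\<And>i. i \<in> idx \<Longrightarrow> diagonal_perturb e F B i x = 0"
    and \<mu>: "\<And>k. partial_deriv k (diagonal_perturb e F B i0) x + (\<Sum>i\<in>idx - {i0}. \<mu> i * partial_deriv k (diagonal_perturb e F B i) x) = 0"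
  shows "B \<in> unpack ` {C. C $ i0 $ l = 0 \<and> (\<forall>k\<in>S - {l}. C $ i0 $ k \<noteq> 0)}"
proof -
  define C :: "real ^ 'o ^ 'n" where "C = (\<chi> i k.
    if i = i0 then (if k = l then 0 else if k \<in> S then x $ k else B $ i $ k)
    else if i \<in> idx \<and> k = l then \<mu> i else B $ i $ k)"
  have xS: "k \<in> S \<longleftrightarrow> x $ k \<noteq> 0" for k using x(2) by simp
  have "packed_point C $ k = x $ k" for k
    using x(1) xS[of k] by (simp add: packed_point_def C_def)
  then have pp: "packed_point C = x" by (simp add: vec_eq_iff)
  have solved: "solved_entry C k = B $ i0 $ k" if k: "k \<in> S - {l}" for k
  proof -
    have nz: "e * x $ k ^ (e - 1) \<noteq> 0" using k x(2) e by simp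
    have "(\<Sum>i\<in>idx - {i0}. C $ i $ l * (partial_deriv k (F i) x + e * C $ i $ k * x $ k ^ (e - 1)))
        = (\<Sum>i\<in>idx - {i0}. \<mu> i * partial_deriv k (diagonal_perturb e F B i) x)"
      using k by (intro sum.cong) (auto simp: C_def partial_deriv_diagonal_perturb hom_poly_differentiable[OF F])
    also have "\<dots> = - partial_deriv k (diagonal_perturb e F B i0) x" using \<mu>[of k] by linarith
    also have "\<dots> = - (partial_deriv k (F i0) x + e * B $ i0 $ k * x $ k ^ (e - 1))"
      by (simp add: partial_deriv_diagonal_perturb hom_poly_differentiable[OF F[OF i0]])
    finally show ?thesis using nz unfolding solved_entry_def pp by (simp add: field_simps)
  qed
  have val: "B $ i $ l = - F i x - (\<Sum>k\<in>S - {l}. B $ i $ k * x $ k ^ e)" if i: "i \<in> idx" for i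
  proof -
    have "(\<Sum>k\<in>UNIV. B $ i $ k * x $ k ^ e) = (\<Sum>k\<in>S. B $ i $ k * x $ k ^ e)"
      using e x(2) by (intro sum.mono_neutral_right) auto
    also have "\<dots> = B $ i $ l + (\<Sum>k\<in>S - {l}. B $ i $ k * x $ k ^ e)"
      using x by (subst sum.remove[of _ l]) auto
    finally show ?thesis using zero[OF i] by (simp add: diagonal_perturb_def)
  qed
  have "unpack C = B"
  proof -
    have "unpack C $ i $ k = B $ i $ k" for i k
    proof (cases "i = i0")
      case True
      have "(\<Sum>k\<in>S - {l}. solved_entry C k * x $ k ^ e) = (\<Sum>k\<in>S - {l}. B $ i0 $ k * x $ k ^ e)"
        using solved by (intro sum.cong) auto
      moreover have "C $ i $ k = B $ i $ k" if "k \<notin> S" "k \<noteq> l" using True that by (simp add: C_def)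
      ultimately show ?thesis using True solved[of k] val[OF i0] by (simp add: unpack_def pp)
    next
      case False
      have "(\<Sum>k\<in>S - {l}. C $ i $ k * x $ k ^ e) = (\<Sum>k\<in>S - {l}. B $ i $ k * x $ k ^ e)"
        using False by (intro sum.cong) (auto simp: C_def)
      then show ?thesis using False val[of i] by (auto simp: unpack_def pp) (auto simp: C_def)
    qed
    then show ?thesis by (simp add: vec_eq_iff)
  qed
  moreover have "C $ i0 $ l = 0 \<and> (\<forall>k\<in>S - {l}. C $ i0 $ k \<noteq> 0)" using x(2) by (auto simp: C_def)
  ultimately show ?thesis by blast
qed

end

text \<open>
  By homogeneity a singular zero can be scaled to have a coordinate equal to 1, and there are only
  finitely many choices of this coordinate, of the support and of an equation with nonzero multiplier.
\<close>

lemma negligible_singular_perturbations: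
  fixes F :: "'n::finite \<Rightarrow> real ^ 'o::finite \<Rightarrow> real"
  assumes F: "\<And>i. i \<in> idx \<Longrightarrow> hom_poly e (F i)" and e: "0 < e"
  shows "negligible {B. \<not> nonsingular_system idx (diagonal_perturb e F B)}"
proof -
  define img where "img = (\<lambda>(i0, l, S). unpack F idx e i0 l S ` {C. C $ i0 $ l = 0 \<and> (\<forall>k\<in>S - {l}. C $ i0 $ k \<noteq> 0)})"
  have "negligible (\<Union> (img ` (idx \<times> UNIV \<times> UNIV)))"
    by (intro negligible_Union finite_imageI) (auto simp: img_def intro!: negligible_unpack_image F e)
  moreover have "{B. \<not> nonsingular_system idx (diagonal_perturb e F B)} \<subseteq> \<Union> (img ` (idx \<times> UNIV \<times> UNIV))"
  proof
    fix B assume "B \<in> {B. \<not> nonsingular_system idx (diagonal_perturb e F B)}"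
    then obtain x c i0 where x: "x \<noteq> 0" "\<And>i. i \<in> idx \<Longrightarrow> diagonal_perturb e F B i x = 0"
      "\<And>k. (\<Sum>i\<in>idx. c i * partial_deriv k (diagonal_perturb e F B i) x) = 0" "i0 \<in> idx" "c i0 \<noteq> 0"
      unfolding nonsingular_system_def by blast
    from x(1) obtain l where l: "x $ l \<noteq> 0" by (auto simp: vec_eq_iff)
    define z where "z = (1 / x $ l) *\<^sub>R x"
    have h: "hom_poly e (diagonal_perturb e F B i)" if "i \<in> idx" for i
      by (rule hom_poly_diagonal_perturb[of e F i, OF F[OF that]])
    have "z $ l = 1" using l by (simp add: z_def)
    moreover have "diagonal_perturb e F B i z = 0" if "i \<in> idx" for i
      using hom_poly_scale[OF h[OF that]] x(2)[OF that] by (simp add: z_def)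
    moreover have "partial_deriv k (diagonal_perturb e F B i0) z +
        (\<Sum>i\<in>idx - {i0}. (c i / c i0) * partial_deriv k (diagonal_perturb e F B i) z) = 0" for k
    proof -
      have "(\<Sum>i\<in>idx. c i * partial_deriv k (diagonal_perturb e F B i) z)
         = (1 / x $ l) ^ (e - 1) * (\<Sum>i\<in>idx. c i * partial_deriv k (diagonal_perturb e F B i) x)"
        unfolding sum_distrib_left z_def
        by (intro sum.cong) (simp_all add: hom_poly_scale[OF hom_poly_partial_deriv[OF h]])
      then have "(\<Sum>i\<in>idx. c i * partial_deriv k (diagonal_perturb e F B i) z) = 0" using x(3) by simp
      then have "(\<Sum>i\<in>idx. (c i / c i0) * partial_deriv k (diagonal_perturb e F B i) z) = 0"
        by (simp add: sum_divide_distrib[symmetric])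
      then show ?thesis
        using x(4,5) by (subst (asm) sum.remove[of _ i0]) auto
    qed
    ultimately have "B \<in> img (i0, l, {k. z $ k \<noteq> 0})"
      unfolding img_def prod.case
      by (intro singular_system_in_unpack_image[where \<mu> = "\<lambda>i. c i / c i0" and x = z, OF F e x(4)]) auto
    then show "B \<in> \<Union> (img ` (idx \<times> UNIV \<times> UNIV))" using x(4) by blast
  qed
  ultimately show ?thesis by (rule negligible_subset)
qed

lemma small_nonsingular_perturbation:
  fixes F :: "'n::finite \<Rightarrow> real ^ 'o::finite \<Rightarrow> real"
  assumes "\<And>i. i \<in> idx \<Longrightarrow> hom_poly e (F i)" "0 < e" "0 < \<sigma>"
  obtains G where "nonsingular_system idx G" "\<And>i. i \<in> idx \<Longrightarrow> hom_poly e (G i)"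
    "\<And>i x. \<bar>G i x - F i x\<bar> \<le> \<sigma> * norm x ^ e"
proof -
  have "\<not> negligible (ball (0 :: real ^ 'o ^ 'n) (\<sigma> / CARD('o)))"
    using assms(3) by (intro open_not_negligible) (simp_all add: zero_less_divide_iff not_le)
  moreover have "negligible {B. \<not> nonsingular_system idx (diagonal_perturb e F B)}"
    using assms(1,2) by (rule negligible_singular_perturbations)
  ultimately have "\<not> ball (0 :: real ^ 'o ^ 'n) (\<sigma> / CARD('o)) \<subseteq> {B. \<not> nonsingular_system idx (diagonal_perturb e F B)}"
    using negligible_subset by blast
  then obtain B where B: "norm B < \<sigma> / CARD('o)" "nonsingular_system idx (diagonal_perturb e F B)"
    by auto
  show ?thesis
  proof (rule that[OF B(2)])
    show "hom_poly e (diagonal_perturb e F B i)" if "i \<in> idx" for i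
      using assms(1)[OF that] by (rule hom_poly_diagonal_perturb)
    fix i :: 'n and x :: "real ^ 'o"
    have "\<bar>B $ i $ k * x $ k ^ e\<bar> \<le> \<sigma> / CARD('o) * norm x ^ e" for k
    proof -
      have "\<bar>B $ i $ k\<bar> \<le> norm B"
        using component_le_norm_cart[of "B $ i" k] Finite_Cartesian_Product.norm_nth_le[of B i] by linarith
      then have "\<bar>B $ i $ k\<bar> \<le> \<sigma> / CARD('o)" using B(1) by linarith
      moreover have "\<bar>x $ k\<bar> ^ e \<le> norm x ^ e"
        by (intro power_mono component_le_norm_cart) simp
      ultimately show ?thesis unfolding abs_mult power_abs using assms(3) by (intro mult_mono) auto
    qed
    then have "(\<Sum>k\<in>UNIV. \<bar>B $ i $ k * x $ k ^ e\<bar>) \<le> (\<Sum>k\<in>(UNIV :: 'o set). \<sigma> / CARD('o) * norm x ^ e)"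
      by (intro sum_mono)
    moreover have "\<bar>diagonal_perturb e F B i x - F i x\<bar> \<le> (\<Sum>k\<in>UNIV. \<bar>B $ i $ k * x $ k ^ e\<bar>)"
      unfolding diagonal_perturb_def by (simp add: sum_abs)
    ultimately show "\<bar>diagonal_perturb e F B i x - F i x\<bar> \<le> \<sigma> * norm x ^ e" by simp
  qed
qed

section \<open>The approximation theorem in homogeneous coordinates\<close>

lemma norm_affine_pt: "(norm (affine_pt v))\<^sup>2 = 1 + (norm v)\<^sup>2"
proof -
  have "(norm (affine_pt v))\<^sup>2 = (\<Sum>i\<in>UNIV. (affine_pt v $ i)\<^sup>2)"
    by (simp add: norm_vec_def L2_set_def sum_nonneg)
  also have "\<dots> = 1 + (\<Sum>j\<in>UNIV. (v $ j)\<^sup>2)"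
    by (simp add: UNIV_option_conv sum.reindex)
  also have "(\<Sum>j\<in>UNIV. (v $ j)\<^sup>2) = (norm v)\<^sup>2"
    by (simp add: norm_vec_def L2_set_def sum_nonneg)
  finally show ?thesis .
qed

lemma norm_affine_pt_ge_1: "1 \<le> norm (affine_pt v)"
proof -
  have "1\<^sup>2 \<le> (norm (affine_pt v))\<^sup>2" by (simp add: norm_affine_pt)
  then show ?thesis by (rule power2_le_imp_le) simp
qed

lemma affine_pt_neq_0: "affine_pt v \<noteq> 0"
  using norm_affine_pt_ge_1[of v] by auto

lemma continuous_on_affine_pt: "continuous_on S affine_pt"
proof (rule continuous_at_imp_continuous_on, rule ballI)
  show "isCont affine_pt v" for v :: "real ^ 'a"
    by (rule has_derivative_continuous[OF has_derivative_affine_pt])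
qed

lemma scaled_affine_pt:
  assumes "x $ None \<noteq> 0"
  shows "x = x $ None *\<^sub>R affine_pt (\<chi> i. x $ Some i / x $ None)"
proof -
  have "x $ i = (x $ None *\<^sub>R affine_pt (\<chi> i. x $ Some i / x $ None)) $ i" for i
    using assms by (cases i) simp_all
  then show ?thesis unfolding vec_eq_iff by blast
qed

text \<open>
  Both sides have the same homogeneity, so the inequality holds off the hyperplane at infinity, and
  the complement of a hyperplane is dense.
\<close>

lemma le_on_chart_imp_le:
  fixes P N :: "real ^ 'n::finite option \<Rightarrow> real"
  assumes P: "hom_poly D P" and N: "continuous_on UNIV N" "\<And>s x. N (s *\<^sub>R x) = \<bar>s\<bar> ^ D * N x"
    and le: "\<And>v. \<bar>P (affine_pt v)\<bar> \<le> N (affine_pt v)"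
  shows "\<bar>P x\<bar> \<le> N x"
proof -
  have chart: "\<bar>P x\<bar> \<le> N x" if nz: "x $ None \<noteq> 0" for x
  proof -
    let ?v = "\<chi> i. x $ Some i / x $ None"
    have "\<bar>P (x $ None *\<^sub>R affine_pt ?v)\<bar> = \<bar>x $ None\<bar> ^ D * \<bar>P (affine_pt ?v)\<bar>"
      by (simp add: hom_poly_scale[OF P] abs_mult power_abs)
    also have "\<dots> \<le> \<bar>x $ None\<bar> ^ D * N (affine_pt ?v)" using le by (intro mult_left_mono) auto
    also have "\<dots> = N (x $ None *\<^sub>R affine_pt ?v)" by (simp add: N(2))
    finally show ?thesis by (simp only: scaled_affine_pt[OF nz, symmetric])
  qed
  have "closed {x. \<bar>P x\<bar> \<le> N x}"
    by (intro closed_Collect_le continuous_intros hom_poly_continuous_on[OF P] N(1))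
  moreover have "x \<in> closure {x. \<bar>P x\<bar> \<le> N x}"
  proof (cases "x $ None = 0")
    case True
    show ?thesis unfolding closure_approachable
    proof (intro allI impI)
      fix e :: real assume "e > 0"
      let ?y = "x + (e / 2) *\<^sub>R axis None 1"
      have "?y $ None \<noteq> 0" using True \<open>e > 0\<close> by simp
      then have "?y \<in> {x. \<bar>P x\<bar> \<le> N x}" by (intro CollectI chart)
      moreover have "dist ?y x < e" using \<open>e > 0\<close> by (simp add: dist_norm)
      ultimately show "\<exists>y\<in>{x. \<bar>P x\<bar> \<le> N x}. dist y x < e" by (rule bexI[rotated])
    qed
  next
    case False
    then have "x \<in> {x. \<bar>P x\<bar> \<le> N x}" by (intro CollectI chart)
    then show ?thesis by (rule subsetD[OF closure_subset])
  qed
  ultimately have "x \<in> {x. \<bar>P x\<bar> \<le> N x}" by (simp only: closure_closed)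
  then show ?thesis by (rule CollectD)
qed

lemma nonsingular_system_reindex:
  assumes h: "bij_betw h A idx" and G: "nonsingular_system idx G"
  shows "nonsingular_system A (\<lambda>i. G (h i))"
  unfolding nonsingular_system_def
proof (intro allI impI ballI)
  fix x c i assume x: "x \<noteq> 0" and z: "\<forall>i\<in>A. G (h i) x = 0"
    and c: "\<forall>k. (\<Sum>i\<in>A. c i * partial_deriv k (G (h i)) x) = 0" and i: "i \<in> A"
  define c' where "c' j = c (the_inv_into A h j)" for j
  have inj: "inj_on h A" and im: "h ` A = idx" using h by (auto simp: bij_betw_def)
  have c': "c' (h j) = c j" if "j \<in> A" for j using the_inv_into_f_f[OF inj that] by (simp add: c'_def)
  have "(\<Sum>j\<in>idx. c' j * partial_deriv k (G j) x) = 0" for k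
  proof -
    have "(\<Sum>j\<in>idx. c' j * partial_deriv k (G j) x) = (\<Sum>i\<in>A. c' (h i) * partial_deriv k (G (h i)) x)"
      by (rule sum.reindex_bij_betw[OF h, symmetric])
    also have "\<dots> = (\<Sum>i\<in>A. c i * partial_deriv k (G (h i)) x)"
      by (rule sum.cong) (simp_all add: c')
    finally show ?thesis using c by simp
  qed
  then have deriv: "\<forall>k. (\<Sum>j\<in>idx. c' j * partial_deriv k (G j) x) = 0" ..
  have zero: "\<forall>j\<in>idx. G j x = 0" using z unfolding im[symmetric] by (simp only: ball_simps)
  have "\<forall>j\<in>idx. c' j = 0"
    by (rule mp[OF mp[OF mp[OF spec[OF spec[OF G[unfolded nonsingular_system_def], of x], of c'] x] zero] deriv])
  then have "c' (h i) = 0" using i im by blast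
  then show "c i = 0" using c'[OF i] by simp
qed

text \<open>
  The matrix \<open>A\<close> of \<open>generic_projection\<close> is used as a change of coordinates \<open>a\<close> with inverse \<open>b\<close>, and
  \<open>U y\<close> is the ball of radius \<open>\<epsilon>\<close> around \<open>b y\<close> seen in the new coordinates. The stable polar systems
  found there are homogenised, perturbed to a nonsingular system, and transported back.
\<close>

lemma nonsingular_approximation_positive_degree:
  fixes H :: "real ^ 'n::finite option \<Rightarrow> real"
  assumes d: "0 < d" and H: "hom_poly (2 * d) H" "\<And>x. 0 \<le> H x"
    and th: "thin m {v. H (affine_pt v) = 0}" and I: "card I = Suc m" "i0 \<in> (I :: 'n set)"
    and T: "finite T" "\<forall>v\<in>T. H (affine_pt v) = 0" and "0 < \<epsilon>"
  shows "\<exists>t0>0. \<forall>t. 0 < t \<and> t < t0 \<longrightarrow> (\<exists>G. (\<forall>i\<in>insert i0 (- I). hom_poly (2 * d) (G i)) \<and>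
     nonsingular_system (insert i0 (- I)) G \<and>
     (\<forall>x. (\<forall>i\<in>insert i0 (- I). G i x = 0) \<longrightarrow> H x \<le> 2 * t * norm x ^ (2 * d)) \<and>
     (\<forall>v\<in>T. \<exists>v'. dist v v' < \<epsilon> \<and> (\<forall>i\<in>insert i0 (- I). G i (affine_pt v') = 0)))"
proof -
  let ?idx = "insert i0 (- I)"
  define V where "V = {v. H (affine_pt v) = 0}"
  define Q where "Q v = H (affine_pt v)" for v
  have Q: "deg_le (2 * d) Q" unfolding Q_def[abs_def] by (rule deg_leI[OF H(1)])
  have "closed V" unfolding V_def Q_def[symmetric]
    by (intro closed_Collect_eq deg_le_continuous_on[OF Q] continuous_on_const)
  then obtain A :: "real ^ 'n ^ 'n" where A: "invertible A"
    "\<And>x y. x \<in> T \<Longrightarrow> y \<in> V \<Longrightarrow> dist x y = \<epsilon> \<Longrightarrow> \<exists>i\<in>I. (A *v (y - x)) $ i \<noteq> 0"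
    using generic_projection[OF th[folded V_def] _ T(1) \<open>0 < \<epsilon>\<close> I(1)] by blast
  obtain A' where A': "A ** A' = mat 1" "A' ** A = mat 1" using A(1) unfolding invertible_def by blast
  define a where "a v = A *v v" for v
  define b where "b v = A' *v v" for v
  have lin: "linear a" "linear b" by (simp_all add: a_def[abs_def] b_def[abs_def])
  have ab: "a (b y) = y" and ba: "b (a y) = y" for y
    using A'
    by (simp_all add: a_def b_def matrix_vector_mul_assoc)
  have cb: "continuous_on S b" and ca: "continuous_on S a" for S
    by (simp_all add: linear_continuous_on linear_conv_bounded_linear[THEN iffD1] lin)
  define w where "w y = norm (affine_pt (b y)) ^ (2 * d)" for y
  have w: "deg_le (2 * d) w" "0 < w y" for y
  proof -
    show "deg_le (2 * d) w" unfolding w_def[abs_def]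
      by (rule deg_le_compose_linear[OF deg_leI[OF hom_poly_norm_power] lin(2)])
    show "0 < w y" using affine_pt_neq_0[of "b y"] by (simp add: w_def)
  qed
  obtain K0 where K0: "0 < K0" "\<And>v. norm (a v) \<le> K0 * norm v" using linear_bounded_pos[OF lin(1)] by blast
  define K where "K = max 1 K0"
  have K: "1 \<le> K" "norm (a v) \<le> K * norm v" for v
    using K0(2)[of v] mult_right_mono[of K0 K "norm v"] by (simp_all add: K_def)
  have M: "1 + (norm y)\<^sup>2 \<le> K\<^sup>2 * w y" for y
  proof -
    have "(norm y)\<^sup>2 \<le> (K * norm (b y))\<^sup>2" using K(2)[of "b y"] by (intro power_mono) (simp_all add: ab)
    moreover have "1 \<le> K\<^sup>2" using K(1) by simp
    ultimately have "1 + (norm y)\<^sup>2 \<le> K\<^sup>2 * (norm (affine_pt (b y)))\<^sup>2"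
      by (simp add: norm_affine_pt power_mult_distrib distrib_left)
    also have "(norm (affine_pt (b y)))\<^sup>2 \<le> w y"
      unfolding w_def using d by (intro power_increasing norm_affine_pt_ge_1) auto
    finally show ?thesis by (simp add: mult_left_mono)
  qed
  have th': "thin m {y. Q (b y) = 0}"
    using thin_linear_vimage[OF th lin ab] by (simp add: Q_def)
  define U where "U y = {z. dist (b y) (b z) < \<epsilon>}" for y
  have opU: "open (U y)" for y
    unfolding U_def by (intro open_Collect_less continuous_intros cb)
  have bdU: "bounded (U y)" for y
  proof (rule bounded_subset)
    show "bounded (a ` ball (b y) \<epsilon>)"
      using lin(1) by (intro bounded_linear_image bounded_ball) (simp add: linear_conv_bounded_linear)
    show "U y \<subseteq> a ` ball (b y) \<epsilon>"
    proof
      fix z assume "z \<in> U y"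
      then have "b z \<in> ball (b y) \<epsilon>" by (simp add: U_def)
      then show "z \<in> a ` ball (b y) \<epsilon>" using ab[of z, symmetric] by (rule image_eqI[rotated])
    qed
  qed
  have frU: "dist (b y) (b z) = \<epsilon>" if "z \<in> frontier (U y)" for y z
  proof -
    have "closed {z. dist (b y) (b z) \<le> \<epsilon>}" by (intro closed_Collect_le continuous_intros cb)
    then have "closure (U y) \<subseteq> {z. dist (b y) (b z) \<le> \<epsilon>}"
      by (intro closure_minimal) (auto simp: U_def)
    moreover have "z \<in> closure (U y)" "z \<notin> U y"
      using that opU by (auto simp: frontier_def interior_open)
    ultimately show ?thesis by (force simp: U_def)
  qed
  have "\<exists>t0>0. \<forall>t. 0 < t \<and> t < t0 \<longrightarrow> (\<exists>f. deg_le (2 * d) f \<and>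
     (\<forall>v. \<bar>f v - (Q (b v) - t * w v)\<bar> \<le> t / 2 * w v) \<and>
     (\<forall>x\<in>a ` T. stable_zero ?idx (polar_system i0 f) (U x)))"
  proof (rule stable_polar_systems[OF _ _ _ w _ M th' I])
    show "2 \<le> 2 * d" using d by simp
    show "deg_le (2 * d) (\<lambda>y. Q (b y))" by (rule deg_le_compose_linear[OF Q lin(2)])
    show "0 \<le> Q (b v)" for v by (simp add: Q_def H(2))
    show "0 < K\<^sup>2" using K(1) by simp
    show "finite (a ` T)" using T(1) by simp
    show "open (U x)" "bounded (U x)" for x by (rule opU bdU)+
    show "x \<in> U x" for x using \<open>0 < \<epsilon>\<close> by (simp add: U_def)
    show "Q (b x) = 0" if "x \<in> a ` T" for x using that T(2) by (auto simp: ba Q_def)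
    show "\<exists>i\<in>I. z $ i \<noteq> x $ i" if x: "x \<in> a ` T" and z: "z \<in> frontier (U x)" "Q (b z) = 0" for x z
    proof -
      obtain v where v: "v \<in> T" "x = a v" using x by blast
      have "dist v (b z) = \<epsilon>" using frU[OF z(1)] by (simp add: v(2) ba)
      moreover have "b z \<in> V" using z(2) by (simp add: V_def Q_def)
      ultimately obtain i where "i \<in> I" "(A *v (b z - v)) $ i \<noteq> 0" using A(2) v(1) by blast
      moreover have "A *v (b z - v) = z - x"
        using ab[of z] by (simp add: a_def v(2) matrix_vector_mult_diff_distrib)
      ultimately show ?thesis by auto
    qed
  qed
  then obtain t0 where t0: "0 < t0" and ex: "\<And>t. 0 < t \<Longrightarrow> t < t0 \<Longrightarrow> \<exists>f. deg_le (2 * d) f \<and>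
     (\<forall>v. \<bar>f v - (Q (b v) - t * w v)\<bar> \<le> t / 2 * w v) \<and>
     (\<forall>x\<in>a ` T. stable_zero ?idx (polar_system i0 f) (U x))" by blast
  show ?thesis
  proof (intro exI[of _ t0] conjI t0 allI impI)
    fix t assume t: "0 < t \<and> t < t0"
    obtain f where f: "deg_le (2 * d) f" "\<And>v. \<bar>f v - (Q (b v) - t * w v)\<bar> \<le> t / 2 * w v"
      "\<And>x. x \<in> a ` T \<Longrightarrow> stable_zero ?idx (polar_system i0 f) (U x)" using ex[of t] t by blast
    have "\<exists>F. hom_poly (2 * d) F \<and> (\<lambda>v. polar_system i0 f i (a v)) = (\<lambda>v. F (affine_pt v))" for i
      using deg_le_compose_linear[OF deg_le_polar_system[OF f(1)] lin(1)] unfolding deg_le_def .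
    then have "\<forall>i. \<exists>F. hom_poly (2 * d) F \<and> (\<lambda>v. polar_system i0 f i (a v)) = (\<lambda>v. F (affine_pt v))" ..
    from choice[OF this] obtain F where
      FFa: "\<forall>i. hom_poly (2 * d) (F i) \<and> (\<lambda>v. polar_system i0 f i (a v)) = (\<lambda>v. F i (affine_pt v))" ..
    have F: "hom_poly (2 * d) (F i)" and Fa: "(\<lambda>v. polar_system i0 f i (a v)) = (\<lambda>v. F i (affine_pt v))" for i
      using spec[OF FFa, of i] by (rule conjunct1, rule conjunct2)
    have F0: "\<bar>F i0 x - (H x - t * norm x ^ (2 * d))\<bar> \<le> t / 2 * norm x ^ (2 * d)" for x
    proof (rule le_on_chart_imp_le)
      show "hom_poly (2 * d) (\<lambda>x. F i0 x - (H x - t * norm x ^ (2 * d)))"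
        by (intro hom_poly_diff F H hom_poly_cmult hom_poly_norm_power)
      show "continuous_on UNIV (\<lambda>x :: real ^ 'n option. t / 2 * norm x ^ (2 * d))" by (intro continuous_intros)
      show "t / 2 * norm (s *\<^sub>R x) ^ (2 * d) = \<bar>s\<bar> ^ (2 * d) * (t / 2 * norm x ^ (2 * d))" for s and x :: "real ^ 'n option"
        by (simp add: power_mult_distrib)
      show "\<bar>F i0 (affine_pt v) - (H (affine_pt v) - t * norm (affine_pt v) ^ (2 * d))\<bar> \<le> t / 2 * norm (affine_pt v) ^ (2 * d)" for v
        using f(2)[of "a v"] fun_cong[OF Fa[of i0], of v] by (simp add: polar_system_def Q_def w_def ba)
    qed
    have "\<forall>y\<in>a ` T. eventually (\<lambda>\<sigma>. \<forall>G. (\<forall>i\<in>?idx. continuous_on UNIV (G i) \<and> (\<forall>x. \<bar>G i x - F i x\<bar> \<le> \<sigma> * norm x ^ (2 * d))) \<longrightarrow>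
        (\<exists>z\<in>U y. \<forall>i\<in>?idx. G i (affine_pt (b z)) = 0)) (at_right 0)"
    proof
      fix y assume "y \<in> a ` T"
      then obtain \<delta> where \<delta>: "0 < \<delta>" and zero: "\<forall>G. (\<forall>i\<in>?idx. continuous_on UNIV (G i) \<and> (\<forall>x\<in>U y. \<bar>G i x - polar_system i0 f i x\<bar> \<le> \<delta>))
        \<longrightarrow> (\<exists>x\<in>U y. \<forall>i\<in>?idx. G i x = 0)"
        using f(3) unfolding stable_zero_def by blast
      have "bounded (w ` closure (U y))"
        using bdU deg_le_continuous_on[OF w(1)]
        by (intro compact_imp_bounded compact_continuous_image) (simp_all add: compact_closure)
      then obtain C where C: "0 < C" "\<And>z. z \<in> U y \<Longrightarrow> \<bar>w z\<bar> \<le> C"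
        using closure_subset[of "U y"] unfolding bounded_pos by auto
      have "0 \<le> C" using C(1) by simp
      have "eventually (\<lambda>\<sigma>. \<sigma> * C \<le> \<delta>) (at_right 0)" by (rule eventually_mult_le_at_right_0[OF \<delta> \<open>0 \<le> C\<close>])
      moreover have "eventually (\<lambda>\<sigma>. 0 < \<sigma>) (at_right (0::real))" by (rule eventually_at_right_less)
      ultimately show "eventually (\<lambda>\<sigma>. \<forall>G. (\<forall>i\<in>?idx. continuous_on UNIV (G i) \<and> (\<forall>x. \<bar>G i x - F i x\<bar> \<le> \<sigma> * norm x ^ (2 * d))) \<longrightarrow>
        (\<exists>z\<in>U y. \<forall>i\<in>?idx. G i (affine_pt (b z)) = 0)) (at_right 0)"
      proof eventually_elim
        fix \<sigma> assume \<sigma>: "\<sigma> * C \<le> \<delta>" "0 < \<sigma>"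
        show "\<forall>G. (\<forall>i\<in>?idx. continuous_on UNIV (G i) \<and> (\<forall>x. \<bar>G i x - F i x\<bar> \<le> \<sigma> * norm x ^ (2 * d))) \<longrightarrow>
          (\<exists>z\<in>U y. \<forall>i\<in>?idx. G i (affine_pt (b z)) = 0)"
        proof (intro allI impI)
          fix G assume G: "\<forall>i\<in>?idx. continuous_on UNIV (G i) \<and> (\<forall>x. \<bar>G i x - F i x\<bar> \<le> \<sigma> * norm x ^ (2 * d))"
          show "\<exists>z\<in>U y. \<forall>i\<in>?idx. G i (affine_pt (b z)) = 0"
          proof (rule zero[rule_format], intro conjI ballI)
            fix i assume i: "i \<in> ?idx"
            then have Gi: "continuous_on UNIV (G i)" "\<And>x. \<bar>G i x - F i x\<bar> \<le> \<sigma> * norm x ^ (2 * d)" using G by blast+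
            show "continuous_on UNIV (\<lambda>z. G i (affine_pt (b z)))"
              by (rule continuous_on_compose2[OF Gi(1)] continuous_on_compose2[OF continuous_on_affine_pt cb])+ auto
            fix z assume z: "z \<in> U y"
            have "polar_system i0 f i z = F i (affine_pt (b z))"
              using fun_cong[OF Fa[of i], of "b z"] by (simp add: ab)
            moreover have "\<sigma> * norm (affine_pt (b z)) ^ (2 * d) \<le> \<sigma> * C"
              using C(2)[OF z] \<sigma>(2) unfolding w_def by (intro mult_left_mono) auto
            ultimately show "\<bar>G i (affine_pt (b z)) - polar_system i0 f i z\<bar> \<le> \<delta>"
              using Gi(2)[of "affine_pt (b z)"] \<sigma>(1) by linarith
          qed
        qed
      qed
    qed
    then have "eventually (\<lambda>\<sigma>. \<forall>y\<in>a ` T. \<forall>G. (\<forall>i\<in>?idx. continuous_on UNIV (G i) \<and> (\<forall>x. \<bar>G i x - F i x\<bar> \<le> \<sigma> * norm x ^ (2 * d))) \<longrightarrow>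
        (\<exists>z\<in>U y. \<forall>i\<in>?idx. G i (affine_pt (b z)) = 0)) (at_right 0)"
      using T(1) by (intro eventually_ball_finite) auto
    moreover have "eventually (\<lambda>\<sigma>. \<sigma> * 1 \<le> t / 4) (at_right 0)"
      using t by (intro eventually_mult_le_at_right_0) auto
    moreover have "eventually (\<lambda>\<sigma>. 0 < \<sigma>) (at_right (0::real))" by (rule eventually_at_right_less)
    ultimately have "eventually (\<lambda>\<sigma>. (\<forall>y\<in>a ` T. \<forall>G. (\<forall>i\<in>?idx. continuous_on UNIV (G i) \<and> (\<forall>x. \<bar>G i x - F i x\<bar> \<le> \<sigma> * norm x ^ (2 * d))) \<longrightarrow>
        (\<exists>z\<in>U y. \<forall>i\<in>?idx. G i (affine_pt (b z)) = 0)) \<and> \<sigma> \<le> t / 4 \<and> 0 < \<sigma>) (at_right 0)"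
      by eventually_elim simp
    then obtain \<sigma> where near: "\<forall>y\<in>a ` T. \<forall>G. (\<forall>i\<in>?idx. continuous_on UNIV (G i) \<and> (\<forall>x. \<bar>G i x - F i x\<bar> \<le> \<sigma> * norm x ^ (2 * d))) \<longrightarrow>
        (\<exists>z\<in>U y. \<forall>i\<in>?idx. G i (affine_pt (b z)) = 0)" and \<sigma>: "\<sigma> \<le> t / 4" "0 < \<sigma>"
      using eventually_happens'[OF trivial_limit_at_right_real[of 0]] by blast
    have "0 < 2 * d" using d by simp
    then obtain G where G: "nonsingular_system ?idx G" "\<And>i. i \<in> ?idx \<Longrightarrow> hom_poly (2 * d) (G i)"
      "\<And>i x. \<bar>G i x - F i x\<bar> \<le> \<sigma> * norm x ^ (2 * d)"
      by (rule small_nonsingular_perturbation[of ?idx "2 * d" F \<sigma>, OF F _ \<sigma>(2)]) (rule that)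
    \<comment> \<open>The errors are at most \<open>t / 4\<close> from the perturbation and \<open>t / 2\<close> from the kicks, and \<open>t\<close> itself was
      subtracted from \<open>H\<close>, all relative to the weight.\<close>
    have small: "H x \<le> 2 * t * norm x ^ (2 * d)" if "\<forall>i\<in>?idx. G i x = 0" for x
    proof -
      have "\<bar>F i0 x\<bar> \<le> \<sigma> * norm x ^ (2 * d)" using G(3)[of i0 x] that by simp
      also have "\<dots> \<le> t / 4 * norm x ^ (2 * d)" using \<sigma>(1) by (intro mult_right_mono) auto
      finally have "\<bar>F i0 x\<bar> \<le> t * norm x ^ (2 * d) / 4" by simp
      moreover have "\<bar>F i0 x - (H x - t * norm x ^ (2 * d))\<bar> \<le> t * norm x ^ (2 * d) / 2" using F0[of x] by simp
      moreover have "0 \<le> t * norm x ^ (2 * d)" using t by simp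
      ultimately have "H x \<le> 2 * (t * norm x ^ (2 * d))" by linarith
      then show ?thesis by (simp add: mult.assoc)
    qed
    have close: "\<exists>v'. dist v v' < \<epsilon> \<and> (\<forall>i\<in>?idx. G i (affine_pt v') = 0)" if v: "v \<in> T" for v
    proof -
      have "\<forall>i\<in>?idx. continuous_on UNIV (G i) \<and> (\<forall>x. \<bar>G i x - F i x\<bar> \<le> \<sigma> * norm x ^ (2 * d))"
        using G(3) hom_poly_continuous_on[OF G(2)] by blast
      then obtain z where "z \<in> U (a v)" "\<forall>i\<in>?idx. G i (affine_pt (b z)) = 0" using near v by blast
      then show ?thesis by (intro exI[of _ "b z"]) (simp add: U_def ba)
    qed
    show "\<exists>G. (\<forall>i\<in>?idx. hom_poly (2 * d) (G i)) \<and> nonsingular_system ?idx G \<and>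
     (\<forall>x. (\<forall>i\<in>?idx. G i x = 0) \<longrightarrow> H x \<le> 2 * t * norm x ^ (2 * d)) \<and>
     (\<forall>v\<in>T. \<exists>v'. dist v v' < \<epsilon> \<and> (\<forall>i\<in>?idx. G i (affine_pt v') = 0))"
      using G(1,2) small close by (intro exI[of _ G] conjI ballI allI impI)
  qed
qed

lemma nonsingular_approximation:
  fixes H :: "real ^ 'n::finite option \<Rightarrow> real"
  assumes H: "hom_poly (2 * d) H" "\<And>x. 0 \<le> H x"
    and th: "thin m {v. H (affine_pt v) = 0}" and m: "Suc m \<le> CARD('n)"
    and T: "finite T" "\<And>v. v \<in> T \<Longrightarrow> H (affine_pt v) = 0" and "0 < \<epsilon>"
  shows "\<exists>t0>0. \<forall>t. 0 < t \<and> t < t0 \<longrightarrow> (\<exists>G. (\<forall>i<CARD('n) - m. hom_poly (2 * d) (G i)) \<and>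
     nonsingular_system {..<CARD('n) - m} G \<and>
     (\<forall>x. (\<forall>i<CARD('n) - m. G i x = 0) \<longrightarrow> H x \<le> 2 * t * norm x ^ (2 * d)) \<and>
     (\<forall>v\<in>T. \<exists>v'. dist v v' < \<epsilon> \<and> (\<forall>i<CARD('n) - m. G i (affine_pt v') = 0)))"
proof (cases "d = 0")
  case True
  \<comment> \<open>A form of degree 0 is constant, and it is not zero since its zero set is thin. So there is nothing
    to approximate, and the constant equations 1 will do.\<close>
  define c where "c = H 0"
  have const: "H x = c" for x using hom_poly_scale[of 0 H 0 x] H(1) True by (simp add: c_def)
  have "c \<noteq> 0"
  proof
    assume "c = 0"
    then have "{v. H (affine_pt v) = 0} = UNIV" using const by auto
    then show False using th not_thin_UNIV[OF m] by simp
  qed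
  then have "T = {}" using T(2) const by auto
  moreover have "\<exists>i. i < CARD('n) - m" using m by (intro exI[of _ 0]) simp
  ultimately show ?thesis
    using True hom_poly.const[of 1]
    by (intro exI[of _ 1] conjI allI impI exI[of _ "\<lambda>i x. 1"]) (auto simp: nonsingular_system_def)
next
  case False
  obtain I :: "'n set" where I: "card I = Suc m" using obtain_subset_with_card_n[OF m] by metis
  then obtain i0 where i0: "i0 \<in> I" by fastforce
  let ?idx = "insert i0 (- I)"
  have "card ?idx = Suc (CARD('n) - Suc m)"
    using i0 I by (simp add: Compl_eq_Diff_UNIV card_Diff_subset)
  then have "card ?idx = CARD('n) - m" using m by simp
  then obtain h where h: "bij_betw h {..<CARD('n) - m} ?idx"
    using ex_bij_betw_nat_finite[of ?idx] by (auto simp: atLeast0LessThan)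
  have im: "(\<forall>i<CARD('n) - m. P (h i)) \<longleftrightarrow> (\<forall>i\<in>?idx. P i)" for P
    unfolding bij_betw_imp_surj_on[OF h, symmetric] ball_simps(9) Ball_def[of "{..<_}"] lessThan_iff ..
  have "0 < d" using False by simp
  from nonsingular_approximation_positive_degree[OF this H th I i0 T(1) _ \<open>0 < \<epsilon>\<close>] T(2)
  obtain t0 where t0: "0 < t0" and ex: "\<forall>t. 0 < t \<and> t < t0 \<longrightarrow> (\<exists>G. (\<forall>i\<in>?idx. hom_poly (2 * d) (G i)) \<and>
     nonsingular_system ?idx G \<and>
     (\<forall>x. (\<forall>i\<in>?idx. G i x = 0) \<longrightarrow> H x \<le> 2 * t * norm x ^ (2 * d)) \<and>
     (\<forall>v\<in>T. \<exists>v'. dist v v' < \<epsilon> \<and> (\<forall>i\<in>?idx. G i (affine_pt v') = 0)))"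
    by blast
  show ?thesis
  proof (intro exI[of _ t0] conjI t0 allI impI)
    fix t assume "0 < t \<and> t < t0"
    with ex obtain G where G: "\<forall>i\<in>?idx. hom_poly (2 * d) (G i)" "nonsingular_system ?idx G"
     "\<forall>x. (\<forall>i\<in>?idx. G i x = 0) \<longrightarrow> H x \<le> 2 * t * norm x ^ (2 * d)"
     "\<forall>v\<in>T. \<exists>v'. dist v v' < \<epsilon> \<and> (\<forall>i\<in>?idx. G i (affine_pt v') = 0)"
      by blast
    show "\<exists>G. (\<forall>i<CARD('n) - m. hom_poly (2 * d) (G i)) \<and> nonsingular_system {..<CARD('n) - m} G \<and>
     (\<forall>x. (\<forall>i<CARD('n) - m. G i x = 0) \<longrightarrow> H x \<le> 2 * t * norm x ^ (2 * d)) \<and>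
     (\<forall>v\<in>T. \<exists>v'. dist v v' < \<epsilon> \<and> (\<forall>i<CARD('n) - m. G i (affine_pt v') = 0))"
    proof (intro exI[of _ "\<lambda>i. G (h i)"] conjI)
      show "nonsingular_system {..<CARD('n) - m} (\<lambda>i. G (h i))"
        by (rule nonsingular_system_reindex[OF h G(2)])
      show "\<forall>i<CARD('n) - m. hom_poly (2 * d) (G (h i))"
        using G(1) unfolding im[of "\<lambda>i. hom_poly (2 * d) (G i)"] .
      show "\<forall>x. (\<forall>i<CARD('n) - m. G (h i) x = 0) \<longrightarrow> H x \<le> 2 * t * norm x ^ (2 * d)"
        using G(3) unfolding im[of "\<lambda>i. G i x = 0" for x] .
      show "\<forall>v\<in>T. \<exists>v'. dist v v' < \<epsilon> \<and> (\<forall>i<CARD('n) - m. G (h i) (affine_pt v') = 0)"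
        using G(4) unfolding im[of "\<lambda>i. G i (affine_pt x) = 0" for x] .
    qed
  qed
qed

section \<open>Defining equations, charts and complete intersections\<close>

lemma homogeneous_hom_poly:
  assumes "homogeneous P" "total_degree P \<le> d"
  shows "\<exists>k\<le>d. hom_poly k (eval_poly P)"
proof -
  obtain k where k: "\<forall>a\<in>Poly_Mapping.keys P. monom_degree a = k"
    using assms(1) unfolding homogeneous_def by blast
  show ?thesis
  proof (cases "Poly_Mapping.keys P = {}")
    case True
    then have "\<forall>a\<in>Poly_Mapping.keys P. monom_degree a = 0" by simp
    then show ?thesis using hom_poly_eval_poly by blast
  next
    case False
    then obtain a where "a \<in> Poly_Mapping.keys P" by blast
    then have "k \<le> total_degree P"
      using k unfolding total_degree_def by (intro Max_ge) force+
    then have "k \<le> d" using assms(2) by linarith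
    then show ?thesis using hom_poly_eval_poly[OF k] by blast
  qed
qed

text \<open>
  The powers of the norm bring all squares to the common degree \<open>2 d\<close> without adding zeros.
\<close>

lemma sum_of_squares_form:
  fixes \<P> :: "('k::finite) rpoly set" and W :: "real ^ 'u::finite \<Rightarrow> real ^ 'k"
  assumes "finite \<P>" "\<forall>P\<in>\<P>. homogeneous P" "\<forall>P\<in>\<P>. total_degree P \<le> d" "linear W"
  obtains H where "hom_poly (2 * d) H" "\<And>x. 0 \<le> H x"
    "\<And>x. x \<noteq> 0 \<Longrightarrow> H x = 0 \<longleftrightarrow> (\<forall>P\<in>\<P>. eval_poly P (W x) = 0)"
proof -
  have "\<forall>P\<in>\<P>. \<exists>k\<le>d. hom_poly k (eval_poly P)"
    using assms(2,3) homogeneous_hom_poly by blast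
  then obtain k where k: "\<And>P. P \<in> \<P> \<Longrightarrow> k P \<le> d" "\<And>P. P \<in> \<P> \<Longrightarrow> hom_poly (k P) (eval_poly P)"
    by metis
  define H where "H x = (\<Sum>P\<in>\<P>. norm x ^ (2 * (d - k P)) * eval_poly P (W x) ^ 2)" for x
  show ?thesis
  proof (rule that[of H])
    have "hom_poly (2 * d) (\<lambda>x. norm x ^ (2 * (d - k P)) * eval_poly P (W x) ^ 2)" if P: "P \<in> \<P>" for P
    proof -
      have "2 * (d - k P) + k P * 2 = 2 * d" using k(1)[OF P] by simp
      then show ?thesis
        using hom_poly_mult[OF hom_poly_norm_power hom_poly_power[OF hom_poly_compose_linear[OF k(2)[OF P] assms(4)]], of "d - k P" 2]
        by simp
    qed
    then show "hom_poly (2 * d) H" unfolding H_def[abs_def] by (rule hom_poly_sum)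
    show "0 \<le> H x" for x unfolding H_def by (intro sum_nonneg mult_nonneg_nonneg) auto
    show "H x = 0 \<longleftrightarrow> (\<forall>P\<in>\<P>. eval_poly P (W x) = 0)" if "x \<noteq> 0" for x
      unfolding H_def using assms(1) that by (subst sum_nonneg_eq_0_iff) auto
  qed
qed

lemma algebraic_set_common_zeros:
  fixes q :: "nat \<Rightarrow> ('v::finite) rpoly"
  shows "algebraic_set {x. \<forall>i<k. eval_poly (q i) x = 0}"
  unfolding algebraic_set_def
  by (intro exI[of _ "q ` {..<k}"]) auto

lemma algebraic_set_empty: "algebraic_set ({} :: (real ^ 'v::finite) set)"
  unfolding algebraic_set_def
  by (intro exI[of _ "{1}"]) (simp add: eval_poly_one)

lemma nonsingular_systemD:
  assumes "nonsingular_system {..<k} G" "x \<noteq> 0" "\<And>i. i < k \<Longrightarrow> G i x = 0"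
    and "\<And>h. (\<Sum>i<k. c i * frechet_derivative (G i) (at x) h) = 0"
  shows "\<forall>i<k. c i = 0"
proof -
  have "\<forall>i\<in>{..<k}. G i x = 0" using assms(3) by simp
  moreover have "\<forall>j. (\<Sum>i<k. c i * partial_deriv j (G i) x) = 0"
    using assms(4) by (simp add: partial_deriv_def)
  ultimately have "\<forall>i\<in>{..<k}. c i = 0"
    using assms(1,2) unfolding nonsingular_system_def by blast
  then show ?thesis by simp
qed

lemma linear_frechet_derivative_hom_poly:
  "hom_poly D F \<Longrightarrow> linear (frechet_derivative F (at x))"
  using hom_poly_differentiable[of D F x] by (simp add: linear_frechet_derivative)

text \<open>
  The factor \<open>c\<close> is a rescaling of affine space, needed for approximations from inside balls.
\<close>

lemma nonsingular_ci_affine_chart: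
  fixes G :: "nat \<Rightarrow> real ^ 'n::finite option \<Rightarrow> real"
  assumes G: "nonsingular_system {..<k} G" "\<forall>i<k. hom_poly D (G i)" and "c \<noteq> 0"
  obtains q where "\<forall>i<k. total_degree (q i) \<le> D" "\<forall>i<k. eval_poly (q i) = (\<lambda>v. G i (affine_pt (c *\<^sub>R v)))"
    "nonsingular_ci_affine k q {v. \<forall>i<k. G i (affine_pt (c *\<^sub>R v)) = 0}"
proof -
  have lin: "linear (\<lambda>v :: real ^ 'n. c *\<^sub>R v)" by (rule linear_scaleR)
  have "\<exists>p. total_degree p \<le> D \<and> eval_poly p = (\<lambda>v. G i (affine_pt (c *\<^sub>R v)))" if i: "i < k" for i
  proof -
    have "hom_poly D (G i)" using G(2) i by blast
    from deg_le_compose_linear[OF deg_leI[OF this] lin]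
    obtain F where F: "hom_poly D F" "(\<lambda>v. G i (affine_pt (c *\<^sub>R v))) = (\<lambda>v. F (affine_pt v))" by (rule deg_leE)
    obtain p where "eval_poly p = (\<lambda>v. F (affine_pt v))" "total_degree p \<le> D"
      using dehomogenization_rpoly[OF F(1)] .
    then show ?thesis using F(2) by (intro exI[of _ p]) simp
  qed
  then obtain q where q: "\<And>i. i < k \<Longrightarrow> total_degree (q i) \<le> D"
    "\<And>i. i < k \<Longrightarrow> eval_poly (q i) = (\<lambda>v. G i (affine_pt (c *\<^sub>R v)))" by metis
  define e :: "real ^ 'n \<Rightarrow> real ^ 'n option" where "e h = (\<chi> i. case i of None \<Rightarrow> 0 | Some j \<Rightarrow> h $ j)" for h
  have "nonsingular_ci_affine k q {v. \<forall>i<k. G i (affine_pt (c *\<^sub>R v)) = 0}"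
    unfolding nonsingular_ci_affine_def nonsingular_zero_set_def
  proof (intro conjI ballI allI impI)
    show "{v. \<forall>i<k. G i (affine_pt (c *\<^sub>R v)) = 0} = {x \<in> UNIV. \<forall>i<k. eval_poly (q i) x = 0}"
      using q(2) by auto
    fix v a j
    assume v: "v \<in> {v. \<forall>i<k. G i (affine_pt (c *\<^sub>R v)) = 0}" and j: "j < k"
      and dep: "\<forall>h\<in>UNIV. (\<Sum>i<k. a i * frechet_derivative (eval_poly (q i)) (at v) h) = 0"
    let ?p = "affine_pt (c *\<^sub>R v)"
    let ?D = "\<lambda>i. frechet_derivative (G i) (at ?p)"
    have zero: "G i ?p = 0" if "i < k" for i using v that by simp
    have hp: "hom_poly D (G i)" if "i < k" for i using G(2) that by blast
    have linD: "linear (?D i)" if "i < k" for i by (rule linear_frechet_derivative_hom_poly[OF hp[OF that]])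
    have der: "frechet_derivative (eval_poly (q i)) (at v) h = ?D i (e (c *\<^sub>R h))" if i: "i < k" for i h
    proof -
      have "((\<lambda>v. c *\<^sub>R v) has_derivative (\<lambda>h. c *\<^sub>R h)) (at v)" by (auto intro!: derivative_eq_intros)
      from has_derivative_compose[OF this has_derivative_dehomogenization[OF hp[OF i]]]
      have "(eval_poly (q i) has_derivative (\<lambda>h. ?D i (e (c *\<^sub>R h)))) (at v)"
        by (simp add: q(2)[OF i] e_def)
      from frechet_derivative_at[OF this] show ?thesis by metis
    qed
    have tang: "(\<Sum>i<k. a i * ?D i (e h)) = 0" for h
    proof -
      have "(\<Sum>i<k. a i * ?D i (e h)) = (\<Sum>i<k. a i * frechet_derivative (eval_poly (q i)) (at v) ((1 / c) *\<^sub>R h))"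
        using \<open>c \<noteq> 0\<close> by (intro sum.cong) (simp_all add: der)
      then show ?thesis using dep by simp
    qed
    \<comment> \<open>By Euler's identity the differentials also vanish in the radial direction.\<close>
    have full: "(\<Sum>i<k. a i * ?D i x) = 0" for x
    proof -
      define h where "h = (\<chi> j. x $ Some j - x $ None * (c *\<^sub>R v) $ j)"
      have x: "x = x $ None *\<^sub>R ?p + e h"
        unfolding vec_eq_iff
      proof
        fix i show "x $ i = (x $ None *\<^sub>R ?p + e h) $ i" by (cases i) (simp_all add: e_def h_def)
      qed
      have "?D i x = ?D i (e h)" if i: "i < k" for i
      proof -
        have "?D i x = ?D i (x $ None *\<^sub>R ?p + e h)" using arg_cong[OF x, of "?D i"] .
        also have "\<dots> = x $ None * ?D i ?p + ?D i (e h)"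
          by (simp add: linear_add[OF linD[OF i]] linear_scale[OF linD[OF i]])
        finally show ?thesis using euler_identity[OF hp[OF i], of ?p] zero[OF i] by simp
      qed
      then have "(\<Sum>i<k. a i * ?D i x) = (\<Sum>i<k. a i * ?D i (e h))" by (intro sum.cong) simp_all
      then show ?thesis using tang by simp
    qed
    show "a j = 0"
      using nonsingular_systemD[OF G(1) affine_pt_neq_0 zero full] j by blast
  qed
  then show ?thesis using q by (intro that[of q]) auto
qed

lemma nonsingular_ci_sphere_of_system:
  fixes G :: "nat \<Rightarrow> real ^ 'o::finite \<Rightarrow> real"
  assumes G: "nonsingular_system {..<k} G" "\<forall>i<k. hom_poly D (G i)"
  obtains q where "\<forall>i<k. homogeneous (q i) \<and> total_degree (q i) \<le> D" "\<forall>i<k. eval_poly (q i) = G i"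
    "nonsingular_ci_sphere k q {x \<in> sphere 0 1. \<forall>i<k. G i x = 0}"
proof -
  have "\<exists>p. homogeneous p \<and> total_degree p \<le> D \<and> eval_poly p = G i" if i: "i < k" for i
    using hom_poly_rpoly[of D "G i"] G(2) i by metis
  then obtain q where q: "\<And>i. i < k \<Longrightarrow> homogeneous (q i) \<and> total_degree (q i) \<le> D"
    "\<And>i. i < k \<Longrightarrow> eval_poly (q i) = G i" by metis
  have "nonsingular_ci_sphere k q {x \<in> sphere 0 1. \<forall>i<k. G i x = 0}"
    unfolding nonsingular_ci_sphere_def nonsingular_zero_set_def
  proof (intro conjI ballI allI impI)
    show "{x \<in> sphere 0 1. \<forall>i<k. G i x = 0} = {x \<in> sphere 0 1. \<forall>i<k. eval_poly (q i) x = 0}"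
      using q(2) by auto
    fix x a j
    assume x: "x \<in> {x \<in> sphere 0 1. \<forall>i<k. G i x = 0}" and j: "j < k"
      and dep: "\<forall>h\<in>{v. x \<bullet> v = 0}. (\<Sum>i<k. a i * frechet_derivative (eval_poly (q i)) (at x) h) = 0"
    let ?D = "\<lambda>i. frechet_derivative (G i) (at x)"
    have zero: "G i x = 0" if "i < k" for i using x that by simp
    have nx: "x \<bullet> x = 1" using x by (simp add: dot_square_norm)
    have hp: "hom_poly D (G i)" if "i < k" for i using G(2) that by blast
    have linD: "linear (?D i)" if "i < k" for i by (rule linear_frechet_derivative_hom_poly[OF hp[OF that]])
    have full: "(\<Sum>i<k. a i * ?D i z) = 0" for z
    proof -
      define h where "h = z - (x \<bullet> z) *\<^sub>R x"
      have "x \<bullet> h = 0" by (simp add: h_def inner_diff_right nx)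
      then have "(\<Sum>i<k. a i * frechet_derivative (eval_poly (q i)) (at x) h) = 0" using dep by simp
      moreover have "frechet_derivative (eval_poly (q i)) (at x) h = ?D i z" if i: "i < k" for i
        using euler_identity[OF hp[OF i], of x] zero[OF i]
        by (simp add: q(2)[OF i] h_def linear_diff[OF linD[OF i]] linear_scale[OF linD[OF i]])
      ultimately show ?thesis by simp
    qed
    have "x \<noteq> 0" using nx by auto
    then show "a j = 0"
      using nonsingular_systemD[OF G(1) _ zero full] j by blast
  qed
  then show ?thesis using q by (intro that[of q]) auto
qed

lemma orthogonal_transformation_inv_props:
  fixes U :: "real ^ 'k::finite \<Rightarrow> real ^ 'k"
  assumes "orthogonal_transformation U"
  shows "linear (inv_into UNIV U)" "U (inv_into UNIV U x) = x" "inv_into UNIV U (U x) = x" "norm (inv_into UNIV U x) = norm x"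
proof -
  have oi: "orthogonal_transformation (inv_into UNIV U)" using assms by (rule orthogonal_transformation_inv)
  then show "linear (inv_into UNIV U)" "norm (inv_into UNIV U x) = norm x"
    by (simp_all add: orthogonal_transformation_linear orthogonal_transformation_norm)
  show "U (inv_into UNIV U x) = x" using assms by (simp add: orthogonal_transformation_surj surj_f_inv_f)
  show "inv_into UNIV U (U x) = x" using assms by (simp add: orthogonal_transformation_inj)
qed

lemma affine_chart_eqI:
  assumes U: "linear U" and L: "L = span {z}" and z: "z \<noteq> 0" "U z = s *\<^sub>R affine_pt v" "s \<noteq> 0"
  shows "affine_chart U L = v"
proof -
  let ?x = "SOME x. x \<in> L \<and> x \<noteq> 0"
  have "z \<in> L \<and> z \<noteq> 0" using z(1) by (simp add: L span_base)
  then have x: "?x \<in> L" "?x \<noteq> 0" using someI[of "\<lambda>x. x \<in> L \<and> x \<noteq> 0" z] by blast+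
  then obtain c where c: "?x = c *\<^sub>R z" by (auto simp: L span_singleton)
  with x(2) have "c \<noteq> 0" by auto
  have "U ?x = (c * s) *\<^sub>R affine_pt v" using linear_scale[OF U, of c z] c z(2) by simp
  then show ?thesis
    using \<open>c \<noteq> 0\<close> z(3) by (simp add: affine_chart_def Let_def vec_eq_iff)
qed

text \<open>
  A line outside the polar hyperplane of \<open>y\<close> is spanned by exactly one vector whose new coordinate at
  \<open>None\<close> is 1.
\<close>

lemma affine_chart_image:
  fixes \<P> :: "('n::finite option) rpoly set"
  assumes hom: "\<forall>P\<in>\<P>. homogeneous P" and y: "y \<in> proj_space" and U: "adapted_coords y U"
  shows "affine_chart U ` (proj_zero_set \<P> - polar_hyperplane y) =
     {v. \<forall>P\<in>\<P>. eval_poly P ((inv_into UNIV U) (affine_pt v)) = 0}"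
proof -
  have orth: "orthogonal_transformation U" and Uy: "U ` y = span {axis None 1}"
    using U by (auto simp: adapted_coords_def)
  note W = orthogonal_transformation_inv_props[OF orth]
  have lin: "linear U" using orth by (rule orthogonal_transformation_linear)
  have inner: "U a \<bullet> U b = a \<bullet> b" for a b using orth by (simp add: orthogonal_transformation_def)
  show ?thesis
  proof (intro equalityI subsetI)
    fix v assume "v \<in> affine_chart U ` (proj_zero_set \<P> - polar_hyperplane y)"
    then obtain L where L: "L \<in> proj_space" "\<forall>P\<in>\<P>. \<forall>x\<in>L. eval_poly P x = 0" "L \<notin> polar_hyperplane y"
      "v = affine_chart U L" by (auto simp: proj_zero_set_def)
    then have sub: "subspace L" "dim L = 1" by (auto simp: proj_space_def)
    obtain a b where ab: "a \<in> L" "b \<in> y" "a \<bullet> b \<noteq> 0" using L(1,3) by (auto simp: polar_hyperplane_def)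
    have "a \<noteq> 0" using ab(3) by auto
    have "span {a} \<subseteq> L" using ab(1) sub(1) by (intro span_minimal) auto
    moreover have "dim (span {a}) = 1" using \<open>a \<noteq> 0\<close> by (simp add: dim_span dim_insert)
    ultimately have La: "L = span {a}"
      using sub subspace_dim_equal[of "span {a}" L] by (simp add: subspace_span)
    have "U b \<in> span {axis None 1}" using ab(2) Uy by blast
    then obtain c where c: "U b = c *\<^sub>R axis None 1" by (auto simp: span_singleton)
    have "U a \<bullet> U b = c * U a $ None" by (simp add: c inner_axis)
    then have nz: "U a $ None \<noteq> 0" using ab(3) inner[of a b] by auto
    have Ua: "U a = U a $ None *\<^sub>R affine_pt (\<chi> i. U a $ Some i / U a $ None)"
      by (rule scaled_affine_pt[OF nz])
    have v: "v = (\<chi> i. U a $ Some i / U a $ None)"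
      unfolding L(4) by (rule affine_chart_eqI[OF lin La \<open>a \<noteq> 0\<close> Ua nz])
    have "a = U a $ None *\<^sub>R (inv_into UNIV U) (affine_pt v)"
      unfolding v using arg_cong[OF Ua, of "inv_into UNIV U"] by (simp only: W(3) linear_scale[OF W(1)])
    from arg_cong[OF this, of "\<lambda>x. (1 / U a $ None) *\<^sub>R x"]
    have "(1 / U a $ None) *\<^sub>R a = (inv_into UNIV U) (affine_pt v)"
      using nz by (simp only: scaleR_scaleR) simp
    moreover have "(1 / U a $ None) *\<^sub>R a \<in> L" using ab(1) sub(1) by (simp add: subspace_scale)
    ultimately show "v \<in> {v. \<forall>P\<in>\<P>. eval_poly P ((inv_into UNIV U) (affine_pt v)) = 0}" using L(2) by simp
  next
    fix v assume v: "v \<in> {v. \<forall>P\<in>\<P>. eval_poly P ((inv_into UNIV U) (affine_pt v)) = 0}"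
    define z where "z = (inv_into UNIV U) (affine_pt v)"
    have Uz: "U z = 1 *\<^sub>R affine_pt v" by (simp add: z_def W(2))
    have z: "z \<noteq> 0" using affine_pt_neq_0[of v] W(4)[of "affine_pt v"] by (auto simp: z_def)
    define L where "L = span {z}"
    have L: "L \<in> proj_space" using z by (simp add: L_def proj_space_def dim_span dim_insert)
    have "eval_poly P x = 0" if P: "P \<in> \<P>" and x: "x \<in> L" for P x
    proof -
      obtain c where c: "x = c *\<^sub>R z" using x by (auto simp: L_def span_singleton)
      obtain k where "hom_poly k (eval_poly P)" using homogeneous_hom_poly[of P "total_degree P"] hom P by blast
      then show ?thesis using v P by (simp add: c hom_poly_scale z_def)
    qed
    then have "L \<in> proj_zero_set \<P>" using L by (simp add: proj_zero_set_def)
    moreover have "L \<notin> polar_hyperplane y"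
    proof
      assume "L \<in> polar_hyperplane y"
      then have perp: "\<And>a b. a \<in> L \<Longrightarrow> b \<in> y \<Longrightarrow> a \<bullet> b = 0" by (auto simp: polar_hyperplane_def)
      have "axis None 1 \<in> U ` y" unfolding Uy by (rule span_base) simp
      then obtain b where b: "b \<in> y" "U b = axis None 1" by auto
      have "z \<bullet> b = affine_pt v \<bullet> axis None 1" using inner[of z b] Uz b(2) by simp
      then have "z \<bullet> b = 1" by (simp add: inner_axis)
      moreover have "z \<in> L" by (simp add: L_def span_base)
      ultimately show False using perp b(1) by force
    qed
    moreover have "affine_chart U L = v" by (rule affine_chart_eqI[OF lin L_def z Uz]) simp
    ultimately show "v \<in> affine_chart U ` (proj_zero_set \<P> - polar_hyperplane y)" by blast
  qed
qed

section \<open>Approximation in affine space\<close>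

lemma sublevel_near_zeros:
  fixes Q w :: "'a::metric_space \<Rightarrow> real"
  assumes "compact K" "continuous_on K Q" "continuous_on K w" "\<And>v. v \<in> K \<Longrightarrow> 0 \<le> Q v" "\<And>v. v \<in> K \<Longrightarrow> 0 < w v" "0 < \<delta>"
  shows "\<exists>t>0. \<forall>v\<in>K. Q v \<le> 2 * t * w v \<longrightarrow> (\<exists>u\<in>K. Q u = 0 \<and> dist u v < \<delta>)"
proof -
  define C where "C = K \<inter> - (\<Union>u\<in>{u\<in>K. Q u = 0}. ball u \<delta>)"
  have "closed (- (\<Union>u\<in>{u\<in>K. Q u = 0}. ball u \<delta>))" by (intro closed_Compl open_UN ballI open_ball)
  then have "compact C" unfolding C_def by (rule compact_Int_closed[OF assms(1)])
  moreover have "C \<subseteq> K" by (auto simp: C_def)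
  moreover have "0 < Q z" if "z \<in> C" for z
  proof -
    have "Q z \<noteq> 0" using that assms(6) by (auto simp: C_def)
    then show ?thesis using assms(4)[of z] that by (simp add: C_def)
  qed
  ultimately have "\<exists>t>0. \<forall>z\<in>C. 2 * t * w z < Q z"
    using assms(2,3,5) by (intro compact_ratio_bound) (auto elim: continuous_on_subset)
  then obtain t where t: "t > 0" "\<And>z. z \<in> C \<Longrightarrow> 2 * t * w z < Q z" by blast
  have "\<exists>u\<in>K. Q u = 0 \<and> dist u v < \<delta>" if "v \<in> K" "Q v \<le> 2 * t * w v" for v
  proof -
    have "v \<notin> C" using t(2)[of v] that(2) by linarith
    then show ?thesis using that(1) by (auto simp: C_def)
  qed
  then show ?thesis using t(1) by blast
qed

text \<open>
  Otherwise there would be points of \<open>V\<close> whose norms tend to at most \<open>R\<close> and which stay away from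
  \<open>V \<inter> cball 0 R\<close>, and they would have a limit point in that set.
\<close>

lemma slightly_larger_ball_near:
  fixes V :: "'a::euclidean_space set"
  assumes "closed V" "0 < e"
  shows "\<exists>\<sigma>>0. \<forall>u\<in>V. norm u \<le> R + \<sigma> \<longrightarrow> (\<exists>u'\<in>V \<inter> cball 0 R. dist u' u < e)"
proof -
  have "compact (V \<inter> cball 0 (R + 1))" using assms(1) by (intro closed_Int_compact compact_cball)
  moreover have "continuous_on (V \<inter> cball 0 (R + 1)) (\<lambda>u. max 0 (norm u - R))"
    by (intro continuous_intros)
  ultimately have "\<exists>t>0. \<forall>v\<in>V \<inter> cball 0 (R + 1). max 0 (norm v - R) \<le> 2 * t * 1 \<longrightarrow>
      (\<exists>u\<in>V \<inter> cball 0 (R + 1). max 0 (norm u - R) = 0 \<and> dist u v < e)"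
    by (rule sublevel_near_zeros) (use assms(2) in auto)
  then obtain t where t: "t > 0" "\<And>v. v \<in> V \<inter> cball 0 (R + 1) \<Longrightarrow> max 0 (norm v - R) \<le> 2 * t * 1 \<Longrightarrow>
      \<exists>u\<in>V \<inter> cball 0 (R + 1). max 0 (norm u - R) = 0 \<and> dist u v < e"
    by blast
  have "\<exists>u'\<in>V \<inter> cball 0 R. dist u' u < e" if u: "u \<in> V" "norm u \<le> R + min 1 t" for u
  proof -
    have "u \<in> V \<inter> cball 0 (R + 1)" "max 0 (norm u - R) \<le> 2 * t * 1" using u t(1) by auto
    from t(2)[OF this] obtain u' where "u' \<in> V" "max 0 (norm u' - R) = 0" "dist u' u < e" by blast
    moreover have "norm u' \<le> R" using calculation(2) by (simp add: max_def split: if_splits)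
    ultimately show ?thesis by (intro bexI[of _ u']) auto
  qed
  then show ?thesis using t(1) by (intro exI[of _ "min 1 t"]) auto
qed

lemma finite_net:
  fixes K :: "'a::metric_space set"
  assumes "compact K" "0 < e"
  obtains T where "finite T" "T \<subseteq> K" "\<And>x. x \<in> K \<Longrightarrow> \<exists>y\<in>T. dist y x < e"
proof -
  obtain T where "finite T" "T \<subseteq> K" "K \<subseteq> (\<Union>x\<in>T. ball x e)"
    using seq_compact_imp_totally_bounded[OF compact_imp_seq_compact[OF assms(1)], rule_format, OF assms(2)] by blast
  then have T: "finite T" "T \<subseteq> K" and cov: "K \<subseteq> (\<Union>x\<in>T. ball x e)" by blast+
  have "\<exists>y\<in>T. dist y x < e" if "x \<in> K" for x
  proof -
    have "x \<in> (\<Union>x\<in>T. ball x e)" using cov that by (rule subsetD)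
    then show ?thesis by simp
  qed
  with T show thesis by (rule that)
qed

text \<open>
  The error \<open>s\<^sup>2\<close> is chosen small compared with the relative displacement \<open>s\<close> caused by the shrinking in
  \<open>affine_family\<close>; the radius \<open>1 / s\<close> makes the approximation eventually valid on every ball.
\<close>

lemma affine_approximation_at_scale:
  fixes H :: "real ^ 'n::finite option \<Rightarrow> real"
  assumes H: "hom_poly (2 * d) H" "\<And>x. 0 \<le> H x"
    and th: "thin m {v. H (affine_pt v) = 0}" and m: "Suc m \<le> CARD('n)" and s: "0 < s"
  shows "\<exists>G. (\<forall>i<CARD('n) - m. hom_poly (2 * d) (G i)) \<and> nonsingular_system {..<CARD('n) - m} G \<and>
     (\<forall>v. norm v \<le> 1 / s \<and> (\<forall>i<CARD('n) - m. G i (affine_pt v) = 0) \<longrightarrow> (\<exists>u. H (affine_pt u) = 0 \<and> dist u v < s\<^sup>2)) \<and>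
     (\<forall>u. norm u \<le> 1 / s \<and> H (affine_pt u) = 0 \<longrightarrow> (\<exists>v. (\<forall>i<CARD('n) - m. G i (affine_pt v) = 0) \<and> dist u v < s\<^sup>2))"
proof -
  let ?K = "cball (0 :: real ^ 'n) (1 / s)"
  have Q: "continuous_on S (\<lambda>v. H (affine_pt v))" for S by (rule deg_le_continuous_on[OF deg_leI[OF H(1)]])
  have w: "continuous_on S (\<lambda>v :: real ^ 'n. norm (affine_pt v) ^ (2 * d))" for S
    by (intro continuous_intros continuous_on_affine_pt)
  have wpos: "0 < norm (affine_pt v) ^ (2 * d)" for v :: "real ^ 'n" using affine_pt_neq_0[of v] by simp
  have s2: "0 < s\<^sup>2" "0 < s\<^sup>2 / 2" using s by simp_all
  obtain t1 where t1: "0 < t1" "\<And>v. v \<in> ?K \<Longrightarrow> H (affine_pt v) \<le> 2 * t1 * norm (affine_pt v) ^ (2 * d) \<Longrightarrow>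
      \<exists>u\<in>?K. H (affine_pt u) = 0 \<and> dist u v < s\<^sup>2"
    using sublevel_near_zeros[OF compact_cball Q w H(2) wpos s2(1)] by blast
  have "closed {v. H (affine_pt v) = 0}" by (intro closed_Collect_eq Q continuous_on_const)
  then have "compact ({v. H (affine_pt v) = 0} \<inter> ?K)" by (intro closed_Int_compact compact_cball)
  then obtain T where T: "finite T" "T \<subseteq> {v. H (affine_pt v) = 0} \<inter> ?K"
    "\<And>x. x \<in> {v. H (affine_pt v) = 0} \<inter> ?K \<Longrightarrow> \<exists>y\<in>T. dist y x < s\<^sup>2 / 2"
    using finite_net[OF _ s2(2)] by blast
  have T0: "H (affine_pt v) = 0" if "v \<in> T" for v using T(2) that by blast
  obtain t0 where t0: "0 < t0" and ex: "\<forall>t. 0 < t \<and> t < t0 \<longrightarrow> (\<exists>G. (\<forall>i<CARD('n) - m. hom_poly (2 * d) (G i)) \<and>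
     nonsingular_system {..<CARD('n) - m} G \<and>
     (\<forall>x. (\<forall>i<CARD('n) - m. G i x = 0) \<longrightarrow> H x \<le> 2 * t * norm x ^ (2 * d)) \<and>
     (\<forall>v\<in>T. \<exists>v'. dist v v' < s\<^sup>2 / 2 \<and> (\<forall>i<CARD('n) - m. G i (affine_pt v') = 0)))"
    using nonsingular_approximation[OF H th m T(1) T0 s2(2)] by blast
  define t where "t = min t1 (t0 / 2)"
  have t: "0 < t" "t < t0" "t \<le> t1" using t0 t1(1) by (auto simp: t_def)
  with ex obtain G where G: "\<forall>i<CARD('n) - m. hom_poly (2 * d) (G i)"
     "nonsingular_system {..<CARD('n) - m} G"
     "\<forall>x. (\<forall>i<CARD('n) - m. G i x = 0) \<longrightarrow> H x \<le> 2 * t * norm x ^ (2 * d)"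
     "\<forall>v\<in>T. \<exists>v'. dist v v' < s\<^sup>2 / 2 \<and> (\<forall>i<CARD('n) - m. G i (affine_pt v') = 0)" by blast
  show ?thesis
  proof (intro exI[of _ G] conjI G(1,2) allI impI)
    fix v assume v: "norm v \<le> 1 / s \<and> (\<forall>i<CARD('n) - m. G i (affine_pt v) = 0)"
    then have "H (affine_pt v) \<le> 2 * t * norm (affine_pt v) ^ (2 * d)" using G(3) by blast
    also have "\<dots> \<le> 2 * t1 * norm (affine_pt v) ^ (2 * d)"
      using t(3) by (intro mult_right_mono) auto
    finally show "\<exists>u. H (affine_pt u) = 0 \<and> dist u v < s\<^sup>2" using t1(2)[of v] v by auto
  next
    fix u assume u: "norm u \<le> 1 / s \<and> H (affine_pt u) = 0"
    then have "u \<in> {v. H (affine_pt v) = 0} \<inter> ?K" by simp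
    from T(3)[OF this] obtain y where y: "y \<in> T" "dist y u < s\<^sup>2 / 2" by blast
    then obtain v where v: "dist y v < s\<^sup>2 / 2" "\<forall>i<CARD('n) - m. G i (affine_pt v) = 0" using G(4) by blast
    have "dist u v \<le> dist y u + dist y v" using dist_triangle2[of u v y] by (simp add: dist_commute)
    then show "\<exists>v. (\<forall>i<CARD('n) - m. G i (affine_pt v) = 0) \<and> dist u v < s\<^sup>2"
      using y(2) v by (intro exI[of _ v]) simp
  qed
qed

text \<open>
  Intersecting with a ball is not continuous: if \<open>V\<close> touches the ball \<open>B(0, R)\<close> from outside, sets close
  to \<open>V\<close> may miss the ball. The homothety with factor \<open>1 - t\<close> moves the approximating points, which
  have norm at most \<open>R + t\<^sup>2\<close>, into the ball as soon as \<open>t < R\<close>. In the other direction, points of the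
  ball near \<open>V\<close> are near points of \<open>V\<close> in a slightly larger ball, hence near \<open>V \<inter> B(0, R)\<close>.
\<close>

lemma affine_family:
  fixes H :: "real ^ 'n::finite option \<Rightarrow> real"
  assumes H: "hom_poly (2 * d) H" "\<And>x. 0 \<le> H x"
    and th: "thin m V" and V: "V = {v. H (affine_pt v) = 0}" and m: "Suc m \<le> CARD('n)"
  shows "\<exists>Vt :: real \<Rightarrow> (real ^ 'n) set. \<exists>t0>0.
           (\<forall>t>0. algebraic_set (Vt t)) \<and>
           (\<forall>t. 0 < t \<and> t < t0 \<longrightarrow>
              (\<exists>Q. (\<forall>i<CARD('n) - m. total_degree (Q i) \<le> 2 * d) \<and>
                   nonsingular_ci_affine (CARD('n) - m) Q (Vt t))) \<and>
           (\<forall>R>0. hausdorff_limit UNIV dist (\<lambda>t. Vt t \<inter> cball 0 R) (V \<inter> cball 0 R))"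
proof -
  let ?k = "CARD('n) - m"
  have "\<forall>s. \<exists>G. 0 < s \<longrightarrow> ((\<forall>i<?k. hom_poly (2 * d) (G i)) \<and> nonsingular_system {..<?k} G \<and>
     (\<forall>v. norm v \<le> 1 / s \<and> (\<forall>i<?k. G i (affine_pt v) = 0) \<longrightarrow> (\<exists>u. H (affine_pt u) = 0 \<and> dist u v < s\<^sup>2)) \<and>
     (\<forall>u. norm u \<le> 1 / s \<and> H (affine_pt u) = 0 \<longrightarrow> (\<exists>v. (\<forall>i<?k. G i (affine_pt v) = 0) \<and> dist u v < s\<^sup>2)))"
    using affine_approximation_at_scale[OF H th[unfolded V] m] by blast
  from choice[OF this] obtain G where G: "\<forall>s. 0 < s \<longrightarrow> ((\<forall>i<?k. hom_poly (2 * d) (G s i)) \<and> nonsingular_system {..<?k} (G s) \<and>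
     (\<forall>v. norm v \<le> 1 / s \<and> (\<forall>i<?k. G s i (affine_pt v) = 0) \<longrightarrow> (\<exists>u. H (affine_pt u) = 0 \<and> dist u v < s\<^sup>2)) \<and>
     (\<forall>u. norm u \<le> 1 / s \<and> H (affine_pt u) = 0 \<longrightarrow> (\<exists>v. (\<forall>i<?k. G s i (affine_pt v) = 0) \<and> dist u v < s\<^sup>2)))" ..
  have Ghom: "\<forall>i<?k. hom_poly (2 * d) (G s i)" and Gns: "nonsingular_system {..<?k} (G s)"
    and Gnear: "\<And>v. norm v \<le> 1 / s \<Longrightarrow> (\<forall>i<?k. G s i (affine_pt v) = 0) \<Longrightarrow> \<exists>u\<in>V. dist u v < s\<^sup>2"
    and Vnear: "\<And>u. norm u \<le> 1 / s \<Longrightarrow> u \<in> V \<Longrightarrow> \<exists>v. (\<forall>i<?k. G s i (affine_pt v) = 0) \<and> dist u v < s\<^sup>2"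
    if "0 < s" for s
    using G[THEN spec, of s, THEN mp, OF that] unfolding V by auto
  \<comment> \<open>The value for \<open>t \<ge> 1 / 2\<close> only has to be algebraic.\<close>
  define Vt :: "real \<Rightarrow> (real ^ 'n) set" where
    "Vt t = (if t < 1 / 2 then {v. \<forall>i<?k. G t i (affine_pt ((1 / (1 - t)) *\<^sub>R v)) = 0} else {})" for t
  have ci: "\<exists>Q. (\<forall>i<?k. total_degree (Q i) \<le> 2 * d) \<and> nonsingular_ci_affine ?k Q (Vt t) \<and> algebraic_set (Vt t)"
    if t: "0 < t" "t < 1 / 2" for t
  proof -
    have "1 / (1 - t) \<noteq> 0" using t by simp
    from nonsingular_ci_affine_chart[OF Gns[OF t(1)] Ghom[OF t(1)] this]
    obtain q where q: "\<forall>i<?k. total_degree (q i) \<le> 2 * d"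
      "\<forall>i<?k. eval_poly (q i) = (\<lambda>v. G t i (affine_pt ((1 / (1 - t)) *\<^sub>R v)))"
      "nonsingular_ci_affine ?k q {v. \<forall>i<?k. G t i (affine_pt ((1 / (1 - t)) *\<^sub>R v)) = 0}" .
    have Vq: "Vt t = {v. \<forall>i<?k. eval_poly (q i) v = 0}" using t q(2) by (auto simp: Vt_def)
    have "algebraic_set (Vt t)" unfolding Vq by (rule algebraic_set_common_zeros)
    then show ?thesis using q t by (intro exI[of _ q]) (simp add: Vt_def)
  qed
  have alg: "algebraic_set (Vt t)" if "0 < t" for t
  proof (cases "t < 1 / 2")
    case True
    then show ?thesis using ci[OF that] by blast
  next
    case False
    then show ?thesis by (simp add: Vt_def algebraic_set_empty)
  qed
  have closed_alg: "closed A" if A: "algebraic_set A" for A :: "(real ^ 'n) set"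
  proof -
    obtain \<Q> where "A = {x. \<forall>P\<in>\<Q>. eval_poly P x = 0}" using A unfolding algebraic_set_def by blast
    then have "A = (\<Inter>P\<in>\<Q>. {x. eval_poly P x = 0})" by auto
    then show ?thesis by (auto intro!: closed_INT closed_Collect_eq eval_poly_continuous_on continuous_on_const)
  qed
  have clV: "closed V"
    unfolding V by (intro closed_Collect_eq deg_le_continuous_on[OF deg_leI[OF H(1)]] continuous_on_const)
  have lim: "hausdorff_limit UNIV dist (\<lambda>t. Vt t \<inter> cball 0 R) (V \<inter> cball 0 R)" if R: "0 < R" for R
    unfolding hausdorff_limit_def closed_nbhd_def mcball_eq_cball closedin_mtopology_eq_closed
  proof (intro conjI allI impI)
    show "closed (Vt t \<inter> cball 0 R)" if "0 < t" for t using closed_alg[OF alg[OF that]] by (simp add: closed_Int)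
    show "closed (V \<inter> cball 0 R)" using clV by (simp add: closed_Int)
    fix e :: real assume e: "0 < e"
    then obtain \<sigma> where \<sigma>: "0 < \<sigma>" "\<And>u. u \<in> V \<Longrightarrow> norm u \<le> R + \<sigma> \<Longrightarrow> \<exists>u'\<in>V \<inter> cball 0 R. dist u' u < e / 2"
      using slightly_larger_ball_near[OF clV, of "e / 2" R] by auto
    \<comment> \<open>For \<open>t < c\<close> the total displacement, at most \<open>2 R t\<close> by the homothety and \<open>t\<^sup>2\<close> by the approximation,
      is at most \<open>\<sigma>\<close> and \<open>e / 2\<close>; for \<open>t < 1 / (2 R)\<close> all points considered have norm at most \<open>1 / t\<close>.\<close>
    define c where "c = min \<sigma> (e / 2) / (2 * R + 1)"
    have c: "0 < c" using \<sigma>(1) e R by (simp add: c_def)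
    define te where "te = Min {1 / 2, c, R, 1 / (2 * R)}"
    have te: "0 < te" "te \<le> 1 / 2" "te \<le> c" "te \<le> R" "te \<le> 1 / (2 * R)" using c R by (auto simp: te_def)
    show "\<exists>te>0. \<forall>t. 0 < t \<and> t < te \<longrightarrow>
        Vt t \<inter> cball 0 R \<subseteq> (\<Union>x\<in>V \<inter> cball 0 R. cball x e) \<and> V \<inter> cball 0 R \<subseteq> (\<Union>x\<in>Vt t \<inter> cball 0 R. cball x e)"
    proof (intro exI[of _ te] conjI te(1) allI impI subsetI)
      fix t assume t: "0 < t \<and> t < te"
      then have t2: "0 < t" "t < 1 / 2" "t < c" "t < R" "t < 1 / (2 * R)" using te by auto
      have tR: "2 * R \<le> 1 / t" using t2(1,5) R by (simp add: field_simps)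
      have tt: "t\<^sup>2 \<le> t" using t2(1,2) by (simp add: power2_eq_square mult_left_le_one_le)
      have tc: "t * (2 * R + 1) \<le> min \<sigma> (e / 2)" using t2(3) R by (simp add: c_def pos_less_divide_eq)
      have err: "t * (2 * R) + t\<^sup>2 \<le> min \<sigma> (e / 2)" using tc tt by (simp add: algebra_simps)
      {
        fix y assume y: "y \<in> Vt t \<inter> cball 0 R"
        define z where "z = (1 / (1 - t)) *\<^sub>R y"
        have yz: "y = (1 - t) *\<^sub>R z" using t2(2) by (simp add: z_def)
        have "norm z = norm y / (1 - t)" using t2(2) by (simp add: z_def)
        also have "\<dots> \<le> R / (1 / 2)" using y t2 R by (intro frac_le) auto
        finally have nz: "norm z \<le> 2 * R" by simp
        have zG: "\<forall>i<?k. G t i (affine_pt z) = 0" using y t2(2) by (simp add: Vt_def z_def)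
        have "norm z \<le> 1 / t" using nz tR by linarith
        then obtain u where u: "u \<in> V" "dist u z < t\<^sup>2" using Gnear[OF t2(1) _ zG] by blast
        have "dist z y = t * norm z" using t2(1) by (simp add: yz dist_norm algebra_simps)
        also have "\<dots> \<le> t * (2 * R)" using nz t2(1) by (intro mult_left_mono) auto
        finally have duy: "dist u y \<le> min \<sigma> (e / 2)" using u(2) err dist_triangle[of u y z] by linarith
        have "norm u \<le> norm y + dist u y" using norm_triangle_sub[of u y] by (simp add: dist_norm)
        then have "norm u \<le> R + \<sigma>" using y duy by simp
        then obtain u' where u': "u' \<in> V \<inter> cball 0 R" "dist u' u < e / 2" using \<sigma>(2) u(1) by blast
        have "dist u' y \<le> e" using u'(2) duy dist_triangle[of u' y u] by simp
        then show "y \<in> (\<Union>x\<in>V \<inter> cball 0 R. cball x e)" using u'(1) by auto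
      next
        fix u assume u: "u \<in> V \<inter> cball 0 R"
        then have "norm u \<le> 1 / t" using tR R by simp
        then obtain z where z: "\<forall>i<?k. G t i (affine_pt z) = 0" "dist u z < t\<^sup>2" using Vnear[OF t2(1)] u by blast
        define y where "y = (1 - t) *\<^sub>R z"
        have nz: "norm z \<le> R + t\<^sup>2"
        proof -
          have "norm z \<le> norm u + dist u z"
            using norm_triangle_sub[of z u] by (simp add: dist_norm norm_minus_commute)
          then show ?thesis using u z(2) by simp
        qed
        have "(1 / (1 - t)) *\<^sub>R y = z" using t2(2) by (simp add: y_def)
        then have "y \<in> Vt t" using z(1) t2(2) by (simp add: Vt_def)
        moreover have "norm y \<le> R"
        proof -
          have "norm y = (1 - t) * norm z" using t2(2) by (simp add: y_def)
          also have "\<dots> \<le> (1 - t) * (R + t\<^sup>2)" using nz t2(2) by (intro mult_left_mono) auto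
          also have "\<dots> = R - t * (R - t) - t * t\<^sup>2" by (simp add: power2_eq_square algebra_simps)
          also have "\<dots> \<le> R"
          proof -
            have "0 \<le> t * (R - t)" "0 \<le> t * t\<^sup>2" using t2(1,4) by simp_all
            then show ?thesis by linarith
          qed
          finally show ?thesis .
        qed
        moreover have "dist y u \<le> e"
        proof -
          have "t\<^sup>2 \<le> R" using tt t2(4) by simp
          then have "norm z \<le> 2 * R" using nz by simp
          have "dist y z = t * norm z" using t2(1) by (simp add: y_def dist_norm algebra_simps)
          also have "\<dots> \<le> t * (2 * R)" using \<open>norm z \<le> 2 * R\<close> t2(1) by (intro mult_left_mono) auto
          finally show ?thesis using z(2) err e dist_triangle[of y u z] by (simp add: dist_commute)
        qed
        ultimately show "u \<in> (\<Union>x\<in>Vt t \<inter> cball 0 R. cball x e)" by auto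
      }
    qed
  qed
  show ?thesis
  proof (intro exI[of _ Vt] exI[of _ "1 / 2"] conjI allI impI)
    fix t :: real assume "0 < t \<and> t < 1 / 2"
    then show "\<exists>Q. (\<forall>i<?k. total_degree (Q i) \<le> 2 * d) \<and> nonsingular_ci_affine ?k Q (Vt t)"
      using ci[of t] by blast
  qed (use alg lim in auto)
qed

section \<open>Approximation on the sphere\<close>

lemma nonsingular_system_compose_linear:
  fixes G :: "nat \<Rightarrow> real ^ 'o::finite \<Rightarrow> real" and U :: "real ^ 'o \<Rightarrow> real ^ 'o"
  assumes G: "nonsingular_system {..<k} G" "\<forall>i<k. hom_poly D (G i)"
    and U: "linear U" "\<And>x. U (W x) = x" "\<And>x. W (U x) = x" "linear W"
  shows "nonsingular_system {..<k} (\<lambda>i x. G i (U x))"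
  unfolding nonsingular_system_def
proof (intro allI impI)
  fix x c
  assume x: "x \<noteq> 0" and z: "\<forall>i\<in>{..<k}. G i (U x) = 0"
    and dep: "\<forall>j. (\<Sum>i<k. c i * partial_deriv j (\<lambda>x. G i (U x)) x) = 0"
  let ?D = "\<lambda>i. frechet_derivative (G i) (at (U x))"
  have hp: "hom_poly D (G i)" if "i < k" for i using G(2) that by blast
  have linD: "linear (?D i)" if "i < k" for i by (rule linear_frechet_derivative_hom_poly[OF hp[OF that]])
  have der: "partial_deriv j (\<lambda>x. G i (U x)) x = ?D i (U (axis j 1))" if i: "i < k" for i j
  proof -
    have "(U has_derivative U) (at x)" using U(1) by (rule linear_imp_has_derivative)
    moreover have "(G i has_derivative ?D i) (at (U x))"
      using hom_poly_differentiable[OF hp[OF i]] by (simp add: frechet_derivative_works)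
    ultimately have "((\<lambda>x. G i (U x)) has_derivative (\<lambda>h. ?D i (U h))) (at x)"
      by (rule has_derivative_compose)
    then show ?thesis by (rule partial_deriv_eqI)
  qed
  define l where "l h = (\<Sum>i<k. c i * ?D i (U h))" for h
  have "linear l"
  proof (rule linearI)
    fix g h :: "real ^ 'o" and r :: real
    show "l (g + h) = l g + l h"
      unfolding l_def sum.distrib[symmetric]
      by (intro sum.cong) (simp_all add: linear_add[OF U(1)] linear_add[OF linD] distrib_left)
    show "l (r *\<^sub>R h) = r *\<^sub>R l h"
      unfolding l_def scaleR_sum_right
      by (intro sum.cong) (simp_all add: linear_scale[OF U(1)] linear_scale[OF linD])
  qed
  have "l (axis j 1) = 0" for j
    using spec[OF dep, of j] unfolding l_def by (simp add: der)
  then have l0: "l h = 0" for h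
  proof -
    have "l h = l (\<Sum>j\<in>UNIV. h $ j *s axis j 1)" by (simp add: basis_expansion)
    also have "\<dots> = (\<Sum>j\<in>UNIV. h $ j * l (axis j 1))"
      using \<open>linear l\<close> by (simp add: linear_sum linear_scale scalar_mult_eq_scaleR)
    finally show ?thesis using \<open>\<And>j. l (axis j 1) = 0\<close> by simp
  qed
  have full: "(\<Sum>i<k. c i * ?D i h) = 0" for h
    using l0[of "W h"] by (simp add: l_def U(2))
  have "U x \<noteq> 0"
  proof
    assume "U x = 0"
    then have "W (U x) = 0" using linear_0[OF U(4)] by simp
    then show False using x U(3) by simp
  qed
  moreover have "G i (U x) = 0" if "i < k" for i using z that by simp
  ultimately have "\<forall>i<k. c i = 0" by (rule nonsingular_systemD[OF G(1) _ _ full])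
  then show "\<forall>i\<in>{..<k}. c i = 0" by simp
qed

lemma dist_unit_vectors:
  fixes a b :: "'a::real_inner"
  assumes "norm a = 1" "norm b = 1"
  shows "(dist a b)\<^sup>2 = 2 - 2 * (a \<bullet> b)"
proof -
  have "a \<bullet> a = 1" "b \<bullet> b = 1" using assms by (simp_all add: dot_square_norm)
  then show ?thesis
    unfolding dist_norm power2_norm_eq_inner inner_diff_left inner_diff_right by (simp add: inner_commute[of b a])
qed

lemma norm_diff_le_geodesic_dist:
  fixes a b :: "'a::real_inner"
  assumes "norm a = 1" "norm b = 1"
  shows "dist a b \<le> geodesic_dist a b"
proof -
  note ab = inner_unit_bounds[OF assms]
  define \<theta> where "\<theta> = arccos (a \<bullet> b)"
  have \<theta>: "0 \<le> \<theta>" "cos \<theta> = a \<bullet> b" using ab by (simp_all add: \<theta>_def arccos_lbound cos_arccos)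
  have "(dist a b)\<^sup>2 = 2 - 2 * (a \<bullet> b)"
    by (rule dist_unit_vectors[OF assms])
  also have "\<dots> = (2 * sin (\<theta> / 2))\<^sup>2"
    using cos_double_sin[of "\<theta> / 2"] \<theta>(2) by (simp add: power_mult_distrib)
  also have "\<dots> \<le> (2 * (\<theta> / 2))\<^sup>2"
  proof (rule abs_le_square_iff[THEN iffD1])
    show "\<bar>2 * sin (\<theta> / 2)\<bar> \<le> \<bar>2 * (\<theta> / 2)\<bar>" using abs_sin_x_le_abs_x[of "\<theta> / 2"] by (simp add: abs_mult)
  qed
  finally have "(dist a b)\<^sup>2 \<le> \<theta>\<^sup>2" by simp
  then have "dist a b \<le> \<theta>" using \<theta>(1) by (rule power2_le_imp_le)
  then show ?thesis using assms by (simp add: geodesic_dist_def \<theta>_def)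
qed

lemma geodesic_dist_le_of_dist:
  assumes "0 < s"
  shows "\<exists>\<delta>>0. \<forall>a b :: 'a::real_inner. norm a = 1 \<and> norm b = 1 \<and> dist a b < \<delta> \<longrightarrow> geodesic_dist a b \<le> s"
proof -
  define s' where "s' = min s 1"
  have s': "0 < s'" "s' \<le> s" "s' \<le> 1" using assms by (auto simp: s'_def)
  have "s' < pi" using s'(3) pi_gt3 by linarith
  have "cos s' < cos 0" using s'(1) \<open>s' < pi\<close> by (intro cos_monotone_0_pi) auto
  then have c: "cos s' < 1" by simp
  define \<delta> where "\<delta> = sqrt (2 * (1 - cos s'))"
  have \<delta>: "0 < \<delta>" "\<delta>\<^sup>2 = 2 * (1 - cos s')" using c by (simp_all add: \<delta>_def)
  have "geodesic_dist a b \<le> s" if ab: "norm a = 1" "norm b = 1" "dist a b < \<delta>" for a b :: 'a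
  proof -
    have "(dist a b)\<^sup>2 = 2 - 2 * (a \<bullet> b)"
      by (rule dist_unit_vectors[OF ab(1,2)])
    moreover have "(dist a b)\<^sup>2 \<le> \<delta>\<^sup>2" using ab(3) by (intro power_mono) auto
    ultimately have "cos s' \<le> a \<bullet> b" using \<delta>(2) by simp
    then have "arccos (a \<bullet> b) \<le> arccos (cos s')"
      using inner_unit_bounds[OF ab(1,2)] by (intro arccos_le_arccos) auto
    also have "\<dots> = s'" using s'(1) \<open>s' < pi\<close> by (intro arccos_cos) auto
    finally show ?thesis using ab s'(2) by (simp add: geodesic_dist_def)
  qed
  then show ?thesis using \<delta>(1) by blast
qed

lemma closedin_geodesic:
  fixes C :: "'a::real_inner set"
  assumes "closed C" "C \<subseteq> sphere 0 1"
  shows "closedin (Metric_space.mtopology (sphere 0 1) geodesic_dist) C"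
  unfolding Metric_space.closedin_metric[OF Metric_space_geodesic_dist]
proof (intro conjI assms(2) allI impI)
  fix x assume x: "x \<in> sphere 0 1 - C"
  have "open (- C)" using assms(1) by (rule open_Compl)
  moreover have "x \<in> - C" using x by simp
  ultimately obtain r where r: "r > 0" "ball x r \<subseteq> - C" by (rule openE)
  have "disjnt C (Metric_space.mball (sphere 0 1) geodesic_dist x r)"
    unfolding disjnt_iff
  proof (intro allI notI)
    fix y assume y: "y \<in> C \<and> y \<in> Metric_space.mball (sphere 0 1) geodesic_dist x r"
    then have "norm x = 1" "norm y = 1" "geodesic_dist x y < r"
      using Metric_space.in_mball[OF Metric_space_geodesic_dist, of y x r] by auto
    then have "y \<in> ball x r" using norm_diff_le_geodesic_dist[of x y] by simp
    then show False using r(2) y by blast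
  qed
  then show "\<exists>r>0. disjnt C (Metric_space.mball (sphere 0 1) geodesic_dist x r)" using r(1) by blast
qed

text \<open>
  Finitely many hyperplanes do not cover the space.
\<close>

lemma vector_not_orthogonal_to_finite_set:
  fixes T :: "'a::euclidean_space set"
  assumes "finite T" "0 \<notin> T"
  obtains u :: 'a where "norm u = 1" "\<And>z. z \<in> T \<Longrightarrow> z \<bullet> u \<noteq> 0"
proof -
  have "negligible (\<Union>z\<in>T. {u. z \<bullet> u = 0})"
    using assms by (intro negligible_Union finite_imageI) (auto intro!: negligible_hyperplane)
  then have neg: "negligible ((\<Union>z\<in>T. {u. z \<bullet> u = 0}) \<union> {0})" by (intro negligible_Un) auto
  have "\<not> negligible (UNIV :: 'a set)" by (rule open_not_negligible) auto
  then have "(\<Union>z\<in>T. {u. z \<bullet> u = 0}) \<union> {0} \<noteq> UNIV" using neg by (metis (no_types))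
  then obtain v where v: "v \<noteq> 0" "\<And>z. z \<in> T \<Longrightarrow> z \<bullet> v \<noteq> 0" by auto
  show ?thesis
  proof (rule that[of "(1 / norm v) *\<^sub>R v"])
    show "norm ((1 / norm v) *\<^sub>R v) = 1" using v(1) by simp
    show "z \<bullet> (1 / norm v) *\<^sub>R v \<noteq> 0" if "z \<in> T" for z using v that by simp
  qed
qed

lemma nearby_sphere_points:
  fixes W :: "real ^ 'n::finite option \<Rightarrow> real ^ 'n option"
  assumes W: "linear W" "\<And>x. norm (W x) = norm x" and T: "finite T" and \<delta>: "0 < (\<delta>::real)"
  shows "\<exists>\<epsilon>>0. \<forall>v\<in>T. \<forall>v'. dist v v' < \<epsilon> \<longrightarrow>
     dist ((1 / norm (affine_pt v)) *\<^sub>R W (affine_pt v)) ((1 / norm (affine_pt v')) *\<^sub>R W (affine_pt v')) < \<delta>"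
proof -
  let ?\<psi> = "\<lambda>v. (1 / norm (affine_pt v)) *\<^sub>R W (affine_pt v)"
  have Wc: "continuous_on S W" for S
    using W(1) by (simp add: linear_continuous_on linear_conv_bounded_linear)
  have "continuous_on UNIV ?\<psi>"
    by (intro continuous_intros continuous_on_affine_pt continuous_on_compose2[OF Wc continuous_on_affine_pt])
       (auto simp: affine_pt_neq_0)
  then have "\<exists>e>0. \<forall>v'. dist v' v < e \<longrightarrow> dist (?\<psi> v') (?\<psi> v) < \<delta>" for v
    using \<delta> unfolding continuous_on_iff by blast
  then obtain e where e: "\<And>v. 0 < e v" "\<And>v v'. dist v' v < e v \<Longrightarrow> dist (?\<psi> v') (?\<psi> v) < \<delta>" by metis
  define \<epsilon> where "\<epsilon> = Min (insert 1 (e ` T))"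
  have \<epsilon>: "0 < \<epsilon>" "\<And>v. v \<in> T \<Longrightarrow> \<epsilon> \<le> e v" using T e(1) by (auto simp: \<epsilon>_def)
  show ?thesis
  proof (intro exI[of _ \<epsilon>] conjI \<epsilon>(1) ballI allI impI)
    fix v v' assume "v \<in> T" "dist v v' < \<epsilon>"
    then have "dist v' v < e v" using \<epsilon>(2)[of v] by (simp add: dist_commute)
    then show "dist (?\<psi> v) (?\<psi> v') < \<delta>" using e(2)[of v' v] by (simp only: dist_commute)
  qed
qed

text \<open>
  The hyperplane at infinity of the chart is chosen to avoid a finite net \<open>T0\<close> of \<open>Z\<close>; points of \<open>Z\<close> at
  infinity are then still approximated, through the net. The map \<open>\<psi>\<close> from the chart to the
  sphere reaches only a hemisphere, but the zero sets of forms are symmetric, so a net point in the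
  other hemisphere is approximated by an antipode. That the zeros of the system are near \<open>Z\<close> follows on
  the whole sphere at once, by homogeneity and compactness.
\<close>

lemma sphere_approximation_at_scale:
  fixes \<P> :: "('n::finite option) rpoly set"
  assumes P: "finite \<P>" "\<forall>P\<in>\<P>. homogeneous P" "\<forall>P\<in>\<P>. total_degree P \<le> d" and m: "Suc m \<le> CARD('n)"
    and Z: "Z = {x \<in> sphere 0 1. \<forall>P\<in>\<P>. eval_poly P x = 0}" and dim: "real_dim Z \<le> ereal (real m)" and s: "0 < s"
  shows "\<exists>G. (\<forall>i<CARD('n) - m. hom_poly (2 * d) (G i)) \<and> nonsingular_system {..<CARD('n) - m} G \<and>
     (\<forall>x\<in>sphere 0 1. (\<forall>i<CARD('n) - m. G i x = 0) \<longrightarrow> (\<exists>z\<in>Z. geodesic_dist z x \<le> s)) \<and>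
     (\<forall>z\<in>Z. \<exists>x\<in>sphere 0 1. (\<forall>i<CARD('n) - m. G i x = 0) \<and> geodesic_dist x z \<le> s)"
proof -
  let ?k = "CARD('n) - m"
  let ?S = "sphere (0 :: real ^ 'n option) 1"
  obtain \<delta> where \<delta>: "0 < \<delta>" "\<And>a b :: real ^ 'n option. norm a = 1 \<Longrightarrow> norm b = 1 \<Longrightarrow> dist a b < \<delta> \<Longrightarrow> geodesic_dist a b \<le> s"
  proof -
    from geodesic_dist_le_of_dist[OF s, where ?'a = "real ^ 'n option"]
    obtain \<delta> where "0 < \<delta>" and *: "\<forall>a b :: real ^ 'n option. norm a = 1 \<and> norm b = 1 \<and> dist a b < \<delta> \<longrightarrow> geodesic_dist a b \<le> s"
      by (elim exE conjE)
    show ?thesis by (rule that[OF \<open>0 < \<delta>\<close>]) (use * in simp)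
  qed
  have \<delta>2: "0 < \<delta> / 2" using \<delta>(1) by simp
  obtain H0 :: "real ^ 'n option \<Rightarrow> real" where H0: "hom_poly (2 * d) H0" "\<And>x. 0 \<le> H0 x"
    "\<And>x. x \<noteq> 0 \<Longrightarrow> H0 x = 0 \<longleftrightarrow> (\<forall>P\<in>\<P>. eval_poly P x = 0)"
    by (rule sum_of_squares_form[OF P linear_ident]) (rule that)
  have ZH: "x \<in> Z \<longleftrightarrow> norm x = 1 \<and> H0 x = 0" for x
  proof -
    have "H0 x = 0 \<longleftrightarrow> (\<forall>P\<in>\<P>. eval_poly P x = 0)" if "norm x = 1"
    proof (rule H0(3))
      show "x \<noteq> 0" using that by (intro notI) simp
    qed
    then show ?thesis unfolding Z mem_Collect_eq mem_sphere_0 by (rule conj_cong[OF refl, symmetric])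
  qed
  have "Z = ?S \<inter> {x. H0 x = 0}" unfolding set_eq_iff Int_iff ZH mem_sphere_0 mem_Collect_eq by simp
  moreover have "closed {x. H0 x = 0}" by (intro closed_Collect_eq hom_poly_continuous_on[OF H0(1)] continuous_on_const)
  ultimately have cZ: "compact Z" by (simp only: compact_Int_closed[OF compact_sphere])
  obtain T0 where T0: "finite T0" "T0 \<subseteq> Z" "\<And>x. x \<in> Z \<Longrightarrow> \<exists>y\<in>T0. dist y x < \<delta> / 2"
    by (rule finite_net[OF cZ \<delta>2]) (rule that)
  have "0 \<notin> Z" unfolding ZH by simp
  then have "0 \<notin> T0" using T0(2) by (rule contra_subsetD[rotated])
  then obtain u where u: "norm u = 1" "\<And>z. z \<in> T0 \<Longrightarrow> z \<bullet> u \<noteq> 0"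
    by (rule vector_not_orthogonal_to_finite_set[OF T0(1)]) (rule that)
  have "norm u = norm (axis None (1::real) :: real ^ 'n option)" using u(1) by simp
  then obtain U :: "real ^ 'n option \<Rightarrow> real ^ 'n option" where U: "orthogonal_transformation U" "U u = axis None 1"
    by (rule orthogonal_transformation_exists)
  define W where "W = inv_into UNIV U"
  note W = orthogonal_transformation_inv_props[OF U(1), folded W_def]
  have linU: "linear U" using U(1) by (rule orthogonal_transformation_linear)
  have normU: "norm (U x) = norm x" for x using U(1) by (rule orthogonal_transformation_norm)
  have UNone: "U z $ None = z \<bullet> u" for z
  proof -
    have "U z \<bullet> U u = z \<bullet> u" using U(1) by (simp add: orthogonal_transformation_def)
    then show ?thesis by (simp add: U(2) inner_axis)
  qed
  define H where "H x = H0 (W x)" for x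
  have H: "hom_poly (2 * d) H" "\<And>x. 0 \<le> H x"
    unfolding H_def using hom_poly_compose_linear[OF H0(1) W(1)] H0(2) by auto
  define \<psi> where "\<psi> v = (1 / norm (affine_pt v)) *\<^sub>R W (affine_pt v)" for v
  have n\<psi>: "norm (\<psi> v) = 1" for v using affine_pt_neq_0[of v] by (simp add: \<psi>_def W(4))
  have H\<psi>: "H0 (\<psi> v) = (1 / norm (affine_pt v)) ^ (2 * d) * H (affine_pt v)" for v
    by (simp add: \<psi>_def H_def hom_poly_scale[OF H0(1)])
  have th: "thin m {v. H (affine_pt v) = 0}"
  proof (rule thin_of_real_dim_cone[OF dim linU])
    show "continuous_on {v. H (affine_pt v) = 0} \<psi>"
      unfolding \<psi>_def
      by (intro continuous_intros continuous_on_affine_pt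
          continuous_on_compose2[OF linear_continuous_on[OF linear_conv_bounded_linear[THEN iffD1, OF W(1)], of UNIV] continuous_on_affine_pt])
         (auto simp: affine_pt_neq_0)
    show "continuous_on {v. H (affine_pt v) = 0} (\<lambda>v. norm (affine_pt v))"
      by (intro continuous_intros continuous_on_affine_pt)
    show "\<psi> v \<in> Z" if "v \<in> {v. H (affine_pt v) = 0}" for v
      using that unfolding ZH by (simp add: n\<psi> H\<psi>)
    show "1 \<le> norm (affine_pt v)" for v :: "real ^ 'n" by (rule norm_affine_pt_ge_1)
    show "norm (affine_pt v) *\<^sub>R U (\<psi> v) = affine_pt v" for v
      using affine_pt_neq_0[of v] by (simp add: \<psi>_def linear_scale[OF linU] W(2))
  qed
  define ch where "ch z = (\<chi> i. U z $ Some i / U z $ None)" for z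
  have chart: "U z = U z $ None *\<^sub>R affine_pt (ch z)" "U z $ None \<noteq> 0" if "z \<in> T0" for z
  proof -
    show nz: "U z $ None \<noteq> 0" using u(2)[OF that] by (simp add: UNone)
    show "U z = U z $ None *\<^sub>R affine_pt (ch z)" unfolding ch_def by (rule scaled_affine_pt[OF nz])
  qed
  have zch: "z = sgn (U z $ None) *\<^sub>R \<psi> (ch z)" if z: "z \<in> T0" for z
  proof -
    define c where "c = U z $ None"
    have Uz: "U z = c *\<^sub>R affine_pt (ch z)" and c: "c \<noteq> 0" using chart[OF z] by (simp_all add: c_def)
    have "norm z = 1" using T0(2) z ZH by blast
    then have "\<bar>c\<bar> * norm (affine_pt (ch z)) = 1" using normU[of z] unfolding Uz by simp
    moreover have "norm (affine_pt (ch z)) \<noteq> 0" using affine_pt_neq_0[of "ch z"] by simp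
    ultimately have n: "1 / norm (affine_pt (ch z)) = \<bar>c\<bar>" by (simp add: nonzero_divide_eq_eq)
    have "z = W (U z)" by (simp add: W(3))
    also have "\<dots> = c *\<^sub>R W (affine_pt (ch z))" unfolding Uz by (rule linear_scale[OF W(1)])
    also have "\<dots> = (sgn c * \<bar>c\<bar>) *\<^sub>R W (affine_pt (ch z))" by (simp only: sgn_mult_abs)
    also have "\<dots> = sgn c *\<^sub>R \<psi> (ch z)" unfolding \<psi>_def n by simp
    finally show ?thesis by (simp only: c_def)
  qed
  have TH: "H (affine_pt v) = 0" if v: "v \<in> ch ` T0" for v
  proof -
    obtain z where z: "z \<in> T0" "v = ch z" using v by blast
    have "H0 z = 0" using T0(2) z(1) ZH by blast
    moreover have "H (U z) = H0 z" by (simp add: H_def W(3))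
    ultimately have "H (U z $ None *\<^sub>R affine_pt v) = 0" using chart(1)[OF z(1)] by (simp only: z(2))
    then show ?thesis using chart(2)[OF z(1)] by (simp add: hom_poly_scale[OF H(1)])
  qed
  have finT: "finite (ch ` T0)" using T0(1) by simp
  obtain \<epsilon> where \<epsilon>: "0 < \<epsilon>" "\<And>v v'. v \<in> ch ` T0 \<Longrightarrow> dist v v' < \<epsilon> \<Longrightarrow> dist (\<psi> v) (\<psi> v') < \<delta> / 2"
    using nearby_sphere_points[OF W(1) W(4) finT \<delta>2] unfolding \<psi>_def by blast
  have HU: "continuous_on S (\<lambda>x. H0 x)" for S by (rule hom_poly_continuous_on[OF H0(1)])
  have "\<exists>t>0. \<forall>v\<in>?S. H0 v \<le> 2 * t * 1 \<longrightarrow> (\<exists>u\<in>?S. H0 u = 0 \<and> dist u v < \<delta>)"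
    by (rule sublevel_near_zeros[OF compact_sphere HU continuous_on_const]) (use H0(2) \<delta>(1) in auto)
  then obtain t1 where t1: "0 < t1" "\<And>v. norm v = 1 \<Longrightarrow> H0 v \<le> 2 * t1 \<Longrightarrow> \<exists>u\<in>?S. H0 u = 0 \<and> dist u v < \<delta>"
    by auto
  obtain t0 where t0: "0 < t0" and ex: "\<forall>t. 0 < t \<and> t < t0 \<longrightarrow> (\<exists>G. (\<forall>i<?k. hom_poly (2 * d) (G i)) \<and>
     nonsingular_system {..<?k} G \<and>
     (\<forall>x. (\<forall>i<?k. G i x = 0) \<longrightarrow> H x \<le> 2 * t * norm x ^ (2 * d)) \<and>
     (\<forall>v\<in>ch ` T0. \<exists>v'. dist v v' < \<epsilon> \<and> (\<forall>i<?k. G i (affine_pt v') = 0)))"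
    using nonsingular_approximation[OF H th m finT TH \<epsilon>(1)] by blast
  define t where "t = min t1 (t0 / 2)"
  have t: "0 < t" "t < t0" "t \<le> t1" using t0 t1(1) by (auto simp: t_def)
  with ex obtain G where G: "\<forall>i<?k. hom_poly (2 * d) (G i)" "nonsingular_system {..<?k} G"
     "\<forall>x. (\<forall>i<?k. G i x = 0) \<longrightarrow> H x \<le> 2 * t * norm x ^ (2 * d)"
     "\<forall>v\<in>ch ` T0. \<exists>v'. dist v v' < \<epsilon> \<and> (\<forall>i<?k. G i (affine_pt v') = 0)" by blast
  show ?thesis
  proof (intro exI[of _ "\<lambda>i x. G i (U x)"] conjI)
    show "\<forall>i<?k. hom_poly (2 * d) (\<lambda>x. G i (U x))"
      using G(1) hom_poly_compose_linear[OF _ linU] by blast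
    show "nonsingular_system {..<?k} (\<lambda>i x. G i (U x))"
      by (rule nonsingular_system_compose_linear[OF G(2,1) linU W(2,3,1)])
    show "\<forall>x\<in>sphere 0 1. (\<forall>i<?k. G i (U x) = 0) \<longrightarrow> (\<exists>z\<in>Z. geodesic_dist z x \<le> s)"
    proof (intro ballI impI)
      fix x :: "real ^ 'n option" assume x: "x \<in> sphere 0 1" and zero: "\<forall>i<?k. G i (U x) = 0"
      have nx: "norm x = 1" using x by simp
      have "H (U x) \<le> 2 * t * norm (U x) ^ (2 * d)" using G(3) zero by blast
      then have "H0 x \<le> 2 * t1" using t(3) by (simp add: H_def W(3) normU nx)
      then obtain z where z: "norm z = 1" "H0 z = 0" "dist z x < \<delta>" using t1(2)[OF nx] by auto
      then have "z \<in> Z" using ZH by simp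
      moreover have "geodesic_dist z x \<le> s" by (rule \<delta>(2)[OF z(1) nx z(3)])
      ultimately show "\<exists>z\<in>Z. geodesic_dist z x \<le> s" by blast
    qed
    show "\<forall>z\<in>Z. \<exists>x\<in>sphere 0 1. (\<forall>i<?k. G i (U x) = 0) \<and> geodesic_dist x z \<le> s"
    proof
      fix z0 assume z0: "z0 \<in> Z"
      then obtain z where z: "z \<in> T0" "dist z z0 < \<delta> / 2" using T0(3) by blast
      then obtain v' where v': "dist (ch z) v' < \<epsilon>" "\<forall>i<?k. G i (affine_pt v') = 0" using G(4) by blast
      define \<sigma> where "\<sigma> = sgn (U z $ None)"
      have \<sigma>: "\<bar>\<sigma>\<bar> = 1" using chart(2)[OF z(1)] by (simp add: \<sigma>_def abs_sgn_eq)
      define x where "x = \<sigma> *\<^sub>R \<psi> v'"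
      have nx: "norm x = 1" by (simp add: x_def \<sigma> n\<psi>)
      have "U x = (\<sigma> / norm (affine_pt v')) *\<^sub>R affine_pt v'"
        by (simp add: x_def \<psi>_def linear_scale[OF linU] W(2))
      then have "G i (U x) = 0" if "i < ?k" for i
        using v'(2) that hom_poly_scale[OF G(1)[rule_format, OF that]] by simp
      then have "\<forall>i<?k. G i (U x) = 0" by blast
      moreover have "geodesic_dist x z0 \<le> s"
      proof (rule \<delta>(2)[OF nx])
        show "norm z0 = 1" using z0 ZH by blast
        have "dist z x = norm (\<sigma> *\<^sub>R (\<psi> (ch z) - \<psi> v'))"
          unfolding x_def dist_norm scaleR_diff_right \<sigma>_def by (subst zch[OF z(1)]) (rule refl)
        also have "\<dots> = dist (\<psi> (ch z)) (\<psi> v')" by (simp add: \<sigma> dist_norm)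
        also have "\<dots> < \<delta> / 2" by (rule \<epsilon>(2)) (use z(1) v'(1) in auto)
        finally show "dist x z0 < \<delta>" using z(2) dist_triangle[of x z0 z] by (simp add: dist_commute)
      qed
      ultimately show "\<exists>x\<in>sphere 0 1. (\<forall>i<?k. G i (U x) = 0) \<and> geodesic_dist x z0 \<le> s"
        using nx by (intro bexI[of _ x]) auto
    qed
  qed
qed

lemma sphere_family:
  fixes \<P> :: "('n::finite option) rpoly set"
  assumes P: "finite \<P>" "\<forall>P\<in>\<P>. homogeneous P" "\<forall>P\<in>\<P>. total_degree P \<le> d" and m: "Suc m \<le> CARD('n)"
    and Z: "Z = {x \<in> sphere 0 1. \<forall>P\<in>\<P>. eval_poly P x = 0}" and dim: "real_dim Z \<le> ereal (real m)"
  shows "\<exists>Zt :: real \<Rightarrow> (real ^ 'n option) set. \<exists>t0>0.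
           (\<forall>t>0. algebraic_set (Zt t) \<and> Zt t \<subseteq> sphere 0 1) \<and>
           (\<forall>t. 0 < t \<and> t < t0 \<longrightarrow>
              (\<exists>Q. (\<forall>i<CARD('n) - m. homogeneous (Q i) \<and> total_degree (Q i) \<le> 2 * d) \<and>
                   nonsingular_ci_sphere (CARD('n) - m) Q (Zt t))) \<and>
           (\<exists>C0. hausdorff_limit (sphere 0 1) geodesic_dist Zt C0 \<and> Z \<subseteq> C0)"
proof -
  let ?k = "CARD('n) - m"
  have "\<forall>s. \<exists>G. 0 < s \<longrightarrow> ((\<forall>i<?k. hom_poly (2 * d) (G i)) \<and> nonsingular_system {..<?k} G \<and>
     (\<forall>x\<in>sphere 0 1. (\<forall>i<?k. G i x = 0) \<longrightarrow> (\<exists>z\<in>Z. geodesic_dist z x \<le> s)) \<and>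
     (\<forall>z\<in>Z. \<exists>x\<in>sphere 0 1. (\<forall>i<?k. G i x = 0) \<and> geodesic_dist x z \<le> s))"
    using sphere_approximation_at_scale[OF P m Z dim] by blast
  from choice[OF this] obtain G where G: "\<forall>s. 0 < s \<longrightarrow> ((\<forall>i<?k. hom_poly (2 * d) (G s i)) \<and> nonsingular_system {..<?k} (G s) \<and>
     (\<forall>x\<in>sphere 0 1. (\<forall>i<?k. G s i x = 0) \<longrightarrow> (\<exists>z\<in>Z. geodesic_dist z x \<le> s)) \<and>
     (\<forall>z\<in>Z. \<exists>x\<in>sphere 0 1. (\<forall>i<?k. G s i x = 0) \<and> geodesic_dist x z \<le> s))" ..
  define Zt where "Zt t = {x \<in> sphere 0 1. \<forall>i<?k. G t i x = 0}" for t
  have ci: "\<exists>Q. (\<forall>i<?k. homogeneous (Q i) \<and> total_degree (Q i) \<le> 2 * d) \<and> (\<forall>i<?k. eval_poly (Q i) = G t i) \<and>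
      nonsingular_ci_sphere ?k Q (Zt t)" if t: "0 < t" for t
  proof -
    have "nonsingular_system {..<?k} (G t)" "\<forall>i<?k. hom_poly (2 * d) (G t i)" using G t by blast+
    then obtain q where "\<forall>i<?k. homogeneous (q i) \<and> total_degree (q i) \<le> 2 * d" "\<forall>i<?k. eval_poly (q i) = G t i"
      "nonsingular_ci_sphere ?k q {x \<in> sphere 0 1. \<forall>i<?k. G t i x = 0}"
      by (rule nonsingular_ci_sphere_of_system) (rule that)
    then show ?thesis unfolding Zt_def by (intro exI[of _ q] conjI)
  qed
  have sphere_poly: "\<exists>p. \<forall>x :: real ^ 'n option. eval_poly p x = 0 \<longleftrightarrow> norm x = 1"
  proof -
    obtain p :: "('n option) rpoly" where p: "eval_poly p = (\<lambda>x. norm x ^ (2 * 1))"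
      by (rule hom_poly_rpoly[OF hom_poly_norm_power[of 1]]) (rule that)
    have "eval_poly (p + - 1) x = (norm x)\<^sup>2 - 1" for x
      by (simp only: eval_poly_add eval_poly_minus eval_poly_one p) simp
    moreover have "(norm x)\<^sup>2 - 1 = 0 \<longleftrightarrow> norm x = 1" for x :: "real ^ 'n option"
      by (simp add: abs_square_eq_1)
    ultimately have "eval_poly (p + - 1) x = 0 \<longleftrightarrow> norm x = 1" for x by (simp only:)
    then show ?thesis by (intro exI[of _ "p + - 1"] allI)
  qed
  have alg: "algebraic_set (Zt t)" if t: "0 < t" for t
  proof -
    obtain p :: "('n option) rpoly" where p: "\<And>x. eval_poly p x = 0 \<longleftrightarrow> norm x = 1" using sphere_poly by blast
    obtain Q where Q: "\<forall>i<?k. eval_poly (Q i) = G t i" using ci[OF t] by blast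
    have "Zt t = {x. \<forall>q\<in>insert p (Q ` {..<?k}). eval_poly q x = 0}"
      using p Q by (auto simp: Zt_def)
    then show ?thesis unfolding algebraic_set_def by (intro exI[of _ "insert p (Q ` {..<?k})"]) simp
  qed
  have closed: "closed (Zt t)" if t: "0 < t" for t
  proof -
    have "Zt t = sphere 0 1 \<inter> (\<Inter>i\<in>{..<?k}. {x. G t i x = 0})" by (auto simp: Zt_def)
    moreover have "closed {x. G t i x = 0}" if "i < ?k" for i
    proof -
      have "hom_poly (2 * d) (G t i)" using G t that by blast
      then show ?thesis by (intro closed_Collect_eq hom_poly_continuous_on continuous_on_const)
    qed
    ultimately show ?thesis by (auto intro!: closed_Int closed_INT)
  qed
  have closedZ: "closed Z"
  proof -
    have "Z = sphere 0 1 \<inter> (\<Inter>P\<in>\<P>. {x. eval_poly P x = 0})" by (auto simp: Z)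
    then show ?thesis by (auto intro!: closed_Int closed_INT closed_Collect_eq eval_poly_continuous_on continuous_on_const)
  qed
  have sub: "Zt t \<subseteq> sphere 0 1" "Z \<subseteq> sphere 0 1" for t by (auto simp: Zt_def Z)
  have mem: "y \<in> closed_nbhd (sphere 0 1) geodesic_dist C e"
    if "x \<in> C" "geodesic_dist x y \<le> e" "x \<in> sphere 0 1" "y \<in> sphere 0 1" for x y :: "real ^ 'n option" and C e
    using that Metric_space.in_mcball[OF Metric_space_geodesic_dist, of y x e]
    unfolding closed_nbhd_def by blast
  have "hausdorff_limit (sphere 0 1) geodesic_dist Zt Z"
    unfolding hausdorff_limit_def
  proof (intro conjI allI impI)
    show "closedin (Metric_space.mtopology (sphere 0 1) geodesic_dist) (Zt t)" if "0 < t" for t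
      by (rule closedin_geodesic[OF closed[OF that] sub(1)])
    show "closedin (Metric_space.mtopology (sphere 0 1) geodesic_dist) Z"
      by (rule closedin_geodesic[OF closedZ sub(2)])
    fix e :: real assume e: "0 < e"
    show "\<exists>te>0. \<forall>t. 0 < t \<and> t < te \<longrightarrow> Zt t \<subseteq> closed_nbhd (sphere 0 1) geodesic_dist Z e \<and>
        Z \<subseteq> closed_nbhd (sphere 0 1) geodesic_dist (Zt t) e"
    proof (intro exI[of _ e] conjI e allI impI subsetI)
      fix t x assume t: "0 < t \<and> t < e" and x: "x \<in> Zt t"
      have "x \<in> sphere 0 1" "\<forall>i<?k. G t i x = 0" using x by (simp_all add: Zt_def)
      then obtain z where z: "z \<in> Z" "geodesic_dist z x \<le> t" using G t by blast
      have "geodesic_dist z x \<le> e" using z(2) t by linarith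
      then show "x \<in> closed_nbhd (sphere 0 1) geodesic_dist Z e"
        by (rule mem[OF z(1) _ subsetD[OF sub(2) z(1)] subsetD[OF sub(1) x]])
    next
      fix t z assume t: "0 < t \<and> t < e" and z: "z \<in> Z"
      then obtain x where x: "x \<in> sphere 0 1" "\<forall>i<?k. G t i x = 0" "geodesic_dist x z \<le> t" using G by blast
      have "x \<in> Zt t" using x(1,2) by (simp add: Zt_def)
      moreover have "geodesic_dist x z \<le> e" using x(3) t by linarith
      ultimately show "z \<in> closed_nbhd (sphere 0 1) geodesic_dist (Zt t) e"
        by (rule mem[OF _ _ x(1) subsetD[OF sub(2) z]])
    qed
  qed
  then have lim: "\<exists>C0. hausdorff_limit (sphere 0 1) geodesic_dist Zt C0 \<and> Z \<subseteq> C0" by blast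
  show ?thesis
  proof (intro exI[of _ Zt] exI[of _ "1 :: real"] conjI allI impI lim alg sub(1))
    show "\<exists>Q. (\<forall>i<?k. homogeneous (Q i) \<and> total_degree (Q i) \<le> 2 * d) \<and> nonsingular_ci_sphere ?k Q (Zt t)"
      if "0 < t \<and> t < 1" for t
      using ci[of t] that by blast
  qed simp_all
qed

theorem theorem2p10:
  fixes \<P> :: "('n::finite option) rpoly set"
    and d m :: nat
  assumes "finite \<P>"
    and "\<forall>P\<in>\<P>. homogeneous P"
    and "\<forall>P\<in>\<P>. total_degree P \<le> d"
    and "m \<le> CARD('n) - 1"
  shows
    "(\<forall>y U. \<forall>V :: (real ^ 'n) set.
        y \<in> proj_space \<and> adapted_coords y U \<and>
        V = affine_chart U ` (proj_zero_set \<P> - polar_hyperplane y) \<and>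
        real_dim V \<le> ereal (real m) \<longrightarrow>
        (\<exists>Vt :: real \<Rightarrow> (real ^ 'n) set. \<exists>t0>0.
           (\<forall>t>0. algebraic_set (Vt t)) \<and>
           (\<forall>t. 0 < t \<and> t < t0 \<longrightarrow>
              (\<exists>Q. (\<forall>i<CARD('n) - m. total_degree (Q i) \<le> 2 * d) \<and>
                   nonsingular_ci_affine (CARD('n) - m) Q (Vt t))) \<and>
           (\<forall>R>0. hausdorff_limit UNIV dist (\<lambda>t. Vt t \<inter> cball 0 R) (V \<inter> cball 0 R))))
     \<and>
     (\<forall>Z :: (real ^ 'n option) set.
        Z = {x \<in> sphere 0 1. \<forall>P\<in>\<P>. eval_poly P x = 0} \<and>
        real_dim Z \<le> ereal (real m) \<longrightarrow>
        (\<exists>Zt :: real \<Rightarrow> (real ^ 'n option) set. \<exists>t0>0.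
           (\<forall>t>0. algebraic_set (Zt t) \<and> Zt t \<subseteq> sphere 0 1) \<and>
           (\<forall>t. 0 < t \<and> t < t0 \<longrightarrow>
              (\<exists>Q. (\<forall>i<CARD('n) - m. homogeneous (Q i) \<and> total_degree (Q i) \<le> 2 * d) \<and>
                   nonsingular_ci_sphere (CARD('n) - m) Q (Zt t))) \<and>
           (\<exists>C0. hausdorff_limit (sphere 0 1) geodesic_dist Zt C0 \<and> Z \<subseteq> C0)))"
proof (intro conjI allI impI)
  have P: "finite \<P>" "\<forall>P\<in>\<P>. homogeneous P" "\<forall>P\<in>\<P>. total_degree P \<le> d" by fact+
  have "0 < CARD('n)" by simp
  with assms(4) have m: "Suc m \<le> CARD('n)" by linarith
  {
    fix y U and V :: "(real ^ 'n) set"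
    assume *: "y \<in> proj_space \<and> adapted_coords y U \<and>
        V = affine_chart U ` (proj_zero_set \<P> - polar_hyperplane y) \<and> real_dim V \<le> ereal (real m)"
    then have y: "y \<in> proj_space" and U: "adapted_coords y U" and dim: "real_dim V \<le> ereal (real m)" by blast+
    define W where "W = inv_into UNIV U"
    have "orthogonal_transformation U" using U by (simp add: adapted_coords_def)
    note W = orthogonal_transformation_inv_props(1)[OF this, folded W_def]
    have VW: "V = {v. \<forall>P\<in>\<P>. eval_poly P (W (affine_pt v)) = 0}"
      using * affine_chart_image[OF P(2) y U] by (simp only: W_def)
    obtain H :: "real ^ 'n option \<Rightarrow> real" where H: "hom_poly (2 * d) H" "\<And>x. 0 \<le> H x"
      "\<And>x. x \<noteq> 0 \<Longrightarrow> H x = 0 \<longleftrightarrow> (\<forall>P\<in>\<P>. eval_poly P (W x) = 0)"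
      by (rule sum_of_squares_form[OF P W]) (rule that)
    have V: "V = {v. H (affine_pt v) = 0}" unfolding VW by (simp only: H(3)[OF affine_pt_neq_0])
    show "\<exists>Vt :: real \<Rightarrow> (real ^ 'n) set. \<exists>t0>0.
           (\<forall>t>0. algebraic_set (Vt t)) \<and>
           (\<forall>t. 0 < t \<and> t < t0 \<longrightarrow>
              (\<exists>Q. (\<forall>i<CARD('n) - m. total_degree (Q i) \<le> 2 * d) \<and>
                   nonsingular_ci_affine (CARD('n) - m) Q (Vt t))) \<and>
           (\<forall>R>0. hausdorff_limit UNIV dist (\<lambda>t. Vt t \<inter> cball 0 R) (V \<inter> cball 0 R))"
      by (rule affine_family[OF H(1,2) thin_of_real_dim[OF dim] V m])
  }
  fix Z :: "(real ^ 'n option) set"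
  assume "Z = {x \<in> sphere 0 1. \<forall>P\<in>\<P>. eval_poly P x = 0} \<and> real_dim Z \<le> ereal (real m)"
  then have Z: "Z = {x \<in> sphere 0 1. \<forall>P\<in>\<P>. eval_poly P x = 0}" and dim: "real_dim Z \<le> ereal (real m)" by blast+
  show "\<exists>Zt :: real \<Rightarrow> (real ^ 'n option) set. \<exists>t0>0.
           (\<forall>t>0. algebraic_set (Zt t) \<and> Zt t \<subseteq> sphere 0 1) \<and>
           (\<forall>t. 0 < t \<and> t < t0 \<longrightarrow>
              (\<exists>Q. (\<forall>i<CARD('n) - m. homogeneous (Q i) \<and> total_degree (Q i) \<le> 2 * d) \<and>
                   nonsingular_ci_sphere (CARD('n) - m) Q (Zt t))) \<and>
           (\<exists>C0. hausdorff_limit (sphere 0 1) geodesic_dist Zt C0 \<and> Z \<subseteq> C0)"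
    by (rule sphere_family[OF P m Z dim])
qed

end
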